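(* For all constants $\alpha,\eta>0$ there exist constants $C^1_{\eta,\alpha},C^2_{\eta,\alpha}$ (depending only on $\eta,\alpha$) such that the following holds. Let $k\ge2$, and let $F_1,\dots,F_k$ be distributions on $[0,1]$ admitting densities $f_i$ with $\alpha\le f_i\le\eta$ on $[0,1]$. Let $\varepsilon\in(0,1)$, $\rho\in(0,1)$, and let $\{(Y_j,W_j)\}_{j=1}^n$ be $n$ i.i.d. observations from the second-price selection model on $\{f_i\}_{i=1}^k$. Then it is possible to learn in polynomial time cumulative distribution functions $\hat F_i$, $i\in[k]$, satisfying $$\sup_{x\in[0,1]}\big|\hat F_i(x)-F_i(x)\big|\le\varepsilon\qquad\text{with probability at least }1-\rho,$$ as long as $$\varepsilon\le e^{-C^1_{\eta,\alpha}k}\qquad\text{and}\qquad n\ge\left(\frac1\varepsilon\right)^{C^2_{\eta,\alpha}k}\log(1/\rho).$$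
   Context: Notation: $[k]=\{1,\dots,k\}$; $F_i$ also denotes the CDF of the $i$-th bid distribution. Second-price selection model on probability densities $\{f_i\}_{i=1}^k$ on $[0,1]$: an observation is generated by drawing $X_i\sim f_i$ independently for $i\in[k]$, setting $W=\arg\max_{i\in[k]}X_i$, and observing the tuple $(Y,W)$ where $Y=\max_{i\in[k]\setminus\{W\}}X_i$. "Polynomial time" means polynomial in the number $n$ of samples.
   Formalization: The sample-size condition uses max(1, log(1/ρ)) in place of log(1/ρ); with log(1/ρ) the claim is false for ρ very close to 1, where a single observation would have to suffice. Polynomial time is measured on a real-number machine with exact arithmetic. *)

theory Defs
  imports "HOL-Probability.Probability" "HOL-Computational_Algebra.Polynomial"
begin

section \<open>The second-price selection model\<close>

definition bounded_density :: "real \<Rightarrow> real \<Rightarrow> (real \<Rightarrow> real) \<Rightarrow> bool" where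
  "bounded_density \<alpha> \<eta> f \<longleftrightarrow>
     set_borel_measurable borel {0..1} f \<and>
     (\<forall>x\<in>{0..1}. \<alpha> \<le> f x \<and> f x \<le> \<eta>) \<and>
     (LBINT x:{0..1}. f x) = 1"

definition bid_law :: "(real \<Rightarrow> real) \<Rightarrow> real measure" where
  "bid_law f = density lborel (\<lambda>x. ennreal (indicator {0..1} x * f x))"

text \<open>Ties between bids have probability zero; they are broken towards the least index.\<close>

definition winner :: "nat \<Rightarrow> (nat \<Rightarrow> real) \<Rightarrow> nat" where
  "winner k X = (LEAST i. i \<in> {1..k} \<and> X i = Max (X ` {1..k}))"

definition second_price_obs :: "nat \<Rightarrow> (nat \<Rightarrow> real) \<Rightarrow> real \<times> nat" where
  "second_price_obs k X = (Max (X ` ({1..k} - {winner k X})), winner k X)"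

definition second_price_model :: "nat \<Rightarrow> (nat \<Rightarrow> real \<Rightarrow> real) \<Rightarrow> (real \<times> nat) measure" where
  "second_price_model k f =
     distr (PiM {1..k} (\<lambda>i. bid_law (f i))) (borel \<Otimes>\<^sub>M count_space UNIV) (second_price_obs k)"

definition iid_observations ::
    "nat \<Rightarrow> nat \<Rightarrow> (nat \<Rightarrow> real \<Rightarrow> real) \<Rightarrow> (nat \<Rightarrow> real \<times> nat) measure" where
  "iid_observations n k f = PiM {..<n} (\<lambda>_. second_price_model k f)"

text \<open>The sample sequences that can occur. They form a subset of full measure of the space of
  \<open>iid_observations n k f\<close>, whose underlying space also contains bids outside
  the unit interval and winners outside \<open>{1..k}\<close>.\<close>

definition sample_seqs :: "nat \<Rightarrow> nat \<Rightarrow> (nat \<Rightarrow> real \<times> nat) set" where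
  "sample_seqs n k = {..<n} \<rightarrow>\<^sub>E ({0..1} \<times> {1..k})"

definition is_cdf :: "(real \<Rightarrow> real) \<Rightarrow> bool" where
  "is_cdf F \<longleftrightarrow> (\<exists>M. real_distribution M \<and> F = cdf M)"


section \<open>The model of computation\<close>

text \<open>A structured real RAM. The memory consists of arrays of natural numbers and arrays of
  reals, with array names fixed in the program text and computed indices. Only addition and
  truncated subtraction are available on natural numbers (unit-cost multiplication would make
  the integer part too powerful), exact field arithmetic and comparison are available on reals
  (division by zero yields zero), and there is no rounding operation or other conversion from
  reals to natural numbers. Real constants in programs are rational, so that a program cannot
  carry an infinite amount of advice.\<close>

record memory =
  nats :: "nat \<Rightarrow> nat \<Rightarrow> nat"
  reals :: "nat \<Rightarrow> nat \<Rightarrow> real"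

datatype nexp =
    NConst nat
  | NGet nat nexp
  | NAdd nexp nexp
  | NSub nexp nexp

datatype rexp =
    RConst rat
  | RGet nat nexp
  | RAdd rexp rexp
  | RSub rexp rexp
  | RMul rexp rexp
  | RDiv rexp rexp

datatype test =
    NLess nexp nexp
  | RLess rexp rexp
  | Neg test
  | Conj test test

datatype prog =
    Skip
  | NSet nat nexp nexp
  | RSet nat nexp rexp
  | Seq prog prog
  | Cond test prog prog
  | Loop test prog

fun nval :: "nexp \<Rightarrow> memory \<Rightarrow> nat" where
  "nval (NConst c) s = c"
| "nval (NGet a e) s = nats s a (nval e s)"
| "nval (NAdd e1 e2) s = nval e1 s + nval e2 s"
| "nval (NSub e1 e2) s = nval e1 s - nval e2 s"

fun rval :: "rexp \<Rightarrow> memory \<Rightarrow> real" where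
  "rval (RConst c) s = of_rat c"
| "rval (RGet a e) s = reals s a (nval e s)"
| "rval (RAdd e1 e2) s = rval e1 s + rval e2 s"
| "rval (RSub e1 e2) s = rval e1 s - rval e2 s"
| "rval (RMul e1 e2) s = rval e1 s * rval e2 s"
| "rval (RDiv e1 e2) s = rval e1 s / rval e2 s"

fun test_holds :: "test \<Rightarrow> memory \<Rightarrow> bool" where
  "test_holds (NLess e1 e2) s \<longleftrightarrow> nval e1 s < nval e2 s"
| "test_holds (RLess e1 e2) s \<longleftrightarrow> rval e1 s < rval e2 s"
| "test_holds (Neg b) s \<longleftrightarrow> \<not> test_holds b s"
| "test_holds (Conj b1 b2) s \<longleftrightarrow> test_holds b1 s \<and> test_holds b2 s"

definition set_nat :: "nat \<Rightarrow> nat \<Rightarrow> nat \<Rightarrow> memory \<Rightarrow> memory" where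
  "set_nat a i v s = s\<lparr>nats := (nats s)(a := (nats s a)(i := v))\<rparr>"

definition set_real :: "nat \<Rightarrow> nat \<Rightarrow> real \<Rightarrow> memory \<Rightarrow> memory" where
  "set_real a i v s = s\<lparr>reals := (reals s)(a := (reals s a)(i := v))\<rparr>"

text \<open>\<open>exec c s t s'\<close>: started in memory \<open>s\<close>, the program \<open>c\<close> halts after \<open>t\<close> steps in
  memory \<open>s'\<close>. Every executed assignment and every evaluated test counts as one step; as the
  expressions in a program have a fixed size, this is the number of unit-cost operations up to a
  factor that depends only on the program.\<close>

inductive exec :: "prog \<Rightarrow> memory \<Rightarrow> nat \<Rightarrow> memory \<Rightarrow> bool" where
  Skip: "exec Skip s 1 s"
| NSet: "exec (NSet a i e) s 1 (set_nat a (nval i s) (nval e s) s)"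
| RSet: "exec (RSet a i e) s 1 (set_real a (nval i s) (rval e s) s)"
| Seq: "exec c1 s t1 s1 \<Longrightarrow> exec c2 s1 t2 s2 \<Longrightarrow> exec (Seq c1 c2) s (t1 + t2) s2"
| CondTrue: "test_holds b s \<Longrightarrow> exec c1 s t s1 \<Longrightarrow> exec (Cond b c1 c2) s (Suc t) s1"
| CondFalse: "\<not> test_holds b s \<Longrightarrow> exec c2 s t s1 \<Longrightarrow> exec (Cond b c1 c2) s (Suc t) s1"
| LoopFalse: "\<not> test_holds b s \<Longrightarrow> exec (Loop b c) s 1 s"
| LoopTrue: "test_holds b s \<Longrightarrow> exec c s t1 s1 \<Longrightarrow> exec (Loop b c) s1 t2 s2 \<Longrightarrow>
    exec (Loop b c) s (Suc (t1 + t2)) s2"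

inductive_cases exec_SkipE: "exec Skip s t s'"
inductive_cases exec_NSetE: "exec (NSet a i e) s t s'"
inductive_cases exec_RSetE: "exec (RSet a i e) s t s'"
inductive_cases exec_SeqE: "exec (Seq c1 c2) s t s'"
inductive_cases exec_CondE: "exec (Cond b c1 c2) s t s'"
inductive_cases exec_LoopE: "exec (Loop b c) s t s'"

lemma exec_deterministic:
  "exec c s t s1 \<Longrightarrow> exec c s t' s2 \<Longrightarrow> t' = t \<and> s2 = s1"
proof (induction arbitrary: t' s2 rule: exec.induct)
  case (Skip s)
  then show ?case by (rule exec_SkipE) simp
next
  case (NSet a i e s)
  then show ?case by (rule exec_NSetE) simp
next
  case (RSet a i e s)
  then show ?case by (rule exec_RSetE) simp
next
  case (Seq c1 s t1 s1 c2 t2 s2)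
  from Seq.prems show ?case by (rule exec_SeqE) (use Seq.IH in blast)
next
  case (CondTrue b s c1 t s1 c2)
  from CondTrue.prems show ?case by (rule exec_CondE) (use CondTrue in blast)+
next
  case (CondFalse b s c2 t s1 c1)
  from CondFalse.prems show ?case by (rule exec_CondE) (use CondFalse in blast)+
next
  case (LoopFalse b s c)
  from LoopFalse.prems show ?case by (rule exec_LoopE) (use LoopFalse.hyps in simp_all)
next
  case (LoopTrue b s c t1 s1 t2 s2)
  from LoopTrue.prems show ?case
    by (rule exec_LoopE) (use LoopTrue.hyps LoopTrue.IH in blast)+
qed

definition halts_within :: "prog \<Rightarrow> memory \<Rightarrow> nat \<Rightarrow> bool" where
  "halts_within c s T \<longleftrightarrow> (\<exists>t\<le>T. \<exists>s'. exec c s t s')"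

text \<open>Well defined for halting runs by \<open>exec_deterministic\<close>.\<close>

definition result :: "prog \<Rightarrow> memory \<Rightarrow> memory" where
  "result c s = (THE s'. \<exists>t. exec c s t s')"


section \<open>Learners\<close>

text \<open>Input convention: natural array 0 holds \<open>n\<close>, \<open>k\<close>, real array 0 holds \<open>\<epsilon>\<close>, \<open>\<rho>\<close>, real array 1
  holds the prices \<open>Y\<^sub>j\<close>, and natural array 1 the winners \<open>W\<^sub>j\<close>, for \<open>j < n\<close>. All other cells
  are zero.\<close>

definition learner_input ::
    "nat \<Rightarrow> nat \<Rightarrow> real \<Rightarrow> real \<Rightarrow> (nat \<Rightarrow> real \<times> nat) \<Rightarrow> memory" where
  "learner_input n k \<epsilon> \<rho> s =
     \<lparr>nats = (\<lambda>a j. if a = 0 \<and> j = 0 then n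
                   else if a = 0 \<and> j = 1 then k
                   else if a = 1 \<and> j < n then snd (s j)
                   else 0),
      reals = (\<lambda>a j. if a = 0 \<and> j = 0 then \<epsilon>
                    else if a = 0 \<and> j = 1 then \<rho>
                    else if a = 1 \<and> j < n then fst (s j)
                    else 0)\<rparr>"

text \<open>Output convention: a finite table describing \<open>k\<close> step functions. Cell 0 of natural array 2
  holds the number \<open>m\<close> of (not necessarily sorted) jump points, which are listed in real array 2;
  real array 3 holds the jump heights, where cell \<open>i * m + l\<close> is the height of the jump of
  the \<open>i\<close>-th function at the \<open>l\<close>-th point.\<close>

definition table_size :: "memory \<Rightarrow> nat" where
  "table_size s = nats s 2 0"

definition table_fun :: "memory \<Rightarrow> nat \<Rightarrow> real \<Rightarrow> real" where
  "table_fun s i x =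
     (\<Sum>l | l < table_size s \<and> reals s 2 l \<le> x. reals s 3 (i * table_size s + l))"

end

theory Submission
  imports Defs
begin

text \<open>Write \<open>H i\<close> for the product of the \<open>F j\<close> with \<open>j \<noteq> i\<close>. The law of the observation satisfies
  \<open>d P(W = i, Y \<le> x) = (1 - F i x) d H i x\<close>, and \<open>F i\<close> is recovered from the \<open>H j\<close> as \<open>P / H i\<close>, where
  \<open>P\<close>, the product of all \<open>F j\<close>, is the \<open>(k - 1)\<close>-st root of the product of all \<open>H j\<close>. The estimator
  is the Euler scheme for this differential equation, run with empirical cell frequencies on a grid of
  mesh \<open>\<epsilon>\<close> to the power \<open>c2 * k\<close>.

  The error analysis follows the relative error of \<open>H\<close>. In one step the new relative error is a
  convex combination of the old one and of the error of the factor \<open>1 / (1 - F i)\<close>, which is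
  at most \<open>8 F / (1 - F)\<close> times the old one. Since \<open>H i\<close> grows like the power \<open>k - 1\<close> of the
  position, the relative error contracts near 0: a crude start at \<open>\<epsilon>\<close> to the power \<open>c1\<close> with
  constant relative error suffices, so that only probabilities of order \<open>\<epsilon>\<close> to the power \<open>O(k)\<close>
  need to be resolved. Towards 1 the error expands by at most a power \<open>O(k)\<close> of \<open>1 / (1 - x)\<close>.
  In the remaining interval near 1, whose length is of order \<open>\<epsilon>\<close>, monotonicity of
  the output is enough.\<close>

section \<open>The estimator as a recursion over a grid\<close>

text \<open>Two devices keep \<open>k\<close> under control. Relative errors of the \<open>k\<close>
  factors \<open>H j\<close> multiply, but the root of order \<open>k - 1\<close> nearly undoes
  this: as \<open>k \<le> 2 * (k - 1)\<close>, an error \<open>A\<close> in every factor costs at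
  most a square of \<open>1 + A\<close> or \<open>1 - A\<close>. And the assumption on
  \<open>\<epsilon>\<close> enters as \<open>K ^ k \<le> y\<close> with
  \<open>y = 1 / \<epsilon>\<close>, so that a factor \<open>a ^ k\<close> with
  \<open>a \<le> K\<close> is absorbed into a single power of \<open>y\<close>; the error analysis
  then reduces to linear arithmetic with exponents of \<open>y\<close>. These exponents dictate the
  parameters. Contraction and expansion exponents, \<open>b\<close> and \<open>c\<close>, are both
  proportional to \<open>k - 1\<close>, hence a \<open>c1\<close> independent of \<open>k\<close>
  lets the first beat the second. From \<open>x0\<close> on, products of CDFs are at least
  \<open>Pm = (\<alpha> * x0) ^ k\<close>; the mesh \<open>1 / N\<close> must be small against this,
  which forces the factor \<open>k\<close> in its exponent and determines \<open>c2\<close> from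
  \<open>c1\<close>. Each cell frequency is required up to \<open>1 / N ^ 3\<close>, which costs a
  number of samples polynomial in \<open>N\<close>; conversely \<open>N \<le> n\<close>, so that
  loops over the grid are affordable.\<close>

text \<open>With last argument \<open>N\<close>: the \<open>m\<close>-th root of \<open>v\<close>, rounded up to a multiple of \<open>1 / N\<close> and capped
  at 1. The machine has no roots, so all multiples are tried.\<close>

primrec root_scan :: "nat \<Rightarrow> nat \<Rightarrow> real \<Rightarrow> nat \<Rightarrow> real" where
  "root_scan N m v 0 = 0"
| "root_scan N m v (Suc u) =
     (if (real u / real N) ^ m < v then (real u + 1) / real N else root_scan N m v u)"

definition cdf_est :: "real \<Rightarrow> nat \<Rightarrow> nat \<Rightarrow> nat \<Rightarrow> (nat \<Rightarrow> real) \<Rightarrow> nat \<Rightarrow> real" where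
  "cdf_est x0 N k t h i =
     (if real t / real N < x0 then 0 else root_scan N (k - 1) (\<Prod>j=1..k. h j) N / h i)"

text \<open>Here \<open>q i t\<close> is the observed frequency of winner \<open>i\<close> with a price in \<open>(t / N, (t + 1) / N]\<close>, and
  \<open>prod_est x0 N k q t i\<close> estimates \<open>H i (t / N)\<close>. Nothing prevents \<open>cdf_est\<close> from leaving the unit
  interval or from dividing by zero on atypical samples; only \<open>mono_est\<close> is output.\<close>

primrec prod_est ::
    "real \<Rightarrow> nat \<Rightarrow> nat \<Rightarrow> (nat \<Rightarrow> nat \<Rightarrow> real) \<Rightarrow> nat \<Rightarrow> nat \<Rightarrow> real" where
  "prod_est x0 N k q 0 = (\<lambda>i. 0)"
| "prod_est x0 N k q (Suc t) =
     (\<lambda>i. prod_est x0 N k q t i + q i t / (1 - cdf_est x0 N k t (prod_est x0 N k q t) i))"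

primrec mono_est ::
    "real \<Rightarrow> nat \<Rightarrow> nat \<Rightarrow> (nat \<Rightarrow> nat \<Rightarrow> real) \<Rightarrow> nat \<Rightarrow> nat \<Rightarrow> real" where
  "mono_est x0 N k q 0 = (\<lambda>i. 0)"
| "mono_est x0 N k q (Suc t) =
     (\<lambda>i. max (mono_est x0 N k q t i) (min 1 (cdf_est x0 N k t (prod_est x0 N k q t) i)))"

section \<open>The program\<close>

definition wp :: "prog \<Rightarrow> nat \<Rightarrow> (memory \<Rightarrow> bool) \<Rightarrow> memory \<Rightarrow> bool" where
  "wp c T Q s \<longleftrightarrow> (\<exists>t\<le>T. \<exists>s'. exec c s t s' \<and> Q s')"

lemma wp_mono: "wp c T P s \<Longrightarrow> (\<And>s'. P s' \<Longrightarrow> Q s') \<Longrightarrow> T \<le> T' \<Longrightarrow> wp c T' Q s"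
  unfolding wp_def by (meson le_trans)

text \<open>These rules and those for \<open>Seq\<close> are equivalences, so that the simplifier
  executes straight-line code symbolically. The budget is an upper bound and not an exact count,
  which lets branches of unequal cost share it.\<close>

lemma wp_Skip [simp]: "1 \<le> T \<Longrightarrow> wp Skip T Q s \<longleftrightarrow> Q s"
  unfolding wp_def by (blast intro: exec.intros elim: exec_SkipE)

lemma wp_NSet [simp]:
  "1 \<le> T \<Longrightarrow> wp (NSet a i e) T Q s \<longleftrightarrow> Q (set_nat a (nval i s) (nval e s) s)"
  unfolding wp_def by (blast intro: exec.intros elim: exec_NSetE)

lemma wp_RSet [simp]:
  "1 \<le> T \<Longrightarrow> wp (RSet a i e) T Q s \<longleftrightarrow> Q (set_real a (nval i s) (rval e s) s)"
  unfolding wp_def by (blast intro: exec.intros elim: exec_RSetE)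

lemma wp_Seq:
  assumes "wp c1 T1 R s" "\<And>s'. R s' \<Longrightarrow> wp c2 T2 Q s'" "T1 + T2 \<le> T"
  shows "wp (Seq c1 c2) T Q s"
proof -
  from assms(1) obtain t1 s1 where 1: "t1 \<le> T1" "exec c1 s t1 s1" "R s1"
    unfolding wp_def by blast
  with assms(2) obtain t2 s2 where 2: "t2 \<le> T2" "exec c2 s1 t2 s2" "Q s2"
    unfolding wp_def by blast
  have "t1 + t2 \<le> T" using 1 2 assms(3) by linarith
  then show ?thesis
    unfolding wp_def using exec.Seq[OF 1(2) 2(2)] 2(3) by blast
qed

lemma wp_Seq_NSet [simp]:
  assumes "2 \<le> T"
  shows "wp (Seq (NSet a i e) c) T Q s \<longleftrightarrow> wp c (T - 1) Q (set_nat a (nval i s) (nval e s) s)"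
proof
  assume "wp (Seq (NSet a i e) c) T Q s"
  then obtain t s' where t: "t \<le> T" "exec (Seq (NSet a i e) c) s t s'" "Q s'"
    unfolding wp_def by blast
  from t(2) show "wp c (T - 1) Q (set_nat a (nval i s) (nval e s) s)"
  proof (rule exec_SeqE)
    fix t1 s1 t2
    assume "t = t1 + t2" "exec (NSet a i e) s t1 s1" "exec c s1 t2 s'"
    then show ?thesis using t(1,3) unfolding wp_def by (auto elim!: exec_NSetE intro!: exI[of _ t2])
  qed
next
  assume "wp c (T - 1) Q (set_nat a (nval i s) (nval e s) s)"
  then show "wp (Seq (NSet a i e) c) T Q s"
    using assms by (intro wp_Seq[where ?T1.0 = 1 and ?T2.0 = "T - 1"
      and R = "\<lambda>s'. s' = set_nat a (nval i s) (nval e s) s"]) auto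
qed

lemma wp_Seq_RSet [simp]:
  assumes "2 \<le> T"
  shows "wp (Seq (RSet a i e) c) T Q s \<longleftrightarrow> wp c (T - 1) Q (set_real a (nval i s) (rval e s) s)"
proof
  assume "wp (Seq (RSet a i e) c) T Q s"
  then obtain t s' where t: "t \<le> T" "exec (Seq (RSet a i e) c) s t s'" "Q s'"
    unfolding wp_def by blast
  from t(2) show "wp c (T - 1) Q (set_real a (nval i s) (rval e s) s)"
  proof (rule exec_SeqE)
    fix t1 s1 t2
    assume "t = t1 + t2" "exec (RSet a i e) s t1 s1" "exec c s1 t2 s'"
    then show ?thesis using t(1,3) unfolding wp_def by (auto elim!: exec_RSetE intro!: exI[of _ t2])
  qed
next
  assume "wp c (T - 1) Q (set_real a (nval i s) (rval e s) s)"
  then show "wp (Seq (RSet a i e) c) T Q s"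
    using assms by (intro wp_Seq[where ?T1.0 = 1 and ?T2.0 = "T - 1"
      and R = "\<lambda>s'. s' = set_real a (nval i s) (rval e s) s"]) auto
qed

lemma wp_Cond:
  assumes "test_holds b s \<Longrightarrow> wp c1 T Q s" "\<not> test_holds b s \<Longrightarrow> wp c2 T Q s" "Suc T \<le> T'"
  shows "wp (Cond b c1 c2) T' Q s"
proof (cases "test_holds b s")
  case True
  with assms(1) obtain t s' where t: "t \<le> T" "exec c1 s t s'" "Q s'" unfolding wp_def by blast
  then have "Suc t \<le> T'" using assms(3) by linarith
  then show ?thesis unfolding wp_def using exec.CondTrue[OF True t(2)] t(3) by blast
next
  case False
  with assms(2) obtain t s' where t: "t \<le> T" "exec c2 s t s'" "Q s'" unfolding wp_def by blast
  then have "Suc t \<le> T'" using assms(3) by linarith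
  then show ?thesis unfolding wp_def using exec.CondFalse[OF False t(2)] t(3) by blast
qed

text \<open>The invariant is indexed by the number of completed iterations and \<open>M\<close> is
  fixed in advance, so one induction on the remaining iterations gives termination, correctness and
  the cost: body plus test each time, and 1 for the test that fails.\<close>

lemma wp_Loop_aux:
  assumes step: "\<And>j s. j < M \<Longrightarrow> I j s \<Longrightarrow> test_holds b s \<and> wp c T (I (Suc j)) s"
    and stop: "\<And>s. I M s \<Longrightarrow> \<not> test_holds b s"
  shows "j \<le> M \<Longrightarrow> I j s \<Longrightarrow> wp (Loop b c) ((M - j) * Suc T + 1) (I M) s"
proof (induction "M - j" arbitrary: j s)
  case 0
  then have "j = M" by simp
  then show ?case using 0 stop exec.LoopFalse unfolding wp_def by fastforce
next
  case (Suc d)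
  then have j: "j < M" by simp
  from step[OF j Suc.prems(2)] obtain t1 s1
    where 1: "test_holds b s" "t1 \<le> T" "exec c s t1 s1" "I (Suc j) s1"
    unfolding wp_def by blast
  have "d = M - Suc j" using Suc.hyps(2) by simp
  from Suc.hyps(1)[OF this _ 1(4)] j obtain t2 s2
    where 2: "t2 \<le> (M - Suc j) * Suc T + 1" "exec (Loop b c) s1 t2 s2" "I M s2"
    unfolding wp_def by auto
  have "M - j = Suc (M - Suc j)" using j by simp
  then have "(M - j) * Suc T = Suc T + (M - Suc j) * Suc T" by simp
  then have "Suc (t1 + t2) \<le> (M - j) * Suc T + 1" using 1(2) 2(1) by linarith
  then show ?case
    unfolding wp_def using exec.LoopTrue[OF 1(1,3) 2(2)] 2(3) by blast
qed

lemma wp_Loop: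
  assumes "I 0 s"
    and "\<And>j s. j < M \<Longrightarrow> I j s \<Longrightarrow> test_holds b s \<and> wp c T (I (Suc j)) s"
    and "\<And>s. I M s \<Longrightarrow> \<not> test_holds b s"
    and "\<And>s. I M s \<Longrightarrow> Q s"
    and "M * Suc T + 1 \<le> T'"
  shows "wp (Loop b c) T' Q s"
  using wp_Loop_aux[where I = I and M = M and j = 0, OF assms(2,3) _ assms(1)] assms(4,5)
  by (auto intro: wp_mono)

lemma get_set [simp]:
  "nats (set_nat a i v s) = (nats s)(a := (nats s a)(i := v))"
  "reals (set_nat a i v s) = reals s"
  "nats (set_real a i r s) = nats s"
  "reals (set_real a i r s) = (reals s)(a := (reals s a)(i := r))"
  by (simp_all add: set_nat_def set_real_def)

text \<open>A frame condition: \<open>A\<close> and \<open>B\<close> list the arrays of naturals and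
  of reals that a program may modify.\<close>

definition same :: "nat set \<Rightarrow> nat set \<Rightarrow> memory \<Rightarrow> memory \<Rightarrow> bool" where
  "same A B s s' \<longleftrightarrow> (\<forall>a. a \<notin> A \<longrightarrow> nats s' a = nats s a) \<and> (\<forall>b. b \<notin> B \<longrightarrow> reals s' b = reals s b)"

lemma same_refl [simp]: "same A B s s" by (simp add: same_def)

lemma sameD: 
  "same A B s s' \<Longrightarrow> a \<notin> A \<Longrightarrow> nats s' a = nats s a"
  "same A B s s' \<Longrightarrow> b \<notin> B \<Longrightarrow> reals s' b = reals s b"
  by (auto simp: same_def)

lemma same_trans: "same A B s s' \<Longrightarrow> same A' B' s' s'' \<Longrightarrow> A \<subseteq> C \<Longrightarrow> A' \<subseteq> C \<Longrightarrow> B \<subseteq> D \<Longrightarrow> B' \<subseteq> D \<Longrightarrow> same C D s s''"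
  unfolding same_def by (metis subsetD)

section \<open>Program text and specifications of its components\<close>

abbreviation nv :: "nat \<Rightarrow> nexp" where "nv a \<equiv> NGet a (NConst 0)"
abbreviation rv :: "nat \<Rightarrow> rexp" where "rv a \<equiv> RGet a (NConst 0)"
abbreviation nset :: "nat \<Rightarrow> nexp \<Rightarrow> prog" where "nset a e \<equiv> NSet a (NConst 0) e"
abbreviation rset :: "nat \<Rightarrow> rexp \<Rightarrow> prog" where "rset a e \<equiv> RSet a (NConst 0) e"
abbreviation incr :: "nat \<Rightarrow> prog" where "incr a \<equiv> nset a (NAdd (nv a) (NConst 1))"
abbreviation rincr :: "nat \<Rightarrow> prog" where "rincr a \<equiv> rset a (RAdd (rv a) (RConst 1))"
abbreviation num_samples :: nexp where "num_samples \<equiv> nv 0"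
abbreviation num_bidders :: nexp where "num_bidders \<equiv> NGet 0 (NConst 1)"

primrec rpow :: "rexp \<Rightarrow> nat \<Rightarrow> rexp" where
  "rpow e 0 = RConst 1"
| "rpow e (Suc c) = RMul e (rpow e c)"

lemma rval_rpow [simp]: "rval (rpow e c) s = rval e s ^ c"
  by (induction c) simp_all

text \<open>Scratch cells (index 0 unless stated otherwise). Natural arrays: 3 = \<open>N\<close>, 4 = \<open>t\<close>, 5 and 6 = inner
  loop counters, 7 = position in the output table. Real arrays: 4 = target grid size, 5 = \<open>N\<close>, 6 = \<open>n\<close>,
  7 at \<open>i\<close> = \<open>prod_est\<close>, 8 at \<open>i\<close> = \<open>mono_est\<close>, 9 = product of the \<open>prod_est\<close>, 10 = its root,
  11 = power, 12 = cell count, 13 = \<open>cdf_est\<close>, 14 = \<open>t\<close>, 15 = candidate for the root, 16 = next \<open>mono_est\<close>.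
  Since reals cannot be converted, \<open>N\<close>, \<open>n\<close> and \<open>t\<close> are counted in both types.\<close>

definition grid_prog :: "nat \<Rightarrow> prog" where
  "grid_prog c =
     Seq (rset 4 (RConst 1)) (Seq (nset 5 (NConst 0))
     (Seq (Loop (NLess (nv 5) num_bidders)
        (Seq (rset 4 (RMul (rv 4) (RDiv (RConst 1) (rpow (rv 0) c)))) (incr 5)))
     (Seq (rset 5 (RConst 0)) (Seq (nset 3 (NConst 0))
     (Seq (Loop (RLess (rv 5) (rv 4)) (Seq (rincr 5) (incr 3)))
     (Seq (rset 6 (RConst 0)) (Seq (nset 5 (NConst 0))
     (Loop (NLess (nv 5) num_samples) (Seq (rincr 6) (incr 5))))))))))"

text \<open>The nested power follows the program: \<open>c\<close> is a constant of the program
  text, whereas \<open>k\<close> is input and needs a loop.\<close>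

definition grid_size :: "nat \<Rightarrow> nat \<Rightarrow> real \<Rightarrow> nat" where
  "grid_size c k \<epsilon> = nat \<lceil>(1 / \<epsilon> ^ c) ^ k\<rceil>"

text \<open>The ceiling is found by counting in both number types until the real counter is no
  longer below \<open>?D\<close>. This takes \<open>N\<close> rounds, one reason why
  \<open>N\<close> has to be polynomial in the number of samples.\<close>

lemma grid_prog_wp:
  assumes "nats s 0 0 = n" "nats s 0 1 = k" "reals s 0 0 = \<epsilon>"
  assumes N: "N = grid_size c k \<epsilon>"
  shows "wp (grid_prog c) (20 + 3 * k + 3 * N + 3 * n)
    (\<lambda>s'. same {3,5} {4,5,6} s s' \<and> nats s' 3 0 = N \<and> reals s' 5 0 = N \<and> reals s' 6 0 = n) s"
proof -
  let ?D = "(1 / \<epsilon> ^ c) ^ k"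
  define I1 where "I1 = (\<lambda>j s'. same {5} {4} s s' \<and> nats s' 5 0 = j \<and> reals s' 4 0 = (1 / \<epsilon> ^ c) ^ j)"
  define I2 where "I2 = (\<lambda>j s'. same {3,5} {4,5} s s' \<and> nats s' 3 0 = j \<and> reals s' 4 0 = ?D \<and> reals s' 5 0 = real j)"
  define I3 where "I3 = (\<lambda>j s'. same {3,5} {4,5,6} s s' \<and> nats s' 3 0 = N \<and> reals s' 5 0 = N \<and>
    nats s' 5 0 = j \<and> reals s' 6 0 = real j)"
  have N_le: "j < N \<longleftrightarrow> real j < ?D" for j
    unfolding N grid_size_def by linarith
  show ?thesis
    unfolding grid_prog_def
    apply (simp del: One_nat_def)
    apply (rule wp_Seq[where R = "I1 k" and ?T1.0 = "k * 3 + 1" and ?T2.0 = "10 + 3 * N + 3 * n"])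
      apply (rule wp_Loop[where I = I1 and M = k and T = 2])
          apply (simp_all add: I1_def same_def assms(1-3)[simplified])
    apply (rule wp_Seq[where R = "I2 N" and ?T1.0 = "N * 3 + 1" and ?T2.0 = "4 + 3 * n"])
      apply (rule wp_Loop[where I = I2 and M = N and T = 2])
          apply (simp_all add: I2_def same_def assms(1-3)[simplified] N_le del: One_nat_def)
    using N_le[of N] apply simp
    apply (rule wp_Loop[where I = I3 and M = n and T = 2])
          apply (simp_all add: I3_def same_def assms(1-3) del: One_nat_def)
    done
qed

definition prod_prog :: prog where
  "prod_prog =
     Seq (rset 9 (RConst 1)) (Seq (nset 5 (NConst 0))
     (Loop (NLess (nv 5) num_bidders)
       (Seq (incr 5) (rset 9 (RMul (rv 9) (RGet 7 (nv 5)))))))"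

lemma prod_prog_wp:
  assumes "nats s 0 1 = k"
  shows "wp prod_prog (3 + 3 * k)
    (\<lambda>s'. same {5} {9} s s' \<and> reals s' 9 0 = (\<Prod>j=1..k. reals s 7 j)) s"
proof -
  define I where "I = (\<lambda>i s'. same {5} {9} s s' \<and> nats s' 5 0 = i \<and> reals s' 9 0 = (\<Prod>j=1..i. reals s 7 j))"
  show ?thesis
    unfolding prod_prog_def
    apply (simp del: One_nat_def)
    apply (rule wp_Loop[where I = I and M = k and T = 2])
        apply (simp_all add: I_def same_def assms[simplified])
    done
qed

text \<open>The power in cell 11 is formed from the old candidate \<open>i / N\<close>, and the
  candidate is advanced before the test, so that a success stores \<open>(i + 1) / N\<close> as in
  \<open>root_scan\<close>.\<close>

definition root_prog :: prog where
  "root_prog =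
     Seq (rset 10 (RConst 0)) (Seq (rset 15 (RConst 0)) (Seq (nset 5 (NConst 0))
     (Loop (NLess (nv 5) (nv 3))
       (Seq (rset 11 (RConst 1)) (Seq (nset 6 (NConst 0))
       (Seq (Loop (NLess (nv 6) (NSub num_bidders (NConst 1)))
          (Seq (rset 11 (RMul (rv 11) (RDiv (rv 15) (rv 5)))) (incr 6)))
       (Seq (rincr 15) (Seq (incr 5)
       (Cond (RLess (rv 11) (rv 9)) (rset 10 (RDiv (rv 15) (rv 5))) Skip)))))))))"

lemma root_prog_wp:
  assumes "nats s 0 1 = k" "nats s 3 0 = N" "reals s 5 0 = real N" "reals s 9 0 = v"
  shows "wp root_prog (4 + N * (9 + 3 * k))
    (\<lambda>s'. same {5,6} {10,11,15} s s' \<and> reals s' 10 0 = root_scan N (k - 1) v N) s"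
proof -
  define I where "I = (\<lambda>i s'. same {5,6} {10,11,15} s s' \<and> nats s' 5 0 = i \<and> reals s' 15 0 = real i
    \<and> reals s' 10 0 = root_scan N (k - 1) v i)"
  define J where "J = (\<lambda>i j s'. I i s' \<and> nats s' 6 0 = j \<and> reals s' 11 0 = (real i / real N) ^ j)"
  show ?thesis
    unfolding root_prog_def
    apply (simp del: One_nat_def)
    apply (rule wp_Loop[where I = I and M = N and T = "8 + 3 * k"])
        apply (simp add: I_def same_def)
    subgoal for i s'
      apply (simp add: assms I_def same_def del: One_nat_def root_scan.simps)
      apply (rule wp_Seq[where R = "J i (k - 1)" and ?T1.0 = "(k - 1) * 3 + 1" and ?T2.0 = "5"])
        apply (rule wp_Loop[where I = "J i" and M = "k - 1" and T = 2])
            apply (simp_all add: I_def J_def same_def assms[simplified] del: root_scan.simps)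
      apply (rule wp_Cond[where T = 1])
        apply (simp_all add: I_def J_def same_def assms)
      done
       apply (simp_all add: I_def same_def assms)
    done
qed

text \<open>Tests only offer strict comparison, so equality of the winner with the bidder is
  expressed by two negated comparisons.\<close>

definition count_prog :: prog where
  "count_prog =
     Seq (rset 12 (RConst 0)) (Seq (nset 6 (NConst 0))
     (Loop (NLess (nv 6) num_samples)
       (Seq (Cond (Conj (Conj (Neg (NLess (NGet 1 (nv 6)) (nv 5))) (Neg (NLess (nv 5) (NGet 1 (nv 6)))))
                 (Conj (RLess (RDiv (rv 14) (rv 5)) (RGet 1 (nv 6)))
                       (Neg (RLess (RDiv (RAdd (rv 14) (RConst 1)) (rv 5)) (RGet 1 (nv 6))))))
              (rincr 12) Skip)
       (incr 6))))"

text \<open>Cells are open on the left and closed on the right, so that the first \<open>t\<close>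
  of them make up the prices in \<open>(0, t / N]\<close>, in agreement with differences of
  CDFs.\<close>

definition cell_count :: "nat \<Rightarrow> nat \<Rightarrow> (nat \<Rightarrow> real \<times> nat) \<Rightarrow> nat \<Rightarrow> nat \<Rightarrow> nat" where
  "cell_count N n s i t =
     card {j. j < n \<and> snd (s j) = i \<and> real t / real N < fst (s j) \<and> fst (s j) \<le> (real t + 1) / real N}"

lemma cell_count_0: "cell_count N 0 s i t = 0"
  by (simp add: cell_count_def)

lemma cell_count_Suc:
  "cell_count N (Suc n) s i t = cell_count N n s i t +
    (if snd (s n) = i \<and> real t / real N < fst (s n) \<and> fst (s n) \<le> (real t + 1) / real N then 1 else 0)"
proof -
  let ?P = "\<lambda>j. snd (s j) = i \<and> real t / real N < fst (s j) \<and> fst (s j) \<le> (real t + 1) / real N"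
  have "{j. j < Suc n \<and> ?P j} = (if ?P n then insert n {j. j < n \<and> ?P j} else {j. j < n \<and> ?P j})"
    by (auto simp: less_Suc_eq)
  then show ?thesis unfolding cell_count_def by (simp split: if_splits)
qed

lemma count_prog_wp:
  assumes "nats s 0 0 = n" "nats s 5 0 = i" "reals s 5 0 = real N" "reals s 14 0 = real t"
    "\<And>j. j < n \<Longrightarrow> nats s 1 j = snd (x j)" "\<And>j. j < n \<Longrightarrow> reals s 1 j = fst (x j)"
  shows "wp count_prog (3 + 4 * n)
    (\<lambda>s'. same {6} {12} s s' \<and> reals s' 12 0 = real (cell_count N n x i t)) s"
proof -
  define I where "I = (\<lambda>j s'. same {6} {12} s s' \<and> nats s' 6 0 = j \<and> reals s' 12 0 = real (cell_count N j x i t))"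
  show ?thesis
    unfolding count_prog_def
    apply (simp del: One_nat_def)
    apply (rule wp_Loop[where I = I and M = n and T = 3])
        apply (simp add: I_def same_def cell_count_0)
    subgoal for j s'
      apply (rule conjI)
       apply (simp add: I_def same_def assms[simplified])
      apply (rule wp_Seq[where R = "\<lambda>s'. same {6} {12} s s' \<and> nats s' 6 0 = j \<and> 
          reals s' 12 0 = real (cell_count N (Suc j) x i t)" and ?T1.0 = 2 and ?T2.0 = 1])
        apply (rule wp_Cond[where T = 1])
          apply (auto simp add: I_def same_def assms[simplified] cell_count_Suc)
      done
      apply (simp_all add: I_def same_def assms)
    done
qed


definition cell_prog :: "nat \<Rightarrow> prog" where
  "cell_prog c =
     Seq (incr 5)
     (Seq (Cond (RLess (RDiv (rv 14) (rv 5)) (rpow (rv 0) c))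
        (rset 13 (RConst 0)) (rset 13 (RDiv (rv 10) (RGet 7 (nv 5)))))
     (Seq (Cond (RLess (rv 13) (RConst 1)) (rset 16 (rv 13)) (rset 16 (RConst 1)))
     (Seq (Cond (RLess (RGet 8 (nv 5)) (rv 16)) Skip (rset 16 (RGet 8 (nv 5))))
     (Seq count_prog
     (Seq (RSet 3 (nv 7) (RSub (rv 16) (RGet 8 (nv 5))))
     (Seq (RSet 8 (nv 5) (rv 16))
     (Seq (RSet 7 (nv 5) (RAdd (RGet 7 (nv 5))
        (RDiv (RDiv (rv 12) (rv 6)) (RSub (RConst 1) (rv 13)))))
     (nset 7 (NAdd (nv 7) (NAdd (nv 3) (NConst 1)))))))))))"

lemma cell_prog_wp:
  assumes "nats s 0 0 = n" "nats s 5 0 = i - 1" "i \<ge> 1" "nats s 7 0 = d" "nats s 3 0 = N"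
    "reals s 0 0 = \<epsilon>"
    "reals s 5 0 = real N" "reals s 6 0 = real n" "reals s 14 0 = real t"
    "\<And>j. j < n \<Longrightarrow> nats s 1 j = snd (x j)" "\<And>j. j < n \<Longrightarrow> reals s 1 j = fst (x j)"
    and F: "F = (if real t / real N < \<epsilon> ^ c then 0 else reals s 10 0 / reals s 7 i)"
  shows "wp (cell_prog c) (17 + 4 * n)
    (\<lambda>s'. same {5,6,7} {3,7,8,12,13,16} s s' \<and> nats s' 5 0 = i \<and> nats s' 7 0 = d + (N + 1)
      \<and> reals s' 3 = (reals s 3)(d := max (reals s 8 i) (min 1 F) - reals s 8 i)
      \<and> reals s' 8 = (reals s 8)(i := max (reals s 8 i) (min 1 F))
      \<and> reals s' 7 = (reals s 7)(i := reals s 7 i + real (cell_count N n x i t) / real n / (1 - F))) s"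
proof -
  have [simp]: "Suc (i - Suc 0) = i" using assms(3) by simp
  let ?R1 = "\<lambda>s'. same {5} {13,16} s s' \<and> nats s' 5 0 = i \<and> reals s' 13 0 = F"
  let ?R2 = "\<lambda>s'. ?R1 s' \<and> reals s' 16 0 = min 1 F"
  let ?R3 = "\<lambda>s'. ?R1 s' \<and> reals s' 16 0 = max (reals s 8 i) (min 1 F)"
  let ?R4 = "\<lambda>s'. same {5,6} {12,13,16} s s' \<and> nats s' 5 0 = i \<and> reals s' 13 0 = F
     \<and> reals s' 16 0 = max (reals s 8 i) (min 1 F)
     \<and> reals s' 12 0 = real (cell_count N n x i t)"
  show ?thesis
    unfolding cell_prog_def
    apply (simp del: One_nat_def)
    apply (rule wp_Seq[where R = ?R1 and ?T1.0 = 2 and ?T2.0 = "14 + 4 * n"])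
    subgoal by (rule wp_Cond[where T = 1]) (simp_all add: same_def assms(1-11)[simplified] F)
     prefer 2 apply simp
    apply (rule wp_Seq[where R = ?R2 and ?T1.0 = 2 and ?T2.0 = "12 + 4 * n"])
    subgoal by (rule wp_Cond[where T = 1]) (auto simp: same_def min_def)
     prefer 2 apply simp
    apply (rule wp_Seq[where R = ?R3 and ?T1.0 = 2 and ?T2.0 = "10 + 4 * n"])
    subgoal by (rule wp_Cond[where T = 1]) (auto simp: same_def max_def)
     prefer 2 apply simp
    apply (rule wp_Seq[where R = ?R4 and ?T1.0 = "3 + 4 * n" and ?T2.0 = "5"])
      apply (rule wp_mono)
        apply (rule count_prog_wp[where n = n and i = i and N = N and t = t and x = x])
             apply (simp_all add: same_def assms(1-11)[simplified])
    done
qed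


definition step_prog :: "nat \<Rightarrow> prog" where
  "step_prog c =
     Seq prod_prog (Seq root_prog
     (Seq (nset 5 (NConst 0)) (Seq (nset 7 (NAdd (NAdd (nv 3) (NConst 1)) (nv 4)))
     (Seq (Loop (NLess (nv 5) num_bidders) (cell_prog c))
     (Seq (RSet 2 (nv 4) (RDiv (rv 14) (rv 5))) (Seq (rincr 14) (incr 4)))))))"

text \<open>Uniqueness of quotient and remainder. The output table has rows of length
  \<open>N + 1\<close>, indexed from 1 because bidders are, and this fact shows that a write to one
  entry leaves the others intact.\<close>

lemma index_inj:
  fixes i j l m N :: nat
  assumes "i * (N + 1) + l = j * (N + 1) + m" "l \<le> N" "m \<le> N"
  shows "i = j \<and> l = m"
proof -
  have "(i * (N + 1) + l) div (N + 1) = i" "(j * (N + 1) + m) div (N + 1) = j"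
    using assms(2,3) by (auto simp: div_mult_self3 simp del: mult_Suc_right)
  with assms(1) show ?thesis by simp
qed

text \<open>Every \<open>F i\<close> refers to the memory before the loop: the Euler step is
  simultaneous in all bidders although the program treats them in turn. This is sound because bidder
  \<open>i\<close> reads only its own entries of arrays 7 and 8 and the root, which is computed
  before the loop.\<close>

lemma cells_loop_wp:
  assumes "nats s 0 0 = n" "nats s 0 1 = k" "nats s 3 0 = N" "nats s 5 0 = 0"
    "nats s 7 0 = N + 1 + t" "t < N"
    "reals s 0 0 = \<epsilon>" "reals s 5 0 = real N" "reals s 6 0 = real n" "reals s 14 0 = real t"
    "\<And>j. j < n \<Longrightarrow> nats s 1 j = snd (x j)" "\<And>j. j < n \<Longrightarrow> reals s 1 j = fst (x j)"
    and F: "\<And>i. F i = (if real t / real N < \<epsilon> ^ c then 0 else reals s 10 0 / reals s 7 i)"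
  shows "wp (Loop (NLess (nv 5) num_bidders) (cell_prog c)) (k * (18 + 4 * n) + 1)
    (\<lambda>s'. same {5,6,7} {3,7,8,12,13,16} s s'
      \<and> (\<forall>i\<in>{1..k}. reals s' 3 (i * (N + 1) + t) = max (reals s 8 i) (min 1 (F i)) - reals s 8 i
          \<and> reals s' 8 i = max (reals s 8 i) (min 1 (F i))
          \<and> reals s' 7 i = reals s 7 i + real (cell_count N n x i t) / real n / (1 - F i))
      \<and> (\<forall>d. (\<forall>i\<in>{1..k}. d \<noteq> i * (N + 1) + t) \<longrightarrow> reals s' 3 d = reals s 3 d)) s"
proof -
  define I where "I = (\<lambda>u s'. same {5,6,7} {3,7,8,12,13,16} s s' \<and> nats s' 5 0 = u
      \<and> nats s' 7 0 = (u + 1) * (N + 1) + t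
      \<and> (\<forall>i\<in>{1..u}. reals s' 3 (i * (N + 1) + t) = max (reals s 8 i) (min 1 (F i)) - reals s 8 i
          \<and> reals s' 8 i = max (reals s 8 i) (min 1 (F i))
          \<and> reals s' 7 i = reals s 7 i + real (cell_count N n x i t) / real n / (1 - F i))
      \<and> (\<forall>i. i \<notin> {1..u} \<longrightarrow> reals s' 8 i = reals s 8 i \<and> reals s' 7 i = reals s 7 i)
      \<and> (\<forall>d. (\<forall>i\<in>{1..u}. d \<noteq> i * (N + 1) + t) \<longrightarrow> reals s' 3 d = reals s 3 d))"
  have step: "wp (cell_prog c) (17 + 4 * n) (I (Suc u)) s'" if "u < k" and I: "I u s'" for u s'
  proof -
    have sm: "same {5,6,7} {3,7,8,12,13,16} s s'" and v: "nats s' 5 0 = u"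
      "nats s' 7 0 = (u + 1) * (N + 1) + t"
      and upd: "\<And>i. i \<in> {1..u} \<Longrightarrow> reals s' 3 (i * (N + 1) + t) = max (reals s 8 i) (min 1 (F i)) - reals s 8 i
          \<and> reals s' 8 i = max (reals s 8 i) (min 1 (F i))
          \<and> reals s' 7 i = reals s 7 i + real (cell_count N n x i t) / real n / (1 - F i)"
      and keep: "\<And>i. i \<notin> {1..u} \<Longrightarrow> reals s' 8 i = reals s 8 i \<and> reals s' 7 i = reals s 7 i"
      and keep3: "\<And>d. (\<And>i. i \<in> {1..u} \<Longrightarrow> d \<noteq> i * (N + 1) + t) \<Longrightarrow> reals s' 3 d = reals s 3 d"
      using I unfolding I_def by blast+
    note eqs = sameD[OF sm]
    \<comment> \<open>Bidder \<open>Suc u\<close> has not been treated yet, so its estimates are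
      still those of the initial memory.\<close>
    have keepu: "reals s' 8 (Suc u) = reals s 8 (Suc u)" "reals s' 7 (Suc u) = reals s 7 (Suc u)"
      using keep[of "Suc u"] by auto
    have wp: "wp (cell_prog c) (17 + 4 * n)
      (\<lambda>s''. same {5,6,7} {3,7,8,12,13,16} s' s'' \<and> nats s'' 5 0 = Suc u
        \<and> nats s'' 7 0 = (u + 1) * (N + 1) + t + (N + 1)
        \<and> reals s'' 3 = (reals s' 3)((u + 1) * (N + 1) + t
             := max (reals s' 8 (Suc u)) (min 1 (F (Suc u))) - reals s' 8 (Suc u))
        \<and> reals s'' 8 = (reals s' 8)(Suc u := max (reals s' 8 (Suc u)) (min 1 (F (Suc u))))
        \<and> reals s'' 7 = (reals s' 7)(Suc u := reals s' 7 (Suc u)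
             + real (cell_count N n x (Suc u) t) / real n / (1 - F (Suc u)))) s'"
      by (rule cell_prog_wp) (use v eqs assms keepu F in auto)
    show ?thesis
    proof (rule wp_mono[OF wp])
      fix s''
      assume post: "same {5,6,7} {3,7,8,12,13,16} s' s'' \<and> nats s'' 5 0 = Suc u
        \<and> nats s'' 7 0 = (u + 1) * (N + 1) + t + (N + 1)
        \<and> reals s'' 3 = (reals s' 3)((u + 1) * (N + 1) + t
             := max (reals s' 8 (Suc u)) (min 1 (F (Suc u))) - reals s' 8 (Suc u))
        \<and> reals s'' 8 = (reals s' 8)(Suc u := max (reals s' 8 (Suc u)) (min 1 (F (Suc u))))
        \<and> reals s'' 7 = (reals s' 7)(Suc u := reals s' 7 (Suc u)
             + real (cell_count N n x (Suc u) t) / real n / (1 - F (Suc u)))"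
      let ?H = "(u + 1) * (N + 1) + t"
      have neq: "i * (N + 1) + t \<noteq> ?H" if "i \<in> {1..u}" for i
        using index_inj[of i N t "u + 1" t] that assms(6) by auto
      have 3: "reals s'' 3 = (reals s' 3)(?H := max (reals s' 8 (Suc u)) (min 1 (F (Suc u))) - reals s' 8 (Suc u))"
       and 8: "reals s'' 8 = (reals s' 8)(Suc u := max (reals s' 8 (Suc u)) (min 1 (F (Suc u))))"
       and 7: "reals s'' 7 = (reals s' 7)(Suc u := reals s' 7 (Suc u)
             + real (cell_count N n x (Suc u) t) / real n / (1 - F (Suc u)))"
        using post by blast+
      have A: "same {5,6,7} {3,7,8,12,13,16} s s''"
        using post sm same_trans by blast
      have B: "reals s'' 3 (i * (N + 1) + t) = max (reals s 8 i) (min 1 (F i)) - reals s 8 i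
          \<and> reals s'' 8 i = max (reals s 8 i) (min 1 (F i))
          \<and> reals s'' 7 i = reals s 7 i + real (cell_count N n x i t) / real n / (1 - F i)"
        if "i \<in> {1..Suc u}" for i
      proof (cases "i = Suc u")
        case True
        have "i * (N + 1) + t = ?H" using True by simp
        then show ?thesis unfolding 3 8 7 using True keepu by simp
      next
        case False
        with that have i: "i \<in> {1..u}" by auto
        show ?thesis unfolding 3 8 7 using False neq[OF i] upd[OF i] by simp
      qed
      have C: "reals s'' 3 d = reals s 3 d" if "\<And>i. i \<in> {1..Suc u} \<Longrightarrow> d \<noteq> i * (N + 1) + t" for d
      proof -
        have "d \<noteq> ?H" using that[of "Suc u"] by simp
        then show ?thesis unfolding 3 using keep3[of d] that by simp
      qed
      have D: "reals s'' 8 i = reals s 8 i \<and> reals s'' 7 i = reals s 7 i" if "i \<notin> {1..Suc u}" for i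
        unfolding 8 7 using that keep[of i] by auto
      have E: "nats s'' 5 0 = Suc u" "nats s'' 7 0 = (Suc u + 1) * (N + 1) + t"
        using post by simp_all
      show "I (Suc u) s''"
        unfolding I_def using A B C D E by blast
    qed simp
  qed
  show ?thesis
  proof (rule wp_Loop[where I = I and M = k and T = "17 + 4 * n"])
    show "I 0 s" unfolding I_def using assms by simp
  next
    fix u s' assume "u < k" "I u s'"
    then show "test_holds (NLess (nv 5) num_bidders) s' \<and> wp (cell_prog c) (17 + 4 * n) (I (Suc u)) s'"
      using step assms(2) by (auto simp: I_def same_def)
  next
    fix s' assume "I k s'"
    then show "\<not> test_holds (NLess (nv 5) num_bidders) s'"
      using assms(2) by (auto simp: I_def same_def)
  qed (auto simp: I_def)
qed

lemma step_prog_wp: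
  assumes "nats s 0 0 = n" "nats s 0 1 = k" "nats s 3 0 = N" "nats s 4 0 = t" "t < N"
    "reals s 0 0 = \<epsilon>" "reals s 5 0 = real N" "reals s 6 0 = real n" "reals s 14 0 = real t"
    "\<And>j. j < n \<Longrightarrow> nats s 1 j = snd (x j)" "\<And>j. j < n \<Longrightarrow> reals s 1 j = fst (x j)"
    and F: "\<And>i. F i = cdf_est (\<epsilon> ^ c) N k t (reals s 7) i"
  shows "wp (step_prog c) (13 + 3 * k + N * (9 + 3 * k) + k * (18 + 4 * n))
    (\<lambda>s'. same {4,5,6,7} {2,3,7,8,9,10,11,12,13,14,15,16} s s' \<and> nats s' 4 0 = Suc t
      \<and> reals s' 14 0 = real (Suc t) \<and> reals s' 2 = (reals s 2)(t := real t / real N)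
      \<and> (\<forall>i\<in>{1..k}. reals s' 3 (i * (N + 1) + t) = max (reals s 8 i) (min 1 (F i)) - reals s 8 i
          \<and> reals s' 8 i = max (reals s 8 i) (min 1 (F i))
          \<and> reals s' 7 i = reals s 7 i + real (cell_count N n x i t) / real n / (1 - F i))
      \<and> (\<forall>d. (\<forall>i\<in>{1..k}. d \<noteq> i * (N + 1) + t) \<longrightarrow> reals s' 3 d = reals s 3 d)) s"
proof -
  define v where "v = (\<Prod>j=1..k. reals s 7 j)"
  have F': "F i = (if real t / real N < \<epsilon> ^ c then 0 else root_scan N (k - 1) v N / reals s 7 i)" for i
    by (simp add: F cdf_est_def v_def)
  show ?thesis
    unfolding step_prog_def
    apply (rule wp_Seq[where ?T1.0 = "3 + 3 * k"
          and ?T2.0 = "10 + N * (9 + 3 * k) + k * (18 + 4 * n)"])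
      apply (rule prod_prog_wp[where k = k])
    subgoal by (rule assms)
     prefer 2 subgoal by simp
    apply (rule wp_Seq[where ?T1.0 = "4 + N * (9 + 3 * k)" and ?T2.0 = "6 + k * (18 + 4 * n)"])
      apply (rule root_prog_wp[where k = k and N = N and v = v])
    subgoal by (simp add: same_def assms[simplified])
    subgoal by (simp add: same_def assms[simplified])
    subgoal by (simp add: same_def assms[simplified])
    subgoal by (simp add: v_def)
     prefer 2 subgoal by simp
    apply (simp del: One_nat_def)
    apply (rule wp_Seq[where ?T1.0 = "k * (18 + 4 * n) + 1" and ?T2.0 = 3])
      apply (rule cells_loop_wp[where k = k and N = N and n = n and t = t and \<epsilon> = \<epsilon> and x = x and F = F])
                  apply (simp_all add: same_def assms(1-11)[simplified] F')
    done
qed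

text \<open>Adds a last jump at 1 that lifts every function to the value 1, so that the output is a
  CDF on every sample.\<close>

definition final_prog :: prog where
  "final_prog =
     Seq (RSet 2 (nv 3) (RConst 1)) (Seq (nset 2 (NAdd (nv 3) (NConst 1)))
     (Seq (nset 5 (NConst 0)) (Seq (nset 7 (NAdd (NAdd (nv 3) (NConst 1)) (nv 3)))
     (Loop (NLess (nv 5) num_bidders)
       (Seq (incr 5) (Seq (RSet 3 (nv 7) (RSub (RConst 1) (RGet 8 (nv 5))))
       (nset 7 (NAdd (nv 7) (NAdd (nv 3) (NConst 1))))))))))"

lemma final_prog_wp:
  assumes "nats s 0 1 = k" "nats s 3 0 = N"
  shows "wp final_prog (5 + 4 * k)
    (\<lambda>s'. table_size s' = N + 1 \<and> reals s' 2 = (reals s 2)(N := 1)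
      \<and> (\<forall>i\<in>{1..k}. reals s' 3 (i * (N + 1) + N) = 1 - reals s 8 i)
      \<and> (\<forall>d. (\<forall>i\<in>{1..k}. d \<noteq> i * (N + 1) + N) \<longrightarrow> reals s' 3 d = reals s 3 d)) s"
proof -
  define s1 where "s1 = set_nat 7 0 (N + 1 + N) (set_nat 5 0 0
    (set_nat 2 0 (N + 1) (set_real 2 N 1 s)))"
  define I where "I = (\<lambda>u s'. same {5,7} {3} s1 s' \<and> nats s' 5 0 = u
      \<and> nats s' 7 0 = (u + 1) * (N + 1) + N
      \<and> (\<forall>i\<in>{1..u}. reals s' 3 (i * (N + 1) + N) = 1 - reals s 8 i)
      \<and> (\<forall>d. (\<forall>i\<in>{1..u}. d \<noteq> i * (N + 1) + N) \<longrightarrow> reals s' 3 d = reals s 3 d))"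
  have step: "I (Suc u) (set_nat 7 0 ((u + 1) * (N + 1) + N + (N + 1))
      (set_real 3 ((u + 1) * (N + 1) + N) (1 - reals s 8 (Suc u)) (set_nat 5 0 (Suc u) s')))"
    if I: "I u s'" for u s'
  proof -
    let ?H = "(u + 1) * (N + 1) + N"
    have neq: "i * (N + 1) + N \<noteq> ?H" if "i \<in> {1..u}" for i
      using index_inj[of i N N "u + 1" N] that by auto
    have A: "same {5,7} {3} s1 s'" and B: "\<And>i. i \<in> {1..u} \<Longrightarrow> reals s' 3 (i * (N + 1) + N) = 1 - reals s 8 i"
      and C: "\<And>d. (\<And>i. i \<in> {1..u} \<Longrightarrow> d \<noteq> i * (N + 1) + N) \<Longrightarrow> reals s' 3 d = reals s 3 d"
      using I unfolding I_def by blast+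
    let ?s = "set_nat 7 0 (?H + (N + 1)) (set_real 3 ?H (1 - reals s 8 (Suc u)) (set_nat 5 0 (Suc u) s'))"
    have r3: "reals ?s 3 = (reals s' 3)(?H := 1 - reals s 8 (Suc u))" by simp
    have "same {5,7} {3} s1 ?s" using A by (simp add: same_def)
    moreover have "reals ?s 3 (i * (N + 1) + N) = 1 - reals s 8 i" if "i \<in> {1..Suc u}" for i
    proof (cases "i = Suc u")
      case True
      then have "i * (N + 1) + N = ?H" by simp
      then show ?thesis unfolding r3 using True by simp
    next
      case False
      with that have i: "i \<in> {1..u}" by auto
      show ?thesis unfolding r3 using neq[OF i] B[OF i] by simp
    qed
    moreover have "reals ?s 3 d = reals s 3 d" if "\<And>i. i \<in> {1..Suc u} \<Longrightarrow> d \<noteq> i * (N + 1) + N" for d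
    proof -
      have "d \<noteq> ?H" using that[of "Suc u"] by simp
      then show ?thesis unfolding r3 using C[of d] that by simp
    qed
    moreover have "nats ?s 5 0 = Suc u" "nats ?s 7 0 = (Suc u + 1) * (N + 1) + N" by simp_all
    ultimately show ?thesis unfolding I_def by blast
  qed
  have "wp (Loop (NLess (nv 5) num_bidders)
       (Seq (incr 5) (Seq (RSet 3 (nv 7) (RSub (RConst 1) (RGet 8 (nv 5))))
       (nset 7 (NAdd (nv 7) (NAdd (nv 3) (NConst 1))))))) (k * 4 + 1)
    (\<lambda>s'. table_size s' = N + 1 \<and> reals s' 2 = (reals s 2)(N := 1)
      \<and> (\<forall>i\<in>{1..k}. reals s' 3 (i * (N + 1) + N) = 1 - reals s 8 i)
      \<and> (\<forall>d. (\<forall>i\<in>{1..k}. d \<noteq> i * (N + 1) + N) \<longrightarrow> reals s' 3 d = reals s 3 d)) s1"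
  proof (rule wp_Loop[where I = I and M = k and T = 3])
    show "I 0 s1" unfolding I_def s1_def by simp
  next
    fix u s' assume u: "u < k" and I: "I u s'"
    have t: "test_holds (NLess (nv 5) num_bidders) s'"
      using u I assms(1) by (simp add: I_def same_def s1_def)
    have "nats s' 5 0 = u" "nats s' 3 0 = N" "nats s' 7 0 = (u + 1) * (N + 1) + N"
      "reals s' 8 = reals s 8"
      using I assms(2) by (simp_all add: I_def same_def s1_def)
    then show "test_holds (NLess (nv 5) num_bidders) s' \<and>
        wp (Seq (incr 5) (Seq (RSet 3 (nv 7) (RSub (RConst 1) (RGet 8 (nv 5))))
       (nset 7 (NAdd (nv 7) (NAdd (nv 3) (NConst 1)))))) 3 (I (Suc u)) s'"
      using t step[OF I] by simp
  next
    fix s' assume "I k s'"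
    then show "\<not> test_holds (NLess (nv 5) num_bidders) s'"
      using assms(1) by (simp add: I_def same_def s1_def)
  next
    fix s' assume "I k s'"
    then show "table_size s' = N + 1 \<and> reals s' 2 = (reals s 2)(N := 1)
      \<and> (\<forall>i\<in>{1..k}. reals s' 3 (i * (N + 1) + N) = 1 - reals s 8 i)
      \<and> (\<forall>d. (\<forall>i\<in>{1..k}. d \<noteq> i * (N + 1) + N) \<longrightarrow> reals s' 3 d = reals s 3 d)"
      by (simp add: I_def same_def s1_def table_size_def)
  qed simp
  then show ?thesis
    unfolding final_prog_def s1_def by (simp add: assms(2) mult.commute)
qed

definition learner :: "nat \<Rightarrow> nat \<Rightarrow> prog" where
  "learner c1 c2 =
     Seq (grid_prog c2) (Seq (rset 14 (RConst 0)) (Seq (nset 4 (NConst 0))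
     (Seq (Loop (NLess (nv 4) (nv 3)) (step_prog c1)) final_prog)))"

definition step_fun :: "nat \<Rightarrow> (nat \<Rightarrow> real) \<Rightarrow> real \<Rightarrow> real" where
  "step_fun N g x =
     (\<Sum>l | l < N \<and> real l / real N \<le> x. g (Suc l) - g l) + (if 1 \<le> x then 1 - g N else 0)"

text \<open>The cubic terms come from the \<open>N\<close> grid points, each of which needs a scan
  for the root (order \<open>N * k\<close>) and a count for each bidder (order
  \<open>n * k\<close>).\<close>

definition learner_time :: "nat \<Rightarrow> nat \<Rightarrow> nat \<Rightarrow> nat" where
  "learner_time n k N = 28 + 7 * k + 3 * N + 3 * n
     + N * (14 + 3 * k + N * (9 + 3 * k) + k * (18 + 4 * n))"

text \<open>Array 7 agrees with \<open>prod_est\<close> only at the indices of actual bidders; the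
  estimate reads no other entries.\<close>

lemma cdf_est_cong:
  assumes "\<And>j. j \<in> {1..k} \<Longrightarrow> h j = h' j" "i \<in> {1..k}"
  shows "cdf_est x0 N k t h i = cdf_est x0 N k t h' i"
proof -
  have "(\<Prod>j=1..k. h j) = (\<Prod>j=1..k. h' j)" using assms(1) by (rule prod.cong[OF refl])
  then show ?thesis using assms by (simp add: cdf_est_def)
qed

text \<open>\<open>q\<close> has to match the counts only for actual bidders and cells, so that a
  finite count table that vanishes elsewhere can be substituted for it later.\<close>

lemma learner_wp:
  assumes N: "N = grid_size c2 k \<epsilon>"
    and q: "\<And>i t. i \<in> {1..k} \<Longrightarrow> t < N \<Longrightarrow> q i t = real (cell_count N n x i t) / real n"
  shows "wp (learner c1 c2) (learner_time n k N)
    (\<lambda>s'. table_size s' = N + 1 \<and>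
       (\<forall>i\<in>{1..k}. table_fun s' i = step_fun N (\<lambda>t. mono_est (\<epsilon> ^ c1) N k q t i)))
    (learner_input n k \<epsilon> \<rho> x)"
proof -
  let ?s = "learner_input n k \<epsilon> \<rho> x"
  let ?pe = "prod_est (\<epsilon> ^ c1) N k q" and ?me = "mono_est (\<epsilon> ^ c1) N k q"
  let ?M = "{2,3,4,5,6,7,8,9,10,11,12,13,14,15,16}::nat set"
  define I where "I = (\<lambda>t s'. same {3,4,5,6,7} ?M ?s s' \<and> nats s' 3 0 = N \<and> nats s' 4 0 = t
    \<and> reals s' 5 0 = real N \<and> reals s' 6 0 = real n \<and> reals s' 14 0 = real t
    \<and> (\<forall>i\<in>{1..k}. reals s' 7 i = ?pe t i \<and> reals s' 8 i = ?me t i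
        \<and> (\<forall>l<t. reals s' 3 (i * (N + 1) + l) = ?me (Suc l) i - ?me l i))
    \<and> (\<forall>l<t. reals s' 2 l = real l / real N))"
  have inp: "nats ?s 0 0 = n" "nats ?s 0 1 = k" "reals ?s 0 0 = \<epsilon>"
    "\<And>j. j < n \<Longrightarrow> nats ?s 1 j = snd (x j)" "\<And>j. j < n \<Longrightarrow> reals ?s 1 j = fst (x j)"
    by (simp_all add: learner_input_def)
  have step: "wp (step_prog c1) (13 + 3 * k + N * (9 + 3 * k) + k * (18 + 4 * n)) (I (Suc t)) s'"
    if t: "t < N" and I: "I t s'" for t s'
  proof -
    let ?F = "\<lambda>i. cdf_est (\<epsilon> ^ c1) N k t (reals s' 7) i"
    have A: "same {3,4,5,6,7} ?M ?s s'" using I unfolding I_def by blast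
    note eqs = sameD[OF A]
    have B: "reals s' 7 i = ?pe t i" "reals s' 8 i = ?me t i"
      "\<And>l. l < t \<Longrightarrow> reals s' 3 (i * (N + 1) + l) = ?me (Suc l) i - ?me l i"
      if "i \<in> {1..k}" for i
      using I that unfolding I_def by blast+
    have C: "reals s' 2 l = real l / real N" if "l < t" for l
      using I that unfolding I_def by blast
    have Fe: "?F i = cdf_est (\<epsilon> ^ c1) N k t (?pe t) i" if "i \<in> {1..k}" for i
      by (rule cdf_est_cong) (use B that in auto)
    have D: "nats s' 3 0 = N" "nats s' 4 0 = t" "reals s' 5 0 = real N" "reals s' 6 0 = real n"
      "reals s' 14 0 = real t"
      using I unfolding I_def by blast+
    have wp: "wp (step_prog c1) (13 + 3 * k + N * (9 + 3 * k) + k * (18 + 4 * n))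
    (\<lambda>s''. same {4,5,6,7} {2,3,7,8,9,10,11,12,13,14,15,16} s' s'' \<and> nats s'' 4 0 = Suc t
      \<and> reals s'' 14 0 = real (Suc t) \<and> reals s'' 2 = (reals s' 2)(t := real t / real N)
      \<and> (\<forall>i\<in>{1..k}. reals s'' 3 (i * (N + 1) + t) = max (reals s' 8 i) (min 1 (?F i)) - reals s' 8 i
          \<and> reals s'' 8 i = max (reals s' 8 i) (min 1 (?F i))
          \<and> reals s'' 7 i = reals s' 7 i + real (cell_count N n x i t) / real n / (1 - ?F i))
      \<and> (\<forall>d. (\<forall>i\<in>{1..k}. d \<noteq> i * (N + 1) + t) \<longrightarrow> reals s'' 3 d = reals s' 3 d)) s'"
      by (rule step_prog_wp[where \<epsilon> = \<epsilon>]) (simp_all add: eqs inp[simplified] D t)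
    show ?thesis
    proof (rule wp_mono[OF wp], elim conjE)
      fix s''
      assume S: "same {4,5,6,7} {2,3,7,8,9,10,11,12,13,14,15,16} s' s''" "nats s'' 4 0 = Suc t"
          "reals s'' 14 0 = real (Suc t)" "reals s'' 2 = (reals s' 2)(t := real t / real N)"
        and U: "\<forall>i\<in>{1..k}. reals s'' 3 (i * (N + 1) + t) = max (reals s' 8 i) (min 1 (?F i)) - reals s' 8 i
          \<and> reals s'' 8 i = max (reals s' 8 i) (min 1 (?F i))
          \<and> reals s'' 7 i = reals s' 7 i + real (cell_count N n x i t) / real n / (1 - ?F i)"
        and K: "\<forall>d. (\<forall>i\<in>{1..k}. d \<noteq> i * (N + 1) + t) \<longrightarrow> reals s'' 3 d = reals s' 3 d"
      note eqs' = sameD[OF S(1)]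
      have "same {3,4,5,6,7} ?M ?s s''"
        by (rule same_trans[OF A S(1)]) auto
      moreover have "nats s'' 3 0 = N" "reals s'' 5 0 = real N" "reals s'' 6 0 = real n"
        using D by (simp_all add: eqs')
      moreover have "reals s'' 7 i = ?pe (Suc t) i \<and> reals s'' 8 i = ?me (Suc t) i" if "i \<in> {1..k}" for i
        using U that B[OF that] q[OF that t] Fe[OF that] by simp
      moreover have "reals s'' 3 (i * (N + 1) + l) = ?me (Suc l) i - ?me l i"
        if i: "i \<in> {1..k}" and l: "l < Suc t" for i l
      proof (cases "l = t")
        case True
        then show ?thesis using U i B[OF i] Fe[OF i] by simp
      next
        case False
        with l have lt: "l < t" by simp
        have "reals s'' 3 (i * (N + 1) + l) = reals s' 3 (i * (N + 1) + l)"
          using K index_inj[of i N l _ t] lt t by fastforce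
        then show ?thesis using B(3)[OF i lt] by simp
      qed
      moreover have "reals s'' 2 l = real l / real N" if "l < Suc t" for l
        using S(4) C[of l] that by (cases "l = t") auto
      ultimately show "I (Suc t) s''" using S(2,3) unfolding I_def by blast
    qed simp
  qed
  have I_test: "test_holds (NLess (nv 4) (nv 3)) s' \<longleftrightarrow> t < N" if "I t s'" for t s'
    using that by (simp add: I_def)
  have fin: "table_fun s'' i = step_fun N (\<lambda>t. ?me t i)"
    if I: "I N s'" and i: "i \<in> {1..k}" and ts: "table_size s'' = N + 1"
      and r2: "reals s'' 2 = (reals s' 2)(N := 1)"
      and r3: "\<forall>i\<in>{1..k}. reals s'' 3 (i * (N + 1) + N) = 1 - reals s' 8 i"
      and r3': "\<forall>d. (\<forall>i\<in>{1..k}. d \<noteq> i * (N + 1) + N) \<longrightarrow> reals s'' 3 d = reals s' 3 d"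
    for s' s'' i
  proof
    fix y
    have pts: "reals s'' 2 l = real l / real N" if "l < N" for l
      using I that r2 unfolding I_def by simp
    have hts: "reals s'' 3 (i * (N + 1) + l) = ?me (Suc l) i - ?me l i" if "l < N" for l
    proof -
      have "reals s'' 3 (i * (N + 1) + l) = reals s' 3 (i * (N + 1) + l)"
        using r3' index_inj[of i N l _ N] that by fastforce
      then show ?thesis using I i that unfolding I_def by simp
    qed
    have last: "reals s'' 2 N = 1" "reals s'' 3 (i * (N + 1) + N) = 1 - ?me N i"
      using r2 r3 I i unfolding I_def by simp_all
    have "{l. l < N + 1 \<and> reals s'' 2 l \<le> y} =
       (if 1 \<le> y then insert N {l. l < N \<and> real l / real N \<le> y} else {l. l < N \<and> real l / real N \<le> y})"
      using pts last(1) by (auto simp: less_Suc_eq)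
    then show "table_fun s'' i y = step_fun N (\<lambda>t. ?me t i) y"
      unfolding table_fun_def step_fun_def ts using hts last(2) by (simp del: mult_Suc_right)
  qed
  show ?thesis
    unfolding learner_def
    apply (rule wp_Seq[where ?T1.0 = "20 + 3 * k + 3 * N + 3 * n"
          and ?T2.0 = "8 + 4 * k + N * (14 + 3 * k + N * (9 + 3 * k) + k * (18 + 4 * n))"])
      apply (rule grid_prog_wp[OF inp(1-3) N])
     apply (simp del: One_nat_def)
     apply (rule wp_Seq[where R = "I N" and ?T1.0 = "N * (14 + 3 * k + N * (9 + 3 * k) + k * (18 + 4 * n)) + 1"
          and ?T2.0 = "5 + 4 * k"])
       apply (rule wp_Loop[where I = I and M = N and T = "13 + 3 * k + N * (9 + 3 * k) + k * (18 + 4 * n)"])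
    subgoal for s' by (simp add: I_def same_def) (simp add: learner_input_def)
    subgoal using step I_test by blast
    subgoal using I_test by blast
    subgoal by simp
    subgoal by simp
    subgoal for s' s''
      apply (rule wp_mono)
        apply (rule final_prog_wp[where k = k and N = N])
      using inp apply (simp add: I_def same_def)
       apply (simp add: I_def)
      using fin[of s''] apply blast
      apply simp
      done
    subgoal by simp
    apply (simp add: learner_time_def)
    done
qed

section \<open>Step functions\<close>

text \<open>By determinism the definite description in \<open>result\<close> denotes the final
  memory that \<open>wp\<close> speaks of.\<close>

lemma wp_result:
  assumes "wp c T Q s"
  shows "halts_within c s T" "Q (result c s)"
proof -
  from assms obtain t s' where 1: "t \<le> T" "exec c s t s'" "Q s'" unfolding wp_def by blast
  then show "halts_within c s T" unfolding halts_within_def by blast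
  have "result c s = s'"
    unfolding result_def using 1(2) exec_deterministic by blast
  with 1 show "Q (result c s)" by simp
qed

lemma step_fun_neg: "x < 0 \<Longrightarrow> step_fun N g x = 0"
proof -
  assume "x < 0"
  have "\<not> real l / real N \<le> x" for l
  proof -
    have "0 \<le> real l / real N" by simp
    with \<open>x < 0\<close> show ?thesis by linarith
  qed
  then have e: "{l. l < N \<and> real l / real N \<le> x} = {}" by blast
  show ?thesis unfolding step_fun_def e using \<open>x < 0\<close> by simp
qed

lemma step_fun_ge_1:
  assumes "1 \<le> x" "g 0 = 0"
  shows "step_fun N g x = 1"
proof -
  have "real l / real N \<le> x" if "l < N" for l
    using that assms(1) by (smt (verit) divide_le_eq_1 of_nat_0_le_iff of_nat_less_iff)
  then have "{l. l < N \<and> real l / real N \<le> x} = {..<N}" by auto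
  then show ?thesis using assms by (simp add: step_fun_def sum_lessThan_telescope)
qed

text \<open>The jump at \<open>l / N\<close> counts from \<open>l / N\<close> on, so the sum
  telescopes to \<open>g (Suc l)\<close> on cell \<open>l\<close>. The shift is the right one:
  \<open>mono_est\<close> at \<open>Suc l\<close> is the first to contain the estimate made at grid
  point \<open>l\<close>.\<close>

lemma step_fun_inside:
  assumes "0 \<le> x" "x < 1" "N > 0" "g 0 = 0"
  defines "l \<equiv> nat \<lfloor>real N * x\<rfloor>"
  shows "l < N" "real l / real N \<le> x" "x < (real l + 1) / real N" "step_fun N g x = g (Suc l)"
proof -
  have l: "real l \<le> real N * x" "real N * x < real l + 1"
    using assms(1) unfolding l_def by (simp_all add: of_nat_nat)
  have "real N * x < real N" using assms by simp
  with l show lN: "l < N" by linarith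
  show "real l / real N \<le> x" "x < (real l + 1) / real N"
    using l assms(3) by (simp_all add: field_simps)
  have "{m. m < N \<and> real m / real N \<le> x} = {..<Suc l}"
  proof (intro set_eqI)
    fix m
    have "real m / real N \<le> x \<longleftrightarrow> real m \<le> real N * x" using assms(3) by (simp add: field_simps)
    also have "\<dots> \<longleftrightarrow> m < Suc l" using l by linarith
    finally show "m \<in> {m. m < N \<and> real m / real N \<le> x} \<longleftrightarrow> m \<in> {..<Suc l}" using lN by auto
  qed
  then show "step_fun N g x = g (Suc l)"
    using assms by (simp add: step_fun_def sum_lessThan_telescope del: lessThan_Suc sum.lessThan_Suc)
qed

lemma step_fun_altdef:
  "step_fun N g = (\<lambda>x. (\<Sum>l<N. (g (Suc l) - g l) * indicator {real l / real N..} x) + (1 - g N) * indicator {1..} x)"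
proof
  fix x
  have e: "{l. l < N \<and> real l / real N \<le> x} = {l\<in>{..<N}. real l / real N \<le> x}" by simp
  have "(\<Sum>l | l < N \<and> real l / real N \<le> x. g (Suc l) - g l) =
     (\<Sum>l<N. if real l / real N \<le> x then g (Suc l) - g l else 0)"
    unfolding e by (rule sum.inter_filter) simp
  also have "\<dots> = (\<Sum>l<N. (g (Suc l) - g l) * indicator {real l / real N..} x)"
    by (rule sum.cong) auto
  finally show "step_fun N g x = (\<Sum>l<N. (g (Suc l) - g l) * indicator {real l / real N..} x)
      + (1 - g N) * indicator {1..} x"
    unfolding step_fun_def by simp
qed

lemma continuous_at_right_indicator_atLeast:
  "continuous (at_right x) (indicator {a..} :: real \<Rightarrow> real)"
proof -
  have "\<forall>\<^sub>F y in at_right x. (indicator {a..} y :: real) = indicator {a..} x"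
  proof (cases "a \<le> x")
    case True
    then show ?thesis by (auto simp: eventually_at_filter indicator_def)
  next
    case False
    then have "\<forall>\<^sub>F y in at_right x. y < a"
      by (intro order_tendstoD(2)[OF tendsto_ident_at]) auto
    then show ?thesis by eventually_elim (use False in \<open>auto simp: indicator_def\<close>)
  qed
  then show ?thesis unfolding continuous_within by (rule tendsto_eventually)
qed

text \<open>The jumps are nonnegative, the last one by \<open>g N \<le> 1\<close>, so the function
  is the CDF of its interval measure. Monotonicity and the cap are built into
  \<open>mono_est\<close>, hence this applies to atypical samples too.\<close>

lemma is_cdf_step_fun:
  assumes "g 0 = 0" "\<And>l. g l \<le> g (Suc l)" "g N \<le> 1"
  shows "is_cdf (step_fun N g)"
proof -
  let ?F = "step_fun N g"
  have nd: "?F x \<le> ?F y" if "x \<le> y" for x y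
    unfolding step_fun_altdef using that assms
    by (intro add_mono sum_mono mult_left_mono) (auto simp: indicator_def)
  have rc: "continuous (at_right a) ?F" for a
    unfolding step_fun_altdef by (intro continuous_intros continuous_at_right_indicator_atLeast)
  have bot: "(?F \<longlongrightarrow> 0) at_bot"
    by (rule tendsto_eventually) (auto simp: eventually_at_bot_dense step_fun_neg intro!: exI[of _ 0])
  have top: "(?F \<longlongrightarrow> 1) at_top"
    by (rule tendsto_eventually) (auto simp: eventually_at_top_linorder step_fun_ge_1 assms(1) intro!: exI[of _ 1])
  have "real_distribution (interval_measure ?F)"
    by (rule real_distribution_interval_measure[OF nd rc bot top])
  moreover have "cdf (interval_measure ?F) = ?F"
    by (rule cdf_interval_measure[OF nd rc bot])
  ultimately show ?thesis unfolding is_cdf_def by metis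
qed

section \<open>Error propagation\<close>

lemma root_scan_bounds:
  fixes v :: real
  assumes "m \<ge> 1" "N \<ge> 1"
  defines "P \<equiv> root_scan N m v N"
  shows "0 \<le> P" "P = 0 \<or> 0 \<le> P - 1 / real N \<and> (P - 1 / real N) ^ m < v" "1 \<le> P \<or> v \<le> P ^ m"
proof -
  \<comment> \<open>The scan returns the successor of the last success: \<open>w - 1\<close> is a
    candidate with power below \<open>v\<close>, and all candidates from \<open>w\<close> on have
    failed.\<close>
  have inv: "\<exists>w\<le>u. root_scan N m v u = real w / real N
      \<and> (w = 0 \<or> (real (w - 1) / real N) ^ m < v)
      \<and> (\<forall>u'. w \<le> u' \<and> u' < u \<longrightarrow> v \<le> (real u' / real N) ^ m)" for u
  proof (induction u)
    case 0
    then show ?case by simp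
  next
    case (Suc u)
    show ?case
    proof (cases "(real u / real N) ^ m < v")
      case True
      then show ?thesis by (intro exI[of _ "Suc u"]) (simp add: add.commute)
    next
      case False
      from Suc obtain w where "w \<le> u" "root_scan N m v u = real w / real N"
        "w = 0 \<or> (real (w - 1) / real N) ^ m < v"
        "\<forall>u'. w \<le> u' \<and> u' < u \<longrightarrow> v \<le> (real u' / real N) ^ m" by blast
      with False show ?thesis by (intro exI[of _ w]) (auto simp: less_Suc_eq)
    qed
  qed
  from inv[of N] obtain w where w: "w \<le> N" "P = real w / real N"
    "w = 0 \<or> (real (w - 1) / real N) ^ m < v"
    "\<forall>u'. w \<le> u' \<and> u' < N \<longrightarrow> v \<le> (real u' / real N) ^ m"
    unfolding P_def by blast
  show "0 \<le> P" using w(2) by simp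
  show "P = 0 \<or> 0 \<le> P - 1 / real N \<and> (P - 1 / real N) ^ m < v"
  proof (cases "w = 0")
    case False
    then have "P - 1 / real N = real (w - 1) / real N"
      using w(2) by (simp add: diff_divide_distrib of_nat_diff)
    then show ?thesis using w(3) False by auto
  qed (use w in simp)
  show "1 \<le> P \<or> v \<le> P ^ m"
  proof (cases "w = N")
    case False
    then show ?thesis using w by auto
  qed (use w assms in simp)
qed

text \<open>A factor \<open>(1 + A) ^ k\<close> under a root of order \<open>k - 1\<close> is at
  most a square, because \<open>k \<le> 2 * (k - 1)\<close>; likewise for \<open>1 - A\<close>. The
  term \<open>1 / real N\<close> is the rounding of the scan.\<close>

lemma root_scan_relative:
  fixes P A v :: real
  assumes "k \<ge> 2" "N \<ge> 1" "0 < P" "P \<le> 1" "0 \<le> A" "A < 1"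
    and v: "(1 - A) ^ k * P ^ (k - 1) \<le> v" "v \<le> (1 + A) ^ k * P ^ (k - 1)"
  defines "Q \<equiv> root_scan N (k - 1) v N"
  shows "(1 - A)\<^sup>2 * P \<le> Q" "Q \<le> (1 + A)\<^sup>2 * P + 1 / real N"
proof -
  have m: "k - 1 \<ge> 1" "k \<le> 2 * (k - 1)" using assms(1) by auto
  note rs = root_scan_bounds[OF m(1) assms(2), of v, folded Q_def]
  show "(1 - A)\<^sup>2 * P \<le> Q"
  proof (cases "1 \<le> Q")
    case True
    have "(1 - A)\<^sup>2 * P \<le> 1 * 1" 
      using assms by (intro mult_mono power_le_one) auto
    then show ?thesis using True by simp
  next
    case False
    have "((1 - A)\<^sup>2 * P) ^ (k - 1) = (1 - A) ^ (2 * (k - 1)) * P ^ (k - 1)"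
      by (simp only: power_mult_distrib power_mult)
    also have "\<dots> \<le> (1 - A) ^ k * P ^ (k - 1)"
      using assms m by (intro mult_right_mono power_decreasing) auto
    also have "\<dots> \<le> Q ^ (k - 1)" using v rs(3) False by linarith
    finally show ?thesis using rs(1) m(1)
      by (metis le_eq_less_or_eq not_le power_strict_mono zero_less_one_class.zero_less_one less_le_trans)
  qed
  show "Q \<le> (1 + A)\<^sup>2 * P + 1 / real N"
  proof (cases "Q = 0")
    case True
    then show ?thesis using assms by auto
  next
    case False
    then have Q: "0 \<le> Q - 1 / real N" "(Q - 1 / real N) ^ (k - 1) < v" using rs(2) by auto
    note Q(2)
    also have "v \<le> (1 + A) ^ k * P ^ (k - 1)" by (rule v)
    also have "\<dots> \<le> (1 + A) ^ (2 * (k - 1)) * P ^ (k - 1)"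
      using assms m by (intro mult_right_mono power_increasing) auto
    also have "\<dots> = ((1 + A)\<^sup>2 * P) ^ (k - 1)"
      by (simp only: power_mult_distrib power_mult)
    finally have "Q - 1 / real N < (1 + A)\<^sup>2 * P"
      by (rule power_less_imp_less_base) (use assms in auto)
    then show ?thesis by simp
  qed
qed

text \<open>With \<open>R = h / H\<close> the estimate of \<open>F\<close> is
  \<open>F * (Q / P / R)\<close>. To first order the root contributes \<open>2 * A\<close> and the
  quotient \<open>A\<close>; the fourth \<open>A\<close> absorbs the quadratic terms, thanks to
  \<open>A \<le> 1/8\<close>. Half of \<open>d\<close> is the rounding of the root, the other half
  absorbs \<open>d * A\<close>.\<close>

lemma quotient_error:
  fixes A P Q R d F :: real
  assumes "0 \<le> A" "A \<le> 1/8" "1 - A \<le> R" "R \<le> 1 + A" "0 < P" "0 \<le> F"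
    and Q: "(1 - A)\<^sup>2 * P \<le> Q" "Q \<le> (1 + A)\<^sup>2 * P + d * P / 2" and "0 \<le> d"
  shows "\<bar>F * (Q / P / R) - F\<bar> \<le> F * (4 * A + d)"
proof -
  have R: "0 < R" using assms by linarith
  have QP: "(1 - A)\<^sup>2 \<le> Q / P" "Q / P \<le> (1 + A)\<^sup>2 + d / 2"
    using Q assms(5) by (simp_all add: field_simps)
  have "Q / P \<le> (1 + (4 * A + d)) * R"
  proof -
    have "(1 + A)\<^sup>2 + d / 2 \<le> (1 + (4 * A + d)) * (1 - A)"
    proof -
      have "A * A \<le> A * (1/8)" using assms by (intro mult_left_mono) auto
      moreover have "d * A \<le> d * (1/2)" using assms by (intro mult_left_mono) auto
      ultimately have "5 * (A * A) \<le> A" "d * A \<le> d / 2" using assms(1) by auto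
      then show ?thesis by (simp add: power2_eq_square algebra_simps)
    qed
    also have "\<dots> \<le> (1 + (4 * A + d)) * R" using assms by (intro mult_left_mono) auto
    finally show ?thesis using QP by linarith
  qed
  moreover have "(1 - (4 * A + d)) * R \<le> Q / P"
  proof (cases "4 * A + d \<le> 1")
    case True
    then have "(1 - (4 * A + d)) * R \<le> (1 - (4 * A + d)) * (1 + A)" using assms by (intro mult_left_mono) auto
    also have "\<dots> \<le> (1 - 3 * A) * (1 + A)" using assms by (intro mult_right_mono) auto
    also have "\<dots> \<le> (1 - A)\<^sup>2" by (simp add: power2_eq_square algebra_simps)
    finally show ?thesis using QP by linarith
  next
    case False
    then have "(1 - (4 * A + d)) * R \<le> 0" using R by (intro mult_nonpos_nonneg) auto
    moreover have "0 \<le> Q / P" using QP(1) by (meson order_trans zero_le_power2)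
    ultimately show ?thesis by linarith
  qed
  ultimately have "\<bar>Q / P / R - 1\<bar> \<le> 4 * A + d"
  proof -
    assume u: "Q / P \<le> (1 + (4 * A + d)) * R" and l: "(1 - (4 * A + d)) * R \<le> Q / P"
    have "Q / P / R \<le> 1 + (4 * A + d)" "1 - (4 * A + d) \<le> Q / P / R"
      using u l R by (simp_all only: pos_divide_le_eq pos_le_divide_eq)
    then show ?thesis by (simp add: abs_le_iff)
  qed
  then have "F * \<bar>Q / P / R - 1\<bar> \<le> F * (4 * A + d)" using assms by (intro mult_left_mono) auto
  moreover have "\<bar>F * (Q / P / R) - F\<bar> = F * \<bar>Q / P / R - 1\<bar>"
  proof -
    have "F * (Q / P / R) - F = F * (Q / P / R - 1)" by (simp only: right_diff_distrib mult_1_right)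
    then show ?thesis using assms(6) by (simp only: abs_mult abs_of_nonneg)
  qed
  ultimately show ?thesis by simp
qed

text \<open>The second part of \<open>G\<close> keeps \<open>1 - G\<close> above half of
  \<open>1 - F\<close>, so that the division by \<open>1 - G\<close> at most doubles the error of an
  increment. There \<open>\<theta>\<close> measures the relative error of the cell frequency and
  \<open>4 * A + d\<close> that of \<open>G\<close>.\<close>

lemma product_step_error:
  fixes A F G H H' h q \<theta> d :: real
  assumes "0 < H" "H \<le> H'" "\<bar>h / H - 1\<bar> \<le> A" "0 \<le> F" "F < 1"
    and G: "\<bar>G - F\<bar> \<le> F * (4 * A + d)" "F * (4 * A + d) \<le> (1 - F) / 2"
    and q: "\<bar>q - (1 - F) * (H' - H)\<bar> \<le> \<theta> * ((1 - F) * (H' - H))" and "0 \<le> \<theta>" "0 \<le> d"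
  defines "w \<equiv> (H' - H) / H'"
  shows "\<bar>(h + q / (1 - G)) / H' - 1\<bar>
    \<le> (1 - w) * A + w * (8 * A * (F / (1 - F)) + 2 * d / (1 - F) + 2 * \<theta>)"
proof -
  let ?D = "H' - H"
  have "G - F \<le> (1 - F) / 2" using G by (meson abs_le_D1 order_trans)
  then have G': "(1 - F) / 2 \<le> 1 - G" by (simp add: field_simps)
  have "0 < (1 - F) / 2" using assms(5) by simp
  then have Gpos: "0 < 1 - G" using G' by (rule less_le_trans)
  have inv: "1 / (1 - G) \<le> 2 / (1 - F)"
    using G' Gpos assms(5) by (simp add: field_simps)
  have D: "0 \<le> ?D" using assms by simp
  have "\<bar>h - H\<bar> \<le> A * H"
  proof -
    have "h - H = (h / H - 1) * H" using assms(1) by (simp add: field_simps)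
    then have "\<bar>h - H\<bar> = \<bar>h / H - 1\<bar> * H" using assms(1) by (simp add: abs_mult)
    then show ?thesis using assms(1,3) by simp
  qed
  moreover have "\<bar>q / (1 - G) - ?D\<bar> \<le> ?D * (8 * A * (F / (1 - F)) + 2 * d / (1 - F) + 2 * \<theta>)"
  proof -
    have "q / (1 - G) - ?D = (q - (1 - F) * ?D) * (1 / (1 - G)) + ?D * (G - F) * (1 / (1 - G))"
    proof -
      have "q - (1 - F) * ?D + ?D * (G - F) = q - ?D * (1 - G)" by (simp add: algebra_simps)
      then have "(q - (1 - F) * ?D + ?D * (G - F)) / (1 - G) = (q - ?D * (1 - G)) / (1 - G)"
        by (simp only:)
      also have "\<dots> = q / (1 - G) - ?D" using Gpos by (simp add: diff_divide_distrib)
      finally have "(q - (1 - F) * ?D + ?D * (G - F)) / (1 - G) = q / (1 - G) - ?D" .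
      then show ?thesis by (simp add: add_divide_distrib)
    qed
    also have "\<bar>\<dots>\<bar> \<le> \<bar>q - (1 - F) * ?D\<bar> * (1 / (1 - G)) + ?D * \<bar>G - F\<bar> * (1 / (1 - G))"
      using Gpos D by (intro order_trans[OF abs_triangle_ineq]) (simp add: abs_mult)
    also have "\<dots> \<le> \<theta> * ((1 - F) * ?D) * (2 / (1 - F)) + ?D * (F * (4 * A + d)) * (2 / (1 - F))"
      using q G(1) inv D assms Gpos by (intro add_mono mult_mono) auto
    also have "\<dots> = ?D * (8 * A * (F / (1 - F)) + 2 * (F * d) / (1 - F) + 2 * \<theta>)"
    proof -
      have "(1 - F) * inverse (1 - F) = 1" using assms(5) by simp
      then have "\<theta> * ((1 - F) * ?D) * (2 * inverse (1 - F)) + ?D * (F * (4 * A + d)) * (2 * inverse (1 - F))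
        = ?D * (8 * A * (F * inverse (1 - F)) + 2 * (F * d) * inverse (1 - F) + 2 * \<theta>)"
        by algebra
      then show ?thesis by (simp only: divide_inverse)
    qed
    also have "\<dots> \<le> ?D * (8 * A * (F / (1 - F)) + 2 * d / (1 - F) + 2 * \<theta>)"
    proof -
      have "F * d \<le> d" using assms by (intro mult_left_le_one_le) auto
      then have "2 * (F * d) / (1 - F) \<le> 2 * d / (1 - F)"
        using assms(5) by (intro divide_right_mono) auto
      then show ?thesis using D by (intro mult_left_mono) auto
    qed
    finally show ?thesis .
  qed
  ultimately have "\<bar>(h + q / (1 - G)) - H'\<bar> \<le> A * H + ?D * (8 * A * (F / (1 - F)) + 2 * d / (1 - F) + 2 * \<theta>)"
    by linarith
  moreover have H': "0 < H'" using assms by linarith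
  moreover have "\<bar>(h + q / (1 - G)) / H' - 1\<bar> = \<bar>(h + q / (1 - G)) - H'\<bar> / H'"
  proof -
    have "(h + q / (1 - G)) / H' - 1 = ((h + q / (1 - G)) - H') / H'"
      using H' by (simp add: diff_divide_distrib)
    then show ?thesis using H' by (simp only: abs_divide abs_of_pos)
  qed
  ultimately have "\<bar>(h + q / (1 - G)) / H' - 1\<bar> \<le> (A * H + ?D * (8 * A * (F / (1 - F)) + 2 * d / (1 - F) + 2 * \<theta>)) / H'"
    using H' by (simp add: divide_right_mono)
  also have "\<dots> = (1 - w) * A + w * (8 * A * (F / (1 - F)) + 2 * d / (1 - F) + 2 * \<theta>)"
  proof -
    have "1 - w = H / H'" unfolding w_def using H' by (simp add: field_simps)
    then show ?thesis unfolding w_def by (simp add: add_divide_distrib)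
  qed
  finally show ?thesis .
qed

text \<open>With \<open>s = sum a J\<close>, one minus the product lies between
  \<open>s / (1 + s)\<close> and \<open>s\<close>. The lower bound follows from
  \<open>1 - a \<le> exp (- a)\<close> and \<open>1 + s \<le> exp s\<close>.\<close>

lemma prod_one_minus_bounds:
  fixes a :: "'a \<Rightarrow> real"
  assumes "finite J" "\<And>j. j \<in> J \<Longrightarrow> 0 \<le> a j \<and> a j \<le> 1" 
  shows "1 - sum a J \<le> (\<Prod>j\<in>J. 1 - a j)" "(\<Prod>j\<in>J. 1 - a j) * (1 + sum a J) \<le> 1"
proof -
  show "1 - sum a J \<le> (\<Prod>j\<in>J. 1 - a j)" using assms
  proof (induction J rule: finite_induct)
    case (insert x J)
    then have IH: "1 - sum a J \<le> (\<Prod>j\<in>J. 1 - a j)" by simp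
    have "1 - (a x + sum a J) \<le> (1 - a x) * (1 - sum a J)"
      using insert.prems by (simp add: algebra_simps sum_nonneg)
    also have "\<dots> \<le> (1 - a x) * (\<Prod>j\<in>J. 1 - a j)"
      using IH insert.prems by (intro mult_left_mono) auto
    finally show ?case using insert by simp
  qed simp
  have "(\<Prod>j\<in>J. 1 - a j) \<le> (\<Prod>j\<in>J. exp (- a j))"
    using assms(2) by (intro prod_mono) (auto intro: order_trans[OF _ exp_ge_add_one_self])
  also have "\<dots> = exp (- sum a J)" using assms(1) by (simp add: exp_sum sum_negf[symmetric])
  finally have "(\<Prod>j\<in>J. 1 - a j) * (1 + sum a J) \<le> exp (- sum a J) * exp (sum a J)"
    using assms(2) by (intro mult_mono exp_ge_add_one_self) (auto intro!: add_nonneg_nonneg sum_nonneg)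
  then show "(\<Prod>j\<in>J. 1 - a j) * (1 + sum a J) \<le> 1" by (simp add: exp_minus)
qed

text \<open>Turns the exponentials of a discrete Gronwall argument into ratios of consecutive
  powers, which telescope.\<close>

lemma powr_ratio_exp:
  fixes x b :: real
  assumes "0 < x" "0 \<le> b"
  shows "exp (- b / x) \<le> (x / (x + 1)) powr b"
    and "1 < x \<Longrightarrow> exp (b / x) \<le> (x / (x - 1)) powr b"
proof -
  have "ln (1 + 1 / x) \<le> 1 / x" using assms by (intro ln_add_one_self_le_self) auto
  moreover have "ln (x / (x + 1)) = - ln (1 + 1 / x)"
    using assms by (simp add: ln_div field_simps)
  ultimately have "- (1 / x) \<le> ln (x / (x + 1))" by linarith
  then have "b * - (1 / x) \<le> b * ln (x / (x + 1))" using assms by (intro mult_left_mono)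
  then show "exp (- b / x) \<le> (x / (x + 1)) powr b" using assms by (simp add: powr_def)
next
  assume x: "1 < x"
  have "ln ((x - 1) / x) \<le> (x - 1) / x - 1" using x by (intro ln_le_minus_one) auto
  also have "\<dots> = - (1 / x)" using x by (simp add: field_simps)
  finally have "1 / x \<le> ln (x / (x - 1))" using x by (simp add: ln_div)
  then have "b * (1 / x) \<le> b * ln (x / (x - 1))" using assms by (intro mult_left_mono)
  then show "exp (b / x) \<le> (x / (x - 1)) powr b" using x by (simp add: powr_def)
qed

text \<open>The deterministic core: \<open>F i t\<close> stands for the CDF at \<open>t / N\<close>,
  \<open>p\<close> for the true cell probabilities and \<open>q\<close> for the observed
  frequencies. The two bounds on \<open>p\<close> are a discrete substitute for the differential
  equation. The condition \<open>real k \<le> real N * x0\<close> keeps the relative growth of the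
  products per step bounded from \<open>x0\<close> on.\<close>

locale auction_grid =
  fixes k N :: nat and \<alpha> \<eta> x0 :: real and F p q :: "nat \<Rightarrow> nat \<Rightarrow> real"
  assumes k: "2 \<le> k" and N: "1 \<le> N" and \<alpha>: "0 < \<alpha>" "\<alpha> \<le> 1" "\<alpha> \<le> \<eta>"
    and x0: "0 < x0" "x0 \<le> 1" "real k \<le> real N * x0"
    and F_0: "\<And>i. i \<in> {1..k} \<Longrightarrow> F i 0 = 0"
    and F_N: "\<And>i. i \<in> {1..k} \<Longrightarrow> F i N = 1"
    and F_Suc: "\<And>i t. i \<in> {1..k} \<Longrightarrow> t < N \<Longrightarrow> \<alpha> / N \<le> F i (Suc t) - F i t"
      "\<And>i t. i \<in> {1..k} \<Longrightarrow> t < N \<Longrightarrow> F i (Suc t) - F i t \<le> \<eta> / N"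
    and p: "\<And>i t. i \<in> {1..k} \<Longrightarrow> t < N \<Longrightarrow>
        (1 - F i (Suc t)) * ((\<Prod>j\<in>{1..k}-{i}. F j (Suc t)) - (\<Prod>j\<in>{1..k}-{i}. F j t)) \<le> p i t"
      "\<And>i t. i \<in> {1..k} \<Longrightarrow> t < N \<Longrightarrow>
        p i t \<le> (1 - F i t) * ((\<Prod>j\<in>{1..k}-{i}. F j (Suc t)) - (\<Prod>j\<in>{1..k}-{i}. F j t))"
    and q: "\<And>i t. i \<in> {1..k} \<Longrightarrow> t < N \<Longrightarrow> \<bar>q i t - p i t\<bar> \<le> 1 / real N ^ 3"
begin

definition H :: "nat \<Rightarrow> nat \<Rightarrow> real" where
  "H i t = (\<Prod>j\<in>{1..k}-{i}. F j t)"

abbreviation h :: "nat \<Rightarrow> nat \<Rightarrow> real" where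
  "h i t \<equiv> prod_est x0 N k q t i"

abbreviation G :: "nat \<Rightarrow> nat \<Rightarrow> real" where
  "G i t \<equiv> cdf_est x0 N k t (prod_est x0 N k q t) i"

text \<open>A common lower bound for all products of distinct CDFs at grid points from
  \<open>x0\<close> on; it converts absolute into relative errors.\<close>

definition Pm :: real where
  "Pm = (\<alpha> * x0) ^ k"

lemma \<eta>: "0 < \<eta>" using \<alpha> by linarith

lemma Npos: "0 < real N" using N by simp

lemma other_bidder: "\<exists>j. j \<in> {1..k} - {i}"
  using k by (intro exI[of _ "if i = 1 then 2 else 1"]) auto

section \<open>Bounds for the CDFs and their products on the grid\<close>

lemma F_bounds:
  assumes i: "i \<in> {1..k}" and t: "t \<le> N"
  shows "\<alpha> * t / N \<le> F i t" "F i t \<le> \<eta> * t / N"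
    "\<alpha> * (N - t) / N \<le> 1 - F i t" "1 - F i t \<le> \<eta> * (N - t) / N"
proof -
  have "\<alpha> * t / N \<le> F i t \<and> F i t \<le> \<eta> * t / N" using t
  proof (induction t)
    case 0
    then show ?case using F_0[OF i] by simp
  next
    case (Suc t)
    then show ?case using F_Suc[OF i, of t] by (simp add: algebra_simps add_divide_distrib)
  qed
  then show "\<alpha> * t / N \<le> F i t" "F i t \<le> \<eta> * t / N" by auto
  have "d \<le> N \<Longrightarrow> \<alpha> * d / N \<le> 1 - F i (N - d) \<and> 1 - F i (N - d) \<le> \<eta> * d / N" for d
  proof (induction d)
    case 0
    then show ?case using F_N[OF i] by simp
  next
    case (Suc d)
    then have "N - Suc d < N" "Suc (N - Suc d) = N - d" by auto
    then show ?case using Suc F_Suc[OF i, of "N - Suc d"] by (simp add: algebra_simps add_divide_distrib)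
  qed
  from this[of "N - t"] show "\<alpha> * (N - t) / N \<le> 1 - F i t" "1 - F i t \<le> \<eta> * (N - t) / N"
    using t by auto
qed

lemma F_mono:
  assumes "i \<in> {1..k}" "s \<le> t" "t \<le> N"
  shows "F i s \<le> F i t"
  using assms(2,3)
proof (induction t rule: dec_induct)
  case (step m)
  have "0 \<le> \<alpha> / N" using \<alpha> by simp
  with step F_Suc(1)[OF assms(1), of m] show ?case by simp
qed simp

lemma F_01:
  assumes "i \<in> {1..k}" "t \<le> N"
  shows "0 \<le> F i t" "F i t \<le> 1"
  using F_mono[OF assms(1), of 0 t] F_mono[OF assms(1), of t N] assms F_0 F_N by auto

lemma F_pos:
  assumes "i \<in> {1..k}" "0 < t" "t \<le> N"
  shows "0 < F i t"
proof -
  have "0 < \<alpha> * t / N" using assms Npos \<alpha> by simp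
  then show ?thesis using F_bounds(1)[OF assms(1,3)] by linarith
qed

lemma F_lt_1:
  assumes "i \<in> {1..k}" "t < N"
  shows "F i t < 1"
proof -
  have "0 < \<alpha> * (N - t) / N" using assms Npos \<alpha> by simp
  then show ?thesis using F_bounds(3)[of i t] assms by simp
qed

lemma H_pos: "i \<in> {1..k} \<Longrightarrow> 0 < t \<Longrightarrow> t \<le> N \<Longrightarrow> 0 < H i t"
  unfolding H_def by (intro prod_pos) (auto intro: F_pos)

lemma H_mono: "s \<le> t \<Longrightarrow> t \<le> N \<Longrightarrow> H i s \<le> H i t"
  unfolding H_def by (intro prod_mono) (auto intro: F_mono F_01)

lemma H_0: "H i 0 = 0"
proof -
  obtain j where "j \<in> {1..k} - {i}" using other_bidder by blast
  then show ?thesis unfolding H_def by (intro prod_zero bexI[of _ j]) (auto simp: F_0)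
qed

lemma F_ge_x0:
  assumes "i \<in> {1..k}" "t \<le> N" "x0 \<le> t / N"
  shows "\<alpha> * x0 \<le> F i t"
proof -
  have "\<alpha> * x0 \<le> \<alpha> * (t / N)" using \<alpha> assms by (intro mult_left_mono) auto
  then show ?thesis using F_bounds(1)[OF assms(1,2)] by simp
qed

lemma \<alpha>x0: "0 < \<alpha> * x0" "\<alpha> * x0 \<le> 1"
  using \<alpha> x0 by (auto simp: mult_le_one)

lemma Pm_pos: "0 < Pm" and Pm_le_1: "Pm \<le> 1"
  unfolding Pm_def using \<alpha>x0 by (auto intro: power_le_one)

lemma Pm_le_prod:
  assumes "J \<subseteq> {1..k}" "t \<le> N" "x0 \<le> t / N"
  shows "Pm \<le> (\<Prod>j\<in>J. F j t)"
proof -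
  have "card J \<le> k" using assms(1) card_mono[of "{1..k}" J] by simp
  then have "Pm \<le> (\<alpha> * x0) ^ card J"
    unfolding Pm_def using \<alpha>x0 by (intro power_decreasing) auto
  also have "\<dots> = (\<Prod>j\<in>J. \<alpha> * x0)" by simp
  also have "\<dots> \<le> (\<Prod>j\<in>J. F j t)"
  proof (intro prod_mono conjI)
    fix j assume "j \<in> J"
    then show "\<alpha> * x0 \<le> F j t" using F_ge_x0[of j t] assms by auto
  qed (use \<alpha>x0 in auto)
  finally show ?thesis .
qed

text \<open>Only the growth of one factor \<open>j\<close>, at least \<open>\<alpha> / N\<close>, is
  used, and the other \<open>k - 2\<close> factors are bounded below by
  \<open>\<alpha> * x0\<close>. The two spare factors of \<open>Pm\<close> are traded for
  \<open>\<alpha>\<close>.\<close>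

lemma H_Suc_diff:
  assumes i: "i \<in> {1..k}" and t: "t < N" "x0 \<le> t / N"
  shows "Pm / N \<le> H i (Suc t) - H i t"
proof -
  obtain j where j: "j \<in> {1..k} - {i}" using other_bidder by blast
  let ?J = "{1..k} - {i} - {j}"
  have eq: "H i s = F j s * (\<Prod>l\<in>?J. F l s)" for s
    unfolding H_def using j by (intro prod.remove) auto
  have "card ?J = k - 2" using i j by (simp add: card_Diff_subset)
  have "Pm = (\<alpha> * x0)\<^sup>2 * (\<Prod>l\<in>?J. \<alpha> * x0)"
  proof -
    have "(\<alpha> * x0) ^ k = (\<alpha> * x0) ^ (2 + (k - 2))"
      using k by (simp only: le_add_diff_inverse)
    then show ?thesis using \<open>card ?J = k - 2\<close> by (simp only: Pm_def power_add prod_constant)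
  qed
  also have "\<dots> \<le> \<alpha> * (\<Prod>l\<in>?J. F l t)"
  proof (intro mult_mono prod_mono)
    have "(\<alpha> * x0)\<^sup>2 \<le> \<alpha> * x0" using \<alpha>x0 by (simp add: power2_eq_square mult_left_le_one_le)
    also have "\<dots> \<le> \<alpha>" using \<alpha> x0 by (simp add: mult_left_le)
    finally show "(\<alpha> * x0)\<^sup>2 \<le> \<alpha>" .
  qed (use \<alpha>x0 \<alpha> t in \<open>auto intro!: F_ge_x0 prod_nonneg F_01\<close>)
  finally have "Pm / N \<le> \<alpha> / N * (\<Prod>l\<in>?J. F l t)" using Npos by (simp add: divide_right_mono)
  also have "\<dots> \<le> (F j (Suc t) - F j t) * (\<Prod>l\<in>?J. F l t)"
    using F_Suc(1)[of j t] j t by (intro mult_right_mono prod_nonneg) (auto intro!: F_01)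
  also have "\<dots> \<le> F j (Suc t) * (\<Prod>l\<in>?J. F l (Suc t)) - F j t * (\<Prod>l\<in>?J. F l t)"
  proof -
    have "F j (Suc t) * (\<Prod>l\<in>?J. F l t) \<le> F j (Suc t) * (\<Prod>l\<in>?J. F l (Suc t))"
      using t j by (intro mult_left_mono prod_mono) (auto intro!: F_01 F_mono)
    then show ?thesis by (simp add: algebra_simps)
  qed
  finally show ?thesis unfolding eq .
qed

text \<open>\<open>1 - w\<close> is the product of \<open>1 - ?a j\<close> over the other bidders,
  where \<open>?a j\<close> is the relative growth of \<open>F j\<close> in this step, of order
  \<open>1 / Suc t\<close>. Each of the \<open>k - 1\<close> factors contributes to the
  weight.\<close>

lemma weight_bounds:
  assumes i: "i \<in> {1..k}" and t: "0 < t" "t < N" "x0 \<le> t / N"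
  defines "w \<equiv> (H i (Suc t) - H i t) / H i (Suc t)"
  shows "0 \<le> w" "w \<le> 1" "(k - 1) * (\<alpha> / \<eta>) / (2 * Suc t) \<le> w" "w \<le> (k - 1) * \<eta> / (\<alpha> * Suc t)"
proof -
  let ?J = "{1..k} - {i}"
  let ?a = "\<lambda>j. (F j (Suc t) - F j t) / F j (Suc t)"
  have card: "card ?J = k - 1" using i by simp
  have Hp: "0 < H i (Suc t)" "0 < H i t" "H i t \<le> H i (Suc t)" using H_pos[OF i] H_mono t by auto
  then show "0 \<le> w" "w \<le> 1" unfolding w_def by auto
  have Fp: "0 < F j (Suc t)" "0 \<le> F j t" "F j t \<le> F j (Suc t)" if "j \<in> ?J" for j
    using that t by (auto intro!: F_pos F_01 F_mono)
  have a01: "0 \<le> ?a j \<and> ?a j \<le> 1" if "j \<in> ?J" for j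
    using Fp[OF that] by (auto simp: field_simps)
  have a_le: "?a j \<le> \<eta> / (\<alpha> * Suc t)" if "j \<in> ?J" for j
  proof -
    have "?a j \<le> (\<eta> / N) / (\<alpha> * Suc t / N)"
      using that t F_Suc(2)[of j t] F_bounds(1)[of j "Suc t"] Fp[OF that] \<alpha> Npos
      by (intro frac_le) auto
    also have "\<dots> = \<eta> / (\<alpha> * Suc t)" using Npos by simp
    finally show ?thesis .
  qed
  have a_ge: "\<alpha> / (\<eta> * Suc t) \<le> ?a j" if "j \<in> ?J" for j
  proof -
    have "\<alpha> / (\<eta> * Suc t) = (\<alpha> / N) / (\<eta> * Suc t / N)" using Npos by simp
    also have "\<dots> \<le> ?a j"
      using that t F_Suc(1)[of j t] F_bounds(2)[of j "Suc t"] Fp[OF that] \<alpha> Npos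
      by (intro frac_le) auto
    finally show ?thesis .
  qed
  have "(\<Prod>j\<in>?J. 1 - ?a j) = (\<Prod>j\<in>?J. F j t / F j (Suc t))"
    using Fp by (intro prod.cong refl) (simp add: diff_divide_distrib less_imp_neq[THEN not_sym])
  also have "\<dots> = H i t / H i (Suc t)" unfolding H_def by (rule prod_dividef)
  finally have w: "(\<Prod>j\<in>?J. 1 - ?a j) = 1 - w"
    unfolding w_def using Hp by (simp add: diff_divide_distrib)
  have "w \<le> sum ?a ?J" using prod_one_minus_bounds(1)[of ?J ?a] a01 w by simp
  also have "\<dots> \<le> (\<Sum>j\<in>?J. \<eta> / (\<alpha> * Suc t))" by (intro sum_mono a_le)
  also have "\<dots> = (k - 1) * \<eta> / (\<alpha> * Suc t)" using card by simp
  finally show "w \<le> (k - 1) * \<eta> / (\<alpha> * Suc t)" .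
  \<comment> \<open>From \<open>(1 - w) * (1 + z) \<le> 1\<close> follows
    \<open>w \<ge> z / (1 + z)\<close>, and \<open>z \<le> 1\<close> then costs a factor 2. The
    latter holds as \<open>k \<le> N * x0 \<le> t\<close>.\<close>
  define z where "z = (k - 1) * (\<alpha> / \<eta>) / (Suc t)"
  have "z = (\<Sum>j\<in>?J. \<alpha> / (\<eta> * Suc t))" unfolding z_def using card by simp
  also have "\<dots> \<le> sum ?a ?J" by (intro sum_mono a_ge)
  finally have z: "z \<le> sum ?a ?J" .
  have z0: "0 \<le> z" unfolding z_def using \<alpha> \<eta> by simp
  have z1: "z \<le> 1"
  proof -
    have "real N * x0 \<le> t" using t(3) Npos by (simp add: field_simps)
    then have "real (k - 1) \<le> real (Suc t)" using x0(3) k by simp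
    moreover have "\<alpha> / \<eta> \<le> 1" using \<alpha> by simp
    ultimately have "(k - 1) * (\<alpha> / \<eta>) \<le> real (Suc t) * 1" using \<alpha> by (intro mult_mono) auto
    then show ?thesis unfolding z_def by (subst pos_divide_le_eq) auto
  qed
  have "(1 - w) * (1 + z) \<le> (1 - w) * (1 + sum ?a ?J)"
    using z \<open>w \<le> 1\<close> by (intro mult_left_mono) auto
  also have "\<dots> \<le> 1" using prod_one_minus_bounds(2)[of ?J ?a] a01 w by simp
  finally have "z \<le> w * (1 + z)" by (simp add: algebra_simps)
  also have "\<dots> \<le> w * 2" using z1 \<open>0 \<le> w\<close> by (intro mult_left_mono) auto
  finally have "z / 2 \<le> w" by simp
  moreover have "z / 2 = (k - 1) * (\<alpha> / \<eta>) / (2 * Suc t)"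
    unfolding z_def by (simp only: divide_divide_eq_left mult_ac of_nat_mult of_nat_numeral)
  ultimately show "(k - 1) * (\<alpha> / \<eta>) / (2 * Suc t) \<le> w" by simp
qed


text \<open>The errors of the \<open>H j\<close> enter through the root of their product and through
  the division by \<open>h i t\<close>. The absolute rounding error \<open>1 / N\<close> of the root
  becomes relative by \<open>P \<ge> Pm\<close>, which is the origin of
  \<open>2 / (N * Pm)\<close>.\<close>

lemma G_error:
  assumes i: "i \<in> {1..k}" and t: "t < N" "x0 \<le> t / N" and A: "0 \<le> A" "A \<le> 1/8"
    and R: "\<And>j. j \<in> {1..k} \<Longrightarrow> \<bar>h j t / H j t - 1\<bar> \<le> A"
  shows "\<bar>G i t - F i t\<bar> \<le> F i t * (4 * A + 2 / (N * Pm))"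
proof -
  define P where "P = (\<Prod>j=1..k. F j t)"
  define R' where "R' = (\<lambda>j. h j t / H j t)"
  have t0: "0 < t" using t(2) x0(1) by (cases t) auto
  have Hp: "0 < H j t" if "j \<in> {1..k}" for j using H_pos that t0 t by auto
  have Fp: "0 < F j t" if "j \<in> {1..k}" for j using F_pos that t0 t by auto
  have PH: "P = F j t * H j t" if "j \<in> {1..k}" for j
    unfolding P_def H_def using that by (intro prod.remove) auto
  have Pp: "0 < P" unfolding P_def by (intro prod_pos) (auto intro: Fp)
  have P1: "P \<le> 1" unfolding P_def using t by (intro prod_le_1) (auto intro!: F_01)
  have Pm: "Pm \<le> P" unfolding P_def using t by (intro Pm_le_prod) auto
  have R': "1 - A \<le> R' j" "R' j \<le> 1 + A" if "j \<in> {1..k}" for j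
    using R[OF that] unfolding R'_def by linarith+
  have "P * (\<Prod>j=1..k. H j t) = (\<Prod>j=1..k. F j t * H j t)" by (simp add: P_def prod.distrib)
  also have "\<dots> = (\<Prod>j=1..k. P)" using PH by (intro prod.cong) auto
  also have "\<dots> = P * P ^ (k - 1)" using k by (cases k) auto
  finally have PP: "(\<Prod>j=1..k. H j t) = P ^ (k - 1)" using Pp by simp
  define v where "v = (\<Prod>j=1..k. h j t)"
  have "v = (\<Prod>j=1..k. R' j * H j t)"
    unfolding v_def R'_def using Hp by (intro prod.cong) (auto simp: less_imp_neq[THEN not_sym])
  then have v: "v = (\<Prod>j=1..k. R' j) * P ^ (k - 1)" by (simp only: prod.distrib PP)
  have "(\<Prod>j=1..k. 1 - A) \<le> (\<Prod>j=1..k. R' j)" using A R' by (intro prod_mono) auto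
  then have v1: "(1 - A) ^ k * P ^ (k - 1) \<le> v" unfolding v using Pp by (intro mult_right_mono) auto
  have "(\<Prod>j=1..k. R' j) \<le> (\<Prod>j=1..k. 1 + A)"
    using A R' by (intro prod_mono) (auto intro: order_trans[of 0 "1 - A"])
  then have v2: "v \<le> (1 + A) ^ k * P ^ (k - 1)" unfolding v using Pp by (intro mult_right_mono) auto
  define Q where "Q = root_scan N (k - 1) v N"
  have Q: "(1 - A)\<^sup>2 * P \<le> Q" "Q \<le> (1 + A)\<^sup>2 * P + 1 / real N"
    unfolding Q_def using root_scan_relative[OF k N Pp P1 A(1) _ v1 v2] A by auto
  have "1 / real N \<le> 2 / (N * Pm) * P / 2"
    using Pm Pm_pos Npos by (simp add: field_simps)
  with Q(2) have Q2: "Q \<le> (1 + A)\<^sup>2 * P + 2 / (N * Pm) * P / 2" by linarith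
  have "\<bar>F i t * (Q / P / R' i) - F i t\<bar> \<le> F i t * (4 * A + 2 / (N * Pm))"
    by (rule quotient_error[OF A R'[OF i] Pp _ Q(1) Q2]) (use Fp[OF i] Pm_pos in auto)
  moreover have "G i t = F i t * (Q / P / R' i)"
  proof -
    have "\<not> t / N < x0" using t by simp
    then have "G i t = Q / h i t" unfolding cdf_est_def Q_def v_def by simp
    also have "\<dots> = Q / (R' i * H i t)" unfolding R'_def using Hp[OF i] by simp
    also have "\<dots> = F i t * (Q / P / R' i)"
      using PH[OF i] Fp[OF i] Hp[OF i] by (simp add: mult.commute)
    finally show ?thesis .
  qed
  ultimately show ?thesis by simp
qed

text \<open>\<open>b / Suc t\<close> is the lower bound for the weight, hence the rate of
  contraction. In \<open>c\<close>, the upper bound for the weight meets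
  \<open>8 * F / (1 - F)\<close>, which yields the rate of expansion \<open>c / (N - t)\<close>.
  \<open>\<kappa>\<close> bounds the rounding, discretization and sampling error of an increment as
  long as \<open>1 - F\<close> is at least \<open>\<alpha> * \<zeta>\<close>;
  \<open>\<kappa>'\<close> multiplies it by the largest weight, attained at
  \<open>x0\<close>.\<close>

definition b :: real where "b = (k - 1) * (\<alpha> / \<eta>) / 2"
definition c :: real where "c = 8 * (k - 1) * \<eta>\<^sup>2 / \<alpha>\<^sup>2"
definition \<kappa> :: "real \<Rightarrow> real" where "\<kappa> \<zeta> = (6 + 2 * \<eta>) / (N * Pm * \<alpha> * \<zeta>)"
definition \<kappa>' :: "real \<Rightarrow> real" where "\<kappa>' \<zeta> = \<kappa> \<zeta> * ((k - 1) * \<eta>) / (\<alpha> * N * x0)"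

text \<open>\<open>\<zeta>\<close> bounds the distance to 1 from below, so that
  \<open>1 - F i t\<close> is at least \<open>\<alpha> * \<zeta>\<close>; together with
  \<open>small\<close> this keeps \<open>1 - G\<close> above half of \<open>1 - F\<close>.\<close>

lemma relative_error_step:
  assumes i: "i \<in> {1..k}" and t: "t < N" "x0 \<le> t / N" and A: "0 \<le> A" "A \<le> 1/8"
    and R: "\<And>j. j \<in> {1..k} \<Longrightarrow> \<bar>h j t / H j t - 1\<bar> \<le> A"
    and \<zeta>: "0 < \<zeta>" "\<zeta> * real N \<le> real N - real t" and small: "4 * A + 2 / (N * Pm) \<le> \<alpha> * \<zeta> / 2"
  shows "\<bar>h i (Suc t) / H i (Suc t) - 1\<bar> \<le> A * (1 - b / Suc t + c / (N - t)) + \<kappa>' \<zeta>"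
proof -
  have t0: "0 < t" using t(2) x0(1) by (cases t) auto
  let ?D = "H i (Suc t) - H i t"
  let ?w = "?D / H i (Suc t)"
  let ?d = "2 / (N * Pm)"
  define \<theta> where "\<theta> = (\<eta> + 1 / Pm) / (N * \<alpha> * \<zeta>)"
  note w = weight_bounds[OF i t0 t]
  have Hp: "0 < H i t" "0 < H i (Suc t)" using H_pos[OF i] t0 t by auto
  have D: "Pm / N \<le> ?D" by (rule H_Suc_diff[OF i t])
  have D0: "0 \<le> ?D" using H_mono[of t "Suc t" i] t by simp
  have F: "0 \<le> F i t" "F i t < 1" using F_01 F_lt_1 i t by auto
  have \<theta>0: "0 \<le> \<theta>" unfolding \<theta>_def using \<eta> Pm_pos \<alpha> \<zeta> by simp
  have d0: "0 \<le> ?d" using Pm_pos by simp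
  have F1: "\<alpha> * \<zeta> \<le> 1 - F i t"
  proof -
    have "\<alpha> * \<zeta> = \<alpha> * (\<zeta> * N) / N" using Npos by simp
    also have "\<dots> \<le> \<alpha> * (N - t) / N"
      using \<zeta> \<alpha> t by (intro divide_right_mono mult_left_mono) (auto simp: of_nat_diff)
    finally show ?thesis using F_bounds(3)[OF i, of t] t by simp
  qed
  have \<alpha>\<zeta>: "0 < \<alpha> * \<zeta>" using \<alpha> \<zeta> by simp
  \<comment> \<open>The two bounds for \<open>p\<close> differ by the growth of \<open>F i\<close>
    times \<open>?D\<close>, which is the discretization error. The sampling error is compared with
    \<open>?D\<close> through \<open>?D \<ge> Pm / N\<close>.\<close>
  have qb: "\<bar>q i t - (1 - F i t) * ?D\<bar> \<le> \<theta> * ((1 - F i t) * ?D)"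
  proof -
    have "\<bar>q i t - (1 - F i t) * ?D\<bar> \<le> 1 / real N ^ 3 + (F i (Suc t) - F i t) * ?D"
    proof -
      have "(1 - F i (Suc t)) * ?D = (1 - F i t) * ?D - (F i (Suc t) - F i t) * ?D"
        by (simp add: algebra_simps)
      then show ?thesis using q[OF i t(1)] p[OF i t(1)] unfolding H_def[symmetric] by linarith
    qed
    also have "\<dots> \<le> ?D / (N * Pm) + \<eta> / N * ?D"
    proof (intro add_mono mult_right_mono D0)
      have "1 / real N ^ 3 \<le> 1 / real N ^ 2" using N by (intro divide_left_mono power_increasing) auto
      also have "\<dots> = (Pm / N) / (N * Pm)" using Pm_pos by (simp add: power2_eq_square)
      also have "\<dots> \<le> ?D / (N * Pm)" using D Pm_pos by (intro divide_right_mono) auto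
      finally show "1 / real N ^ 3 \<le> ?D / (N * Pm)" .
    qed (rule F_Suc(2)[OF i t(1)])
    also have "\<dots> = \<theta> * ((\<alpha> * \<zeta>) * ?D)"
    proof -
      have "\<theta> * (\<alpha> * \<zeta>) = (\<eta> + 1 / Pm) / N" unfolding \<theta>_def using \<alpha> \<zeta> by simp
      then have "\<theta> * ((\<alpha> * \<zeta>) * ?D) = (\<eta> + 1 / Pm) / N * ?D" by (simp only: mult.assoc[symmetric])
      then show ?thesis by (simp add: add_divide_distrib distrib_right)
    qed
    also have "\<dots> \<le> \<theta> * ((1 - F i t) * ?D)"
      using F1 D0 \<theta>0 by (intro mult_left_mono mult_right_mono) auto
    finally show ?thesis .
  qed
  have sm: "F i t * (4 * A + ?d) \<le> (1 - F i t) / 2"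
  proof -
    have "F i t * (4 * A + ?d) \<le> 4 * A + ?d" using F A d0 by (intro mult_left_le_one_le) auto
    also have "\<dots> \<le> (1 - F i t) / 2" using small F1 by simp
    finally show ?thesis .
  qed
  have "\<bar>h i (Suc t) / H i (Suc t) - 1\<bar>
      \<le> (1 - ?w) * A + ?w * (8 * A * (F i t / (1 - F i t)) + 2 * ?d / (1 - F i t) + 2 * \<theta>)"
    using product_step_error[OF Hp(1) _ R[OF i] F G_error[OF i t A R] sm qb \<theta>0 d0] D0 by simp
  also have "\<dots> \<le> (1 - b / Suc t) * A + (c / (N - t) * A + \<kappa>' \<zeta>)"
  proof (intro add_mono)
    have "b / Suc t \<le> ?w" using w(3) unfolding b_def by (simp add: field_simps)
    then show "(1 - ?w) * A \<le> (1 - b / Suc t) * A" using A by (intro mult_right_mono) auto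
    have \<kappa>: "2 * ?d / (1 - F i t) + 2 * \<theta> \<le> \<kappa> \<zeta>"
    proof -
      have "2 * ?d / (1 - F i t) \<le> 2 * ?d / (\<alpha> * \<zeta>)"
        using F1 \<alpha>\<zeta> d0 by (intro divide_left_mono) auto
      moreover have "\<eta> \<le> \<eta> / Pm" using Pm_pos Pm_le_1 \<eta> by (simp add: field_simps)
      then have "\<theta> \<le> (\<eta> / Pm + 1 / Pm) / (N * \<alpha> * \<zeta>)"
        unfolding \<theta>_def using \<alpha> \<zeta> by (intro divide_right_mono) auto
      ultimately have "2 * ?d / (1 - F i t) + 2 * \<theta> \<le> 2 * ?d / (\<alpha> * \<zeta>) + 2 * ((\<eta> / Pm + 1 / Pm) / (N * \<alpha> * \<zeta>))"
        by linarith
      also have "\<dots> = \<kappa> \<zeta>" unfolding \<kappa>_def using Pm_pos Npos \<alpha> \<zeta> by (simp add: field_simps)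
      finally show ?thesis .
    qed
    have \<kappa>0: "0 \<le> \<kappa> \<zeta>" unfolding \<kappa>_def using Pm_pos \<alpha> \<zeta> \<eta> by simp
    have w\<kappa>: "?w * \<kappa> \<zeta> \<le> \<kappa>' \<zeta>"
    proof -
      have "real N * x0 \<le> Suc t" using t(2) Npos by (simp add: field_simps)
      then have "(k - 1) * \<eta> / (\<alpha> * Suc t) \<le> (k - 1) * \<eta> / (\<alpha> * (N * x0))"
        using \<alpha> \<eta> x0 Npos by (intro divide_left_mono mult_left_mono) auto
      then have "?w \<le> (k - 1) * \<eta> / (\<alpha> * (N * x0))" using w(4) by linarith
      then have "?w * \<kappa> \<zeta> \<le> (k - 1) * \<eta> / (\<alpha> * (N * x0)) * \<kappa> \<zeta>" using \<kappa>0 by (intro mult_right_mono)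
      then show ?thesis unfolding \<kappa>'_def by (simp add: mult_ac)
    qed
    \<comment> \<open>The weight is of order \<open>1 / Suc t\<close> and \<open>F / (1 - F)\<close>
      of order \<open>Suc t / (N - t)\<close>: \<open>Suc t\<close> cancels, so the expansion is
      singular only at 1.\<close>
    have wF: "?w * (F i t / (1 - F i t)) \<le> (c / 8) / (N - t)"
    proof -
      have Nt: "0 < real (N - t)" using t by simp
      have "F i t / (1 - F i t) \<le> (\<eta> * Suc t / N) / (\<alpha> * (N - t) / N)"
      proof (intro frac_le)
        have "\<eta> * t / N \<le> \<eta> * Suc t / N" using \<eta> Npos by (intro divide_right_mono mult_left_mono) auto
        then show "F i t \<le> \<eta> * Suc t / N" using F_bounds(2)[OF i, of t] t by linarith
      qed (use F_bounds(3)[OF i, of t] t F \<alpha> \<eta> Npos Nt in auto)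
      also have "\<dots> = \<eta> * Suc t / (\<alpha> * (N - t))" using Npos by simp
      finally have "?w * (F i t / (1 - F i t)) \<le> (k - 1) * \<eta> / (\<alpha> * Suc t) * (\<eta> * Suc t / (\<alpha> * (N - t)))"
        using w(1,4) F \<eta> \<alpha> by (intro mult_mono) auto
      also have "\<dots> = (c / 8) / (N - t)"
        unfolding c_def using \<alpha> Nt by (simp add: power2_eq_square del: of_nat_Suc)
      finally show ?thesis .
    qed
    have "?w * (8 * A * (F i t / (1 - F i t)) + 2 * ?d / (1 - F i t) + 2 * \<theta>)
        = 8 * A * (?w * (F i t / (1 - F i t))) + ?w * (2 * ?d / (1 - F i t) + 2 * \<theta>)"
      by (simp only: distrib_left mult_ac add.assoc)
    also have "\<dots> \<le> 8 * A * ((c / 8) / (N - t)) + ?w * \<kappa> \<zeta>"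
      using wF \<kappa> w(1) A by (intro add_mono mult_left_mono) auto
    also have "\<dots> \<le> c / (N - t) * A + \<kappa>' \<zeta>"
      using w\<kappa> by (simp add: mult.commute)
    finally show "?w * (8 * A * (F i t / (1 - F i t)) + 2 * ?d / (1 - F i t) + 2 * \<theta>) \<le> c / (N - t) * A + \<kappa>' \<zeta>" .
  qed
  also have "\<dots> = A * (1 - b / Suc t + c / (N - t)) + \<kappa>' \<zeta>" by (simp add: algebra_simps)
  finally show ?thesis .
qed


section \<open>Solution of the error recursion\<close>

lemma b_nonneg: "0 \<le> b" and c_nonneg: "0 \<le> c"
  unfolding b_def c_def using \<alpha> \<eta> by auto

lemma \<kappa>'_nonneg: "0 < \<zeta> \<Longrightarrow> 0 \<le> \<kappa>' \<zeta>"
  unfolding \<kappa>'_def \<kappa>_def using \<alpha> \<eta> x0 Pm_pos by auto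

text \<open>An explicit supersolution of the recursion in \<open>relative_error_step\<close>: the
  initial error with damping and expansion, plus \<open>t - t0\<close> local errors, for which the
  damping is given away.\<close>

definition B :: "nat \<Rightarrow> real \<Rightarrow> real \<Rightarrow> nat \<Rightarrow> real" where
  "B t0 A0 \<zeta> t = A0 * ((real t0 + 1) / (real t + 1)) powr b * (N / (real N - real t)) powr c
     + (real t - real t0) * \<kappa>' \<zeta> * (N / (real N - real t)) powr c"

lemma B_step:
  assumes t: "t0 \<le> t" "Suc t < N" and "0 \<le> A0" "0 < \<zeta>"
  shows "B t0 A0 \<zeta> t * (1 - b / Suc t + c / (N - t)) + \<kappa>' \<zeta> \<le> B t0 A0 \<zeta> (Suc t)"
proof -
  let ?x = "real t + 1" and ?y = "real N - real t"
  let ?u = "(real t0 + 1) powr b" and ?v = "real N powr c"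
  let ?g = "1 - b / ?x + c / ?y"
  have y: "1 < ?y" "real (N - t) = ?y" using t by auto
  have g_eq: "?g = 1 + (- b / ?x + c / ?y)" by simp
  have g: "?g \<le> exp (- b / ?x) * exp (c / ?y)"
    unfolding g_eq exp_add[symmetric] by (rule exp_ge_add_one_self)
  have e1: "exp (- b / ?x) \<le> (?x / (?x + 1)) powr b" by (rule powr_ratio_exp) (auto simp: b_nonneg)
  have e2: "exp (c / ?y) \<le> (?y / (?y - 1)) powr c" by (rule powr_ratio_exp) (use y c_nonneg in auto)
  have r1: "((real t0 + 1) / ?x) powr b * (?x / (?x + 1)) powr b = ((real t0 + 1) / (?x + 1)) powr b"
    by (subst powr_mult[symmetric]) auto
  have r2: "(N / ?y) powr c * (?y / (?y - 1)) powr c = (N / (?y - 1)) powr c"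
    using y by (subst powr_mult[symmetric]) auto
  let ?E1 = "((real t0 + 1) / ?x) powr b" and ?E1' = "((real t0 + 1) / (?x + 1)) powr b"
  let ?E2 = "(N / ?y) powr c" and ?E2' = "(N / (?y - 1)) powr c"
  have "?E1 * ?E2 * ?g \<le> ?E1 * ?E2 * (exp (- b / ?x) * exp (c / ?y))"
    using g by (intro mult_left_mono) auto
  also have "\<dots> = (?E1 * exp (- b / ?x)) * (?E2 * exp (c / ?y))" by simp
  also have "\<dots> \<le> ?E1' * ?E2'"
    unfolding r1[symmetric] r2[symmetric] using e1 e2 by (intro mult_mono) auto
  finally have 1: "A0 * (?E1 * ?E2 * ?g) \<le> A0 * (?E1' * ?E2')" using assms by (intro mult_left_mono)
  have "?E2 * ?g \<le> ?E2 * exp (c / ?y)"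
  proof (rule mult_left_mono)
    have "- b / ?x \<le> 0" using b_nonneg by simp
    then have "exp (- b / ?x) \<le> 1" by simp
    then have "exp (- b / ?x) * exp (c / ?y) \<le> 1 * exp (c / ?y)" by (intro mult_right_mono) auto
    from order_trans[OF g this] show "?g \<le> exp (c / ?y)" by (simp only: mult_1_left)
  qed simp
  also have "\<dots> \<le> ?E2'" unfolding r2[symmetric] using e2 by (intro mult_left_mono) auto
  finally have 2: "((real t - real t0) * \<kappa>' \<zeta>) * (?E2 * ?g) \<le> ((real t - real t0) * \<kappa>' \<zeta>) * ?E2'"
    using t \<kappa>'_nonneg[OF assms(4)] by (intro mult_left_mono) auto
  have "1 \<le> ?E2'" using y c_nonneg t by (intro ge_one_powr_ge_zero) auto
  then have 3: "\<kappa>' \<zeta> * 1 \<le> \<kappa>' \<zeta> * ?E2'" using \<kappa>'_nonneg[OF assms(4)] by (intro mult_left_mono)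
  have "B t0 A0 \<zeta> t * ?g + \<kappa>' \<zeta> = A0 * (?E1 * ?E2 * ?g) + ((real t - real t0) * \<kappa>' \<zeta>) * (?E2 * ?g) + \<kappa>' \<zeta> * 1"
    unfolding B_def by (simp only: distrib_right mult.assoc mult_1_right)
  also have "\<dots> \<le> A0 * (?E1' * ?E2') + ((real t - real t0) * \<kappa>' \<zeta>) * ?E2' + \<kappa>' \<zeta> * ?E2'"
    using 1 2 3 by linarith
  also have "\<dots> = B t0 A0 \<zeta> (Suc t)"
  proof -
    have s: "real (Suc t) + 1 = ?x + 1" "real N - real (Suc t) = ?y - 1" by auto
    show ?thesis unfolding B_def s by (simp add: algebra_simps)
  qed
  finally show ?thesis using y(2) by (simp add: add.commute)
qed

text \<open>The bound for one step presupposes that the error is already small. As \<open>B\<close>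
  is explicit, its smallness can be assumed here for the whole range and verified once the
  parameters are chosen.\<close>

lemma relative_error:
  assumes t0: "x0 \<le> t0 / N" and A0: "0 \<le> A0"
    and init: "\<And>i. i \<in> {1..k} \<Longrightarrow> \<bar>h i t0 / H i t0 - 1\<bar> \<le> A0"
    and \<zeta>: "0 < \<zeta>" "\<zeta> * real N \<le> real N - real T"
    and small: "\<And>t. t0 \<le> t \<Longrightarrow> t \<le> T \<Longrightarrow> B t0 A0 \<zeta> t \<le> 1/8"
      "\<And>t. t0 \<le> t \<Longrightarrow> t \<le> T \<Longrightarrow> 4 * B t0 A0 \<zeta> t + 2 / (N * Pm) \<le> \<alpha> * \<zeta> / 2"
  shows "t0 \<le> t \<Longrightarrow> t \<le> T \<Longrightarrow> \<forall>i\<in>{1..k}. \<bar>h i t / H i t - 1\<bar> \<le> B t0 A0 \<zeta> t"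
proof (induction t rule: dec_induct)
  case base
  have "0 < \<zeta> * real N" using \<zeta> Npos by simp
  then have "t0 < N" using \<zeta> base by linarith
  then have "1 \<le> N / (real N - real t0)" by simp
  then have "1 \<le> (N / (real N - real t0)) powr c" using c_nonneg by (intro ge_one_powr_ge_zero)
  then have "A0 \<le> B t0 A0 \<zeta> t0" unfolding B_def using A0 by (simp add: mult_le_cancel_left1)
  then show ?case using init by force
next
  case (step t)
  have "0 < \<zeta> * real N" using \<zeta> Npos by simp
  then have T: "T < N" using \<zeta> by linarith
  have Bt: "0 \<le> B t0 A0 \<zeta> t"
    using step k by (auto dest!: bspec[of _ _ 1] intro: order_trans[OF abs_ge_zero])
  have x: "x0 \<le> t / N" using t0 step Npos by (meson divide_right_mono of_nat_0_le_iff of_nat_mono order_trans)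
  show ?case
  proof
    fix i assume i: "i \<in> {1..k}"
    have "\<bar>h i (Suc t) / H i (Suc t) - 1\<bar> \<le> B t0 A0 \<zeta> t * (1 - b / Suc t + c / (N - t)) + \<kappa>' \<zeta>"
      by (rule relative_error_step[OF i _ x Bt]) (use step small[of t] \<zeta> T in auto)
    also have "\<dots> \<le> B t0 A0 \<zeta> (Suc t)" by (rule B_step) (use step T A0 \<zeta> in auto)
    finally show "\<bar>h i (Suc t) / H i (Suc t) - 1\<bar> \<le> B t0 A0 \<zeta> (Suc t)" .
  qed
qed

text \<open>Below \<open>x0\<close> the estimate \<open>cdf_est\<close> is 0, so
  \<open>h i t0\<close> is a plain sum of frequencies. The sum of the true \<open>p i s\<close> lies
  between \<open>(1 - F i t0) * H i t0\<close> and \<open>H i t0\<close>, whence a relative error of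
  at most \<open>F i t0\<close> before sampling noise.\<close>

lemma initial_error:
  assumes i: "i \<in> {1..k}" and t0: "t0 \<le> N" "x0 \<le> t0 / N" and before: "\<And>t. t < t0 \<Longrightarrow> real t / N < x0"
  shows "\<bar>h i t0 / H i t0 - 1\<bar> \<le> 2 * \<eta> * x0 + 1 / (real N ^ 2 * Pm)"
proof -
  have t0p: "0 < t0" using t0(2) x0(1) by (cases t0) auto
  have Hp: "0 < H i t0" using H_pos[OF i t0p t0(1)] .
  have hs: "t \<le> t0 \<Longrightarrow> h i t = (\<Sum>s<t. q i s)" for t
    using before by (induction t) (auto simp: cdf_est_def)
  have "\<bar>(\<Sum>s<t0. q i s) - (\<Sum>s<t0. p i s)\<bar> \<le> (\<Sum>s<t0. \<bar>q i s - p i s\<bar>)"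
    unfolding sum_subtractf[symmetric] by (rule sum_abs)
  also have "\<dots> \<le> (\<Sum>s<t0. 1 / real N ^ 3)" using q[OF i] t0 by (intro sum_mono) auto
  also have "\<dots> \<le> N * (1 / real N ^ 3)" using t0 by (simp add: divide_right_mono)
  also have "\<dots> = 1 / real N ^ 2" using Npos by (simp add: power2_eq_square power3_eq_cube)
  finally have 1: "\<bar>h i t0 - (\<Sum>s<t0. p i s)\<bar> \<le> 1 / real N ^ 2" using hs by simp
  have tel: "(\<Sum>s<t0. H i (Suc s) - H i s) = H i t0"
    by (subst sum_lessThan_telescope) (simp add: H_0)
  have Hd: "0 \<le> H i (Suc s) - H i s" if "s < t0" for s using H_mono[of s "Suc s" i] that t0 by simp
  have "(\<Sum>s<t0. p i s) \<le> (\<Sum>s<t0. H i (Suc s) - H i s)"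
  proof (rule sum_mono)
    fix s assume s: "s \<in> {..<t0}"
    have "p i s \<le> (1 - F i s) * (H i (Suc s) - H i s)" using p(2)[OF i, of s] s t0 by (simp add: H_def)
    also have "\<dots> \<le> 1 * (H i (Suc s) - H i s)" using s t0 Hd F_01[OF i, of s] by (intro mult_right_mono) auto
    finally show "p i s \<le> H i (Suc s) - H i s" by simp
  qed
  then have 2: "(\<Sum>s<t0. p i s) \<le> H i t0" using tel by simp
  have "(1 - F i t0) * (\<Sum>s<t0. H i (Suc s) - H i s) \<le> (\<Sum>s<t0. p i s)"
    unfolding sum_distrib_left
  proof (rule sum_mono)
    fix s assume s: "s \<in> {..<t0}"
    have "(1 - F i t0) * (H i (Suc s) - H i s) \<le> (1 - F i (Suc s)) * (H i (Suc s) - H i s)"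
      using s t0 Hd F_mono[OF i, of "Suc s" t0] by (intro mult_right_mono) auto
    also have "\<dots> \<le> p i s" using p(1)[OF i, of s] s t0 by (simp add: H_def)
    finally show "(1 - F i t0) * (H i (Suc s) - H i s) \<le> p i s" .
  qed
  then have 3: "(1 - F i t0) * H i t0 \<le> (\<Sum>s<t0. p i s)" using tel by simp
  have F: "F i t0 \<le> 2 * \<eta> * x0"
  proof -
    \<comment> \<open>\<open>t0\<close> exceeds \<open>N * x0\<close> by less than 1, and this
      overshoot at most doubles it because \<open>N * x0 \<ge> k\<close>.\<close>
    have "real (t0 - 1) / N < x0" using before[of "t0 - 1"] t0p by simp
    then have "real t0 < N * x0 + 1" using Npos t0p by (simp add: field_simps)
    also have "\<dots> \<le> 2 * (N * x0)"
    proof -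
      have "2 \<le> real k" using k by simp
      then show ?thesis using x0(3) by linarith
    qed
    finally have "\<eta> * t0 / N \<le> \<eta> * (2 * (N * x0)) / N"
      using \<eta> Npos by (intro divide_right_mono mult_left_mono) auto
    also have "\<dots> = 2 * \<eta> * x0" using Npos by simp
    finally show ?thesis using F_bounds(2)[OF i t0(1)] by linarith
  qed
  have 4: "1 / real N ^ 2 \<le> 1 / (real N ^ 2 * Pm) * H i t0"
  proof -
    have "Pm \<le> H i t0" unfolding H_def using t0 by (intro Pm_le_prod) auto
    then show ?thesis using Pm_pos Npos by (simp add: field_simps)
  qed
  have "\<bar>h i t0 - H i t0\<bar> \<le> F i t0 * H i t0 + 1 / real N ^ 2"
    using 1 2 3 F_01[OF i t0(1)] Hp by (simp add: algebra_simps abs_le_iff) 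
  also have "\<dots> \<le> (2 * \<eta> * x0) * H i t0 + 1 / (real N ^ 2 * Pm) * H i t0"
    using F Hp 4 by (intro add_mono mult_right_mono) auto
  finally have "\<bar>h i t0 - H i t0\<bar> \<le> (2 * \<eta> * x0 + 1 / (real N ^ 2 * Pm)) * H i t0"
    by (simp add: distrib_right)
  moreover have "h i t0 / H i t0 - 1 = (h i t0 - H i t0) / H i t0"
    using Hp by (simp add: diff_divide_distrib)
  ultimately show ?thesis using Hp by (simp add: abs_divide pos_divide_le_eq)
qed

end

lemma max_min_error:
  fixes M g \<delta> :: real
  assumes "\<bar>M - F\<bar> \<le> \<delta>" "F \<le> F'" "F' \<le> 1" "\<bar>g - F'\<bar> \<le> \<delta>"
  shows "\<bar>max M (min 1 g) - F'\<bar> \<le> \<delta>"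
  using assms by linarith

context auction_grid
begin

section \<open>Accuracy of the output for a suitable grid\<close>

lemma mono_est_le_1: "mono_est x0 N k q t i \<le> 1"
  by (induction t) auto

lemma mono_est_mono: "s \<le> t \<Longrightarrow> mono_est x0 N k q s i \<le> mono_est x0 N k q t i"
  by (induction t rule: dec_induct) auto

text \<open>Beyond \<open>T\<close> nothing is known about \<open>G\<close>. There the output lies
  between its value at \<open>Suc T\<close> and 1, and \<open>F i l\<close> between
  \<open>F i T\<close> and 1; the error at \<open>T\<close> and the missing mass
  \<open>1 - F i T\<close> contribute \<open>\<delta>\<close> each.\<close>

lemma mono_est_error:
  assumes i: "i \<in> {1..k}" and T: "T < N" "1 - \<delta> \<le> F i T" and "0 \<le> \<delta>"
    and before: "\<And>t. t < t0 \<Longrightarrow> real t / N < x0" "\<eta> * x0 \<le> \<delta>"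
    and err: "\<And>t. t0 \<le> t \<Longrightarrow> t \<le> T \<Longrightarrow> \<bar>G i t - F i t\<bar> \<le> \<delta>"
    and l: "l < N"
  shows "\<bar>mono_est x0 N k q (Suc l) i - F i l\<bar> \<le> 2 * \<delta>"
proof -
  have G: "\<bar>G i t - F i t\<bar> \<le> \<delta>" if "t \<le> T" for t
  proof (cases "t0 \<le> t")
    case False
    then have "t / N < x0" using before by simp
    then have "\<eta> * (t / N) \<le> \<eta> * x0" using \<eta> by (intro mult_left_mono) auto
    moreover have "G i t = 0" using \<open>t / N < x0\<close> by (simp add: cdf_est_def)
    ultimately show ?thesis using F_bounds(2)[OF i, of t] F_01[OF i, of t] before T that by simp
  qed (use err that in auto)
  have main: "\<bar>mono_est x0 N k q (Suc l) i - F i l\<bar> \<le> \<delta>" if "l \<le> T" for l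
    using that
  proof (induction l)
    case 0
    then show ?case using G[of 0] F_0[OF i] assms(4) by auto
  next
    case (Suc l)
    have "F i l \<le> F i (Suc l)" "F i (Suc l) \<le> 1" using F_mono[OF i] F_01[OF i] Suc.prems T by auto
    moreover have "\<bar>mono_est x0 N k q (Suc l) i - F i l\<bar> \<le> \<delta>" using Suc by simp
    moreover have "\<bar>G i (Suc l) - F i (Suc l)\<bar> \<le> \<delta>" by (rule G[OF Suc.prems])
    moreover have "mono_est x0 N k q (Suc (Suc l)) i = max (mono_est x0 N k q (Suc l) i) (min 1 (G i (Suc l)))"
      by simp
    ultimately show ?case by (simp only: max_min_error)
  qed
  show ?thesis
  proof (cases "l \<le> T")
    case True
    then show ?thesis using main[of l] assms(4) by linarith
  next
    case False
    have "mono_est x0 N k q (Suc T) i \<le> mono_est x0 N k q (Suc l) i" using False by (intro mono_est_mono) auto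
    moreover have "F i T \<le> F i l" "F i l \<le> 1" using False l by (auto intro!: F_mono F_01 i)
    moreover have "mono_est x0 N k q (Suc l) i \<le> 1" by (rule mono_est_le_1)
    ultimately show ?thesis using main[of T] T(2) assms(4) by linarith
  qed
qed

text \<open>\<open>y\<close> is \<open>1 / \<epsilon>\<close>. The numbers bounded by
  \<open>K\<close> are the constants to be absorbed: directly, or after taking a power
  \<open>k\<close> or \<open>k - 1\<close>, they are at most \<open>y\<close>. The first condition
  on \<open>c1\<close> makes the start accurate enough for the left half of the interval; the second
  gives \<open>c - c1 * b \<le> -4\<close>, so that damping wins in the right half. The condition on
  \<open>c2\<close> pays for \<open>1 / Pm\<close>, \<open>1 / x0\<close> and the expansion of the
  local errors.\<close>

lemma estimate_error:
  fixes y K C :: real and c1 c2 :: nat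
  assumes eta1: "1 \<le> \<eta>" and y: "K ^ k \<le> y" and x0y: "x0 = 1 / y ^ c1" and Ny: "y ^ (c2 * k) \<le> N"
  defines "C \<equiv> 8 * \<eta>\<^sup>2 / \<alpha>\<^sup>2"
  assumes K: "2 \<le> K" "1 / \<alpha> \<le> K" "256 * \<eta> / \<alpha> \<le> K" "2 powr C \<le> K" "4 * (8 * \<eta>) powr C \<le> K"
      "(6 + 2 * \<eta>) * 8 * \<eta>\<^sup>2 / \<alpha>\<^sup>2 \<le> K"
    and c1: "4 \<le> c1" "C + 4 \<le> c1 * (\<alpha> / \<eta>) / 2" and c2: "2 * c1 + C + 7 \<le> c2"
    and i: "i \<in> {1..k}" and l: "l < N"
  shows "\<bar>mono_est x0 N k q (Suc l) i - F i l\<bar> \<le> 1 / (2 * y)" "\<eta> / N \<le> 1 / (2 * y)"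
proof -
  have Ky: "K \<le> y" 
    using y K(1) k self_le_power[of K k] by linarith
  have Kpos: "0 < K" using K by simp
  have y1: "1 < y" "0 < y" using Ky K by auto
  have K_pow: "a ^ k \<le> y" "a ^ (k - 1) \<le> y" if "0 \<le> a" "a \<le> K" for a
  proof -
    have "a ^ k \<le> K ^ k" using that by (intro power_mono) auto
    then show "a ^ k \<le> y" using y by linarith
    have "a ^ (k - 1) \<le> K ^ (k - 1)" using that by (intro power_mono) auto
    also have "\<dots> \<le> K ^ k" using K by (intro power_increasing) auto
    finally show "a ^ (k - 1) \<le> y" using y by linarith
  qed
  have ky: "real k \<le> y"
    using K_pow(1)[of 2] K of_nat_less_two_power[of k, where ?'a = real] by linarith
  have C0: "0 \<le> C" unfolding C_def using \<alpha> \<eta> by simp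
  have cC: "c = (k - 1) * C" unfolding c_def C_def by simp
  have powr_pow: "(a powr C) ^ (k - 1) = a powr c" if "0 < a" for a :: real
  proof -
    have "(a powr C) ^ (k - 1) = (a powr C) powr real (k - 1)" using that by (simp only: powr_realpow powr_gt_zero)
    also have "\<dots> = a powr c" unfolding cC powr_powr by (simp only: mult.commute)
    finally show ?thesis .
  qed
  have pw: "y ^ n = y powr real n" for n using y1 by (simp add: powr_realpow)
  have x0': "x0 = y powr - real c1" unfolding x0y pw using y1 by (simp add: powr_minus_divide)
  have N_inv: "1 / N \<le> y powr - (c2 * k)"
  proof -
    have "1 / N \<le> 1 / y ^ (c2 * k)" using Ny y1 Npos by (intro divide_left_mono) auto
    then show ?thesis unfolding pw using y1 by (simp add: powr_minus_divide)
  qed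
  have Pm_inv: "1 / Pm \<le> y powr (1 + c1 * k)"
  proof -
    have "1 / Pm = (1 / \<alpha>) ^ k * (1 / x0) ^ k" unfolding Pm_def by (simp add: power_mult_distrib power_one_over)
    also have "(1 / x0) ^ k = y powr (c1 * k)" unfolding x0y using pw[of "c1 * k"] by (simp add: power_mult)
    also have "(1 / \<alpha>) ^ k * y powr (c1 * k) \<le> y * y powr (c1 * k)"
      using K_pow(1)[of "1 / \<alpha>"] K \<alpha> by (intro mult_right_mono) auto
    also have "\<dots> = y powr (1 + c1 * k)" using y1 by (simp add: powr_add)
    finally show ?thesis .
  qed
  have k2: "2 \<le> real k" using k by simp
  have c2': "2 * c1 + 7 \<le> real c2" using c2 C0 by linarith
  have ce: "c1 * real k + 7 * k \<le> c2 * real k" "(2 * c1 + C + 7) * real k \<le> c2 * real k"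
  proof -
    have "(c1 + 7) * real k \<le> c2 * real k" using c2' by (intro mult_right_mono) auto
    then show "c1 * real k + 7 * k \<le> c2 * real k" by (simp add: distrib_right)
    show "(2 * c1 + C + 7) * real k \<le> c2 * real k" using c2 by (intro mult_right_mono) auto
  qed
  have NPm: "1 / (N * Pm) \<le> y powr - 3"
  proof -
    have "1 / (N * Pm) = (1 / N) * (1 / Pm)" by simp
    also have "\<dots> \<le> y powr - (c2 * k) * y powr (1 + c1 * k)"
      using N_inv Pm_inv Pm_pos by (intro mult_mono) auto
    also have "\<dots> = y powr (1 + real c1 * real k - real c2 * real k)" by (simp add: powr_add[symmetric])
    also have "\<dots> \<le> y powr - 3" using ce(1) k2 y1 by (intro powr_mono) auto
    finally show ?thesis .
  qed
  have small2: "y powr - 2 \<le> (\<alpha> / (256 * \<eta>)) * (1 / y)"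
  proof -
    have "256 * \<eta> / \<alpha> \<le> y" using K(3) Ky by linarith
    then have "1 / y \<le> \<alpha> / (256 * \<eta>)" using \<alpha> \<eta> y1 by (simp add: field_simps)
    then have "1 / y * (1 / y) \<le> \<alpha> / (256 * \<eta>) * (1 / y)" using y1 by (intro mult_right_mono) auto
    moreover have "y powr - 2 = 1 / y * (1 / y)"
      using y1 by (simp add: powr_minus_divide powr_numeral power2_eq_square)
    ultimately show ?thesis by simp
  qed
  \<comment> \<open>The last \<open>u \<le> Z\<close> steps carry mass at most
    \<open>\<eta> * Z / N = 1 / (4 * y)\<close>. \<open>\<zeta>\<close> is half of
    \<open>Z / N\<close>, which leaves room for rounding \<open>Z\<close> down.\<close>
  define \<zeta> where "\<zeta> = 1 / (8 * \<eta> * y)"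
  define Z where "Z = N / (4 * \<eta> * y)"
  define u where "u = nat \<lfloor>Z\<rfloor>"
  define T where "T = N - u"
  define t0 where "t0 = (LEAST t. x0 \<le> real t / N)"
  define A0 where "A0 = 2 * \<eta> * x0 + 1 / (real N ^ 2 * Pm)"
  have \<zeta>: "0 < \<zeta>" unfolding \<zeta>_def using \<eta> y1 by simp
  have y\<eta>: "256 * \<eta> \<le> y"
  proof -
    have "256 * \<eta> \<le> 256 * \<eta> / \<alpha>" using \<alpha> \<eta> by (simp add: field_simps)
    then show ?thesis using K Ky by linarith
  qed
  have N3: "y ^ 3 \<le> N"
  proof -
    have "3 \<le> real c2 * real k" using c2' k2 mult_mono[of 3 "real c2" 1 "real k"] by linarith
    then have "3 \<le> c2 * k" by (simp flip: of_nat_mult)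
    then have "y ^ 3 \<le> y ^ (c2 * k)" using y1 by (intro power_increasing) auto
    then show ?thesis using Ny by linarith
  qed
  have y2N: "y * (4 * \<eta> * y) \<le> N"
  proof -
    have "y * (4 * \<eta> * y) = (4 * \<eta>) * (y * y)" by simp
    also have "\<dots> \<le> y * (y * y)" using y\<eta> \<eta> y1 by (intro mult_right_mono) auto
    also have "\<dots> = y ^ 3" by (simp add: power3_eq_cube)
    finally show ?thesis using N3 by linarith
  qed
  have Zy: "y \<le> Z" unfolding Z_def using y2N \<eta> y1 by (simp add: pos_le_divide_eq)
  have ZN: "Z \<le> N / 2"
  proof -
    have "1 * 2 \<le> (4 * \<eta>) * y" using eta1 Ky K by (intro mult_mono) auto
    then show ?thesis unfolding Z_def using Npos by (intro divide_left_mono) auto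
  qed
  have u: "u \<le> Z" "Z / 2 \<le> u" "0 < u"
    using Zy Ky K unfolding u_def by linarith+
  have uN: "real u \<le> N / 2" using u ZN by linarith
  have T: "real T = real N - real u" "T < N" unfolding T_def using uN u by linarith+
  have \<zeta>T: "\<zeta> * real N \<le> real N - real T"
  proof -
    have "\<zeta> * real N = Z / 2" unfolding \<zeta>_def Z_def by simp
    then show ?thesis using u T by linarith
  qed
  have ex: "x0 \<le> real N / N" using x0 Npos by simp
  have t0: "x0 \<le> real t0 / N" unfolding t0_def using ex by (rule LeastI)
  have before: "real t / N < x0" if "t < t0" for t
    using not_less_Least[OF that[unfolded t0_def]] by simp
  have t0N: "t0 \<le> N" unfolding t0_def using ex by (rule Least_le)
  have t0p: "0 < t0" using t0 x0(1) by (cases t0) auto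
  have t0x: "real t0 + 1 \<le> 2 * (N * x0)"
  proof -
    have "real (t0 - 1) / N < x0" using before[of "t0 - 1"] t0p by simp
    then have "real t0 < N * x0 + 1" using Npos t0p by (simp add: field_simps)
    then show ?thesis using x0(3) k2 by linarith
  qed
  have N_inv_x0: "1 / N \<le> x0" using x0(3) k2 Npos by (simp add: field_simps)
  have A0: "0 \<le> A0" "A0 \<le> y powr (1 - real c1)"
  proof -
    show "0 \<le> A0" unfolding A0_def using \<eta> x0 Pm_pos by simp
    have "1 / (real N ^ 2 * Pm) = (1 / N) * (1 / (N * Pm))" by (simp add: power2_eq_square)
    also have "\<dots> \<le> x0 * 1"
    proof (intro mult_mono N_inv_x0)
      have "y powr - 3 \<le> y powr 0" using y1 by (intro powr_mono) auto
      then show "1 / (N * Pm) \<le> 1" using NPm y1 by simp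
    qed (use x0 Pm_pos in auto)
    finally have "A0 \<le> 2 * \<eta> * x0 + x0" unfolding A0_def by simp
    also have "\<dots> = (2 * \<eta> + 1) * x0" by (simp add: distrib_right)
    also have "\<dots> \<le> y * x0" using y\<eta> eta1 x0 by (intro mult_right_mono) auto
    also have "\<dots> = y powr (1 - real c1)" unfolding x0' using y1 by (simp add: powr_diff powr_minus_divide)
    finally show "A0 \<le> y powr (1 - real c1)" .
  qed
  have init: "\<bar>h j t0 / H j t0 - 1\<bar> \<le> A0" if "j \<in> {1..k}" for j
    unfolding A0_def by (rule initial_error[OF that t0N t0 before])
  have Ry: "(8 * \<eta> * y) powr c \<le> y * y powr c"
  proof -
    have "(8 * \<eta>) powr c = ((8 * \<eta>) powr C) ^ (k - 1)" using powr_pow \<eta> by simp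
    also have "(8 * \<eta>) powr C \<le> K" using K(5) powr_ge_zero[of "8 * \<eta>" C] by linarith
    then have "((8 * \<eta>) powr C) ^ (k - 1) \<le> y" by (intro K_pow(2)) auto
    finally show ?thesis using \<eta> y1 by (simp add: powr_mult mult_right_mono)
  qed
  have R: "N / (real N - real t) \<le> 8 * \<eta> * y" "0 \<le> N / (real N - real t)" if "t \<le> T" for t
  proof -
    have "0 < \<zeta> * N" using \<zeta> Npos by simp
    moreover have "\<zeta> * N \<le> real N - real t" using \<zeta>T that by linarith
    ultimately have "N / (real N - real t) \<le> N / (\<zeta> * N)" by (intro divide_left_mono) auto
    also have "\<dots> = 8 * \<eta> * y" unfolding \<zeta>_def using Npos by simp
    finally show "N / (real N - real t) \<le> 8 * \<eta> * y" .
    show "0 \<le> N / (real N - real t)" using that T by simp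
  qed
  have term1: "A0 * ((real t0 + 1) / (real t + 1)) powr b * (N / (real N - real t)) powr c \<le> y powr - 2"
    if t: "t0 \<le> t" "t \<le> T" for t
  \<comment> \<open>In the left half the expansion is at most \<open>2 powr c\<close> and
    \<open>A0\<close> alone is small enough. In the right half the expansion may reach
    \<open>(8 * \<eta> * y) powr c\<close>, but the damping is at most
    \<open>(4 * x0) powr b\<close>.\<close>
  proof (cases "2 * t \<le> N")
    case True
    have "((real t0 + 1) / (real t + 1)) powr b \<le> 1 powr b"
      using t b_nonneg by (intro powr_mono2) auto
    moreover have "(N / (real N - real t)) powr c \<le> 2 powr c"
    proof (rule powr_mono2[OF c_nonneg R(2)[OF t(2)]])
      have "2 * real t \<le> N" using True by linarith
      then show "N / (real N - real t) \<le> 2" using Npos by (simp add: field_simps)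
    qed
    moreover have "2 powr c \<le> y" unfolding powr_pow[symmetric, OF zero_less_numeral] using K by (intro K_pow(2)) auto
    ultimately have "A0 * ((real t0 + 1) / (real t + 1)) powr b * (N / (real N - real t)) powr c
        \<le> (y powr (1 - real c1) * 1) * y"
      using A0 by (intro mult_mono) auto
    also have "\<dots> = y powr (2 - real c1)" using powr_mult_base[of y "1 - real c1"] y1 by (simp add: mult.commute)
    also have "\<dots> \<le> y powr - 2" using c1 y1 by (intro powr_mono) auto
    finally show ?thesis .
  next
    case False
    then have t2: "N / 2 \<le> real t + 1" by linarith
    have r: "(real t0 + 1) / (real t + 1) \<le> 4 * x0"
    proof -
      have "(real t0 + 1) / (real t + 1) \<le> (2 * (N * x0)) / (N / 2)"
        using t0x t2 Npos x0 by (intro frac_le) auto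
      then show ?thesis using Npos by simp
    qed
    have "((real t0 + 1) / (real t + 1)) powr b \<le> (4 * x0) powr b"
      by (rule powr_mono2[OF b_nonneg _ r]) auto
    moreover have "(N / (real N - real t)) powr c \<le> (8 * \<eta> * y) powr c"
      using R[OF t(2)] by (intro powr_mono2 c_nonneg)
    moreover have "A0 \<le> 1"
    proof -
      have "y powr (1 - real c1) \<le> y powr 0" using y1 c1 by (intro powr_mono) auto
      then show ?thesis using A0 y1 by simp
    qed
    ultimately have "A0 * ((real t0 + 1) / (real t + 1)) powr b * (N / (real N - real t)) powr c
        \<le> (1 * (4 * x0) powr b) * (8 * \<eta> * y) powr c"
      using A0 by (intro mult_mono) auto
    also have "\<dots> = (4 powr b * (8 * \<eta>) powr c) * (x0 powr b * y powr c)"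
      using x0 \<eta> y1 by (simp add: powr_mult)
    also have "\<dots> \<le> y * y powr - 4"
    proof (intro mult_mono)
      have "b \<le> real (k - 1)"
      proof -
        have "\<alpha> / \<eta> / 2 \<le> 1" using \<alpha> by (simp add: field_simps)
        then have "real (k - 1) * (\<alpha> / \<eta> / 2) \<le> real (k - 1) * 1" by (intro mult_left_mono) auto
        then show ?thesis unfolding b_def by simp
      qed
      then have "4 powr b \<le> (4::real) powr real (k - 1)" by (intro powr_mono) auto
      also have "\<dots> = 4 ^ (k - 1)" by (simp add: powr_realpow)
      finally have "4 powr b * (8 * \<eta>) powr c \<le> 4 ^ (k - 1) * ((8 * \<eta>) powr C) ^ (k - 1)"
        using powr_pow[of "8 * \<eta>"] \<eta> by (simp add: mult_right_mono)
      also have "\<dots> = (4 * (8 * \<eta>) powr C) ^ (k - 1)" by (simp add: power_mult_distrib)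
      also have "\<dots> \<le> y" using K by (intro K_pow(2)) auto
      finally show "4 powr b * (8 * \<eta>) powr c \<le> y" .
      have "x0 powr b * y powr c = y powr (c - c1 * b)"
        unfolding x0' by (simp add: powr_powr powr_add[symmetric])
      also have "\<dots> \<le> y powr - 4"
      proof (rule powr_mono)
        have "real (k - 1) * (C + 4) \<le> real (k - 1) * (c1 * (\<alpha> / \<eta>) / 2)"
          using c1(2) by (intro mult_left_mono) auto
        also have "\<dots> = c1 * b" unfolding b_def by simp
        finally have "c + 4 * real (k - 1) \<le> c1 * b" unfolding cC by (simp add: algebra_simps)
        moreover have "1 \<le> real (k - 1)" using k by simp
        ultimately show "c - c1 * b \<le> - 4" by linarith
      qed (use y1 in auto)
      finally show "x0 powr b * y powr c \<le> y powr - 4" .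
    qed (use y1 in auto)
    also have "\<dots> = y powr - 3" using powr_mult_base[of y "-4"] y1 by simp
    also have "\<dots> \<le> y powr - 2" using y1 by (intro powr_mono) auto
    finally show ?thesis .
  qed
  have term2: "(real t - real t0) * \<kappa>' \<zeta> * (N / (real N - real t)) powr c \<le> y powr - 2"
    if t: "t0 \<le> t" "t \<le> T" for t
  proof -
    have "(real t - real t0) * \<kappa>' \<zeta> * (N / (real N - real t)) powr c
        \<le> N * \<kappa>' \<zeta> * (8 * \<eta> * y) powr c"
      using t T \<kappa>'_nonneg[OF \<zeta>] R[OF t(2)] by (intro mult_mono powr_mono2 c_nonneg) auto
    also have "N * \<kappa>' \<zeta> = ((6 + 2 * \<eta>) * 8 * \<eta>\<^sup>2 / \<alpha>\<^sup>2) * y * real (k - 1) * (1 / x0) * (1 / (N * Pm))"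
      unfolding \<kappa>'_def \<kappa>_def \<zeta>_def using Npos Pm_pos x0 \<alpha>
      by (simp add: power2_eq_square field_simps)
    \<comment> \<open>Five single powers of \<open>y\<close> arise: for the constant, the factor
      \<open>1 / \<zeta>\<close> apart from constants, \<open>k - 1\<close>, the factor
      \<open>(1 / \<alpha>) ^ k\<close> of \<open>1 / Pm\<close>, and
      \<open>(8 * \<eta>) powr c\<close>.\<close>
    also have "\<dots> * (8 * \<eta> * y) powr c \<le> (y * y * y * y powr c1 * y powr (1 + real c1 * real k - real c2 * real k)) * (y * y powr c)"
    proof (intro mult_mono Ry)
      show "(6 + 2 * \<eta>) * 8 * \<eta>\<^sup>2 / \<alpha>\<^sup>2 \<le> y" using K Ky by linarith
      show "real (k - 1) \<le> y" using ky k by simp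
      show "1 / x0 \<le> y powr c1" unfolding x0y using y1 by (simp add: powr_realpow)
      have "1 / (N * Pm) = (1 / N) * (1 / Pm)" by simp
      also have "\<dots> \<le> y powr - (c2 * k) * y powr (1 + c1 * k)"
        using N_inv Pm_inv Pm_pos by (intro mult_mono) auto
      also have "\<dots> = y powr (1 + real c1 * real k - real c2 * real k)" by (simp add: powr_add[symmetric])
      finally show "1 / (N * Pm) \<le> y powr (1 + real c1 * real k - real c2 * real k)" .
    qed (use y1 \<eta> x0 Pm_pos in auto)
    also have "\<dots> = y powr 1 * y powr 1 * y powr 1 * y powr 1 * (y powr c1 * y powr (1 + real c1 * real k - real c2 * real k) * y powr c)"
      using y1 by simp
    also have "\<dots> = y powr (5 + real c1 + real c1 * real k - real c2 * real k + c)" unfolding powr_add[symmetric] by (simp add: algebra_simps)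
    also have "\<dots> \<le> y powr - 2"
    proof (rule powr_mono)
      have "c \<le> C * k" unfolding cC using C0 k by (simp add: mult.commute mult_left_mono)
      moreover have "real c1 * 1 \<le> c1 * real k" using k2 by (intro mult_left_mono) auto
      moreover have "(2 * c1 + C + 7) * real k = 2 * (c1 * real k) + C * k + 7 * real k" by (simp add: algebra_simps)
      ultimately have "5 + c1 + c1 * real k + c + 2 \<le> c2 * real k" using ce(2) k2 by linarith
      then show "5 + real c1 + real c1 * real k - real c2 * real k + c \<le> - 2" by simp
    qed (use y1 in auto)
    finally show ?thesis .
  qed
  have B: "B t0 A0 \<zeta> t \<le> 2 * y powr - 2" if "t0 \<le> t" "t \<le> T" for t
    unfolding B_def using term1[OF that] term2[OF that] by linarith
  \<comment> \<open>Sixteen copies of the bound \<open>small2\<close> are available. At most ten are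
    used: eight for \<open>4 * B\<close> and two for the rounding term.\<close>
  have a\<zeta>: "\<alpha> * \<zeta> / 2 = 16 * (\<alpha> / (256 * \<eta>) * (1 / y))" unfolding \<zeta>_def by simp
  have Bs: "4 * B t0 A0 \<zeta> t + 2 / (N * Pm) \<le> \<alpha> * \<zeta> / 2" if "t0 \<le> t" "t \<le> T" for t
  proof -
    have "y powr - 3 \<le> y powr - 2" using y1 by (intro powr_mono) auto
    then have "2 / (N * Pm) \<le> 2 * y powr - 2" using NPm by simp
    then show ?thesis unfolding a\<zeta> using B[OF that] small2 powr_ge_zero[of y "- 2"] by linarith
  qed
  have a\<zeta>': "\<alpha> * \<zeta> / 2 \<le> 1 / (4 * y)"
  proof -
    have "\<alpha> * (1 / (8 * \<eta> * y)) / 2 = (\<alpha> / \<eta>) * (1 / (16 * y))" by simp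
    also have "\<dots> \<le> 1 * (1 / (4 * y))" using \<alpha> y1 by (intro mult_mono) (auto simp: field_simps)
    finally show ?thesis unfolding \<zeta>_def by simp
  qed
  have Bp: "B t0 A0 \<zeta> t \<le> 1 / 8" if "t0 \<le> t" "t \<le> T" for t
  proof -
    have "1 / (4 * y) \<le> 1 / 4" using y1 by simp
    moreover have "0 \<le> 2 / (N * Pm)" using Pm_pos by simp
    ultimately show ?thesis using Bs[OF that] a\<zeta>' by linarith
  qed
  have err: "\<bar>G i t - F i t\<bar> \<le> 1 / (4 * y)" if t: "t0 \<le> t" "t \<le> T" for t
  proof -
    have R: "\<bar>h j t / H j t - 1\<bar> \<le> B t0 A0 \<zeta> t" if "j \<in> {1..k}" for j
      using relative_error[OF t0 A0(1) init \<zeta> \<zeta>T Bp Bs t] that by blast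
    have B0: "0 \<le> B t0 A0 \<zeta> t" using R[OF i] by linarith
    have tx: "x0 \<le> t / N" using t0 t Npos by (meson divide_right_mono of_nat_0_le_iff of_nat_mono order_trans)
    have tN: "t < N" using t T by simp
    have "\<bar>G i t - F i t\<bar> \<le> F i t * (4 * B t0 A0 \<zeta> t + 2 / (N * Pm))"
      by (rule G_error[OF i tN tx B0 Bp[OF t] R])
    also have "\<dots> \<le> 4 * B t0 A0 \<zeta> t + 2 / (N * Pm)"
      using F_01[OF i, of t] tN B0 Pm_pos by (intro mult_left_le_one_le) auto
    finally show ?thesis using Bs[OF t] a\<zeta>' by linarith
  qed
  have FT: "1 - 1 / (4 * y) \<le> F i T"
  proof -
    have "1 - F i T \<le> \<eta> * (N - T) / N" using F_bounds(4)[OF i, of T] T by simp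
    also have "\<dots> \<le> \<eta> * Z / N"
      using u T \<eta> Npos by (intro divide_right_mono mult_left_mono) (auto simp: of_nat_diff)
    also have "\<dots> = 1 / (4 * y)" unfolding Z_def using Npos \<eta> by simp
    finally show ?thesis by simp
  qed
  have \<eta>x0: "\<eta> * x0 \<le> 1 / (4 * y)"
  proof -
    have "x0 = y powr - real c1" by (rule x0')
    also have "\<dots> \<le> y powr - 2" using c1 y1 by (intro powr_mono) auto
    also have "\<dots> \<le> \<alpha> / (256 * \<eta>) * (1 / y)" by (rule small2)
    finally have "\<eta> * x0 \<le> \<eta> * (\<alpha> / (256 * \<eta>) * (1 / y))" using \<eta> by (intro mult_left_mono) auto
    also have "\<dots> = \<alpha> / 64 * (1 / (4 * y))" using \<eta> by simp
    also have "\<dots> \<le> 1 * (1 / (4 * y))" using \<alpha> y1 by (intro mult_right_mono) auto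
    finally show ?thesis by simp
  qed
  have "\<bar>mono_est x0 N k q (Suc l) i - F i l\<bar> \<le> 2 * (1 / (4 * y))"
    by (rule mono_est_error[OF i T(2) FT _ before \<eta>x0 err l]) (use y1 in auto)
  then show "\<bar>mono_est x0 N k q (Suc l) i - F i l\<bar> \<le> 1 / (2 * y)" by simp
  have "\<eta> * (2 * y) \<le> y * (4 * \<eta> * y)" using y1 \<eta> by (simp add: mult_le_cancel_left1)
  then have "\<eta> * (2 * y) \<le> N" using y2N by linarith
  then show "\<eta> / N \<le> 1 / (2 * y)" using Npos y1 by (simp add: field_simps)
qed

end

section \<open>The probabilistic model\<close>

text \<open>The coordinates of the product space are independent with law \<open>M\<close>;
  composing them with the indicator of \<open>C\<close> gives i.i.d. variables in
  \<open>[0, 1]\<close> with mean \<open>prob C\<close>, to which Hoeffding's inequality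
  applies.\<close>

lemma (in prob_space) Hoeffding_frequency:
  fixes n :: nat and \<epsilon> :: real
  assumes C: "C \<in> sets M" and n: "n > 0" and "\<epsilon> \<ge> 0"
  shows "measure (PiM {..<n} (\<lambda>_. M))
     {s \<in> space (PiM {..<n} (\<lambda>_. M)). \<bar>real (card {j. j < n \<and> s j \<in> C}) / n - prob C\<bar> \<ge> \<epsilon>}
     \<le> 2 * exp (- 2 * real n * \<epsilon>\<^sup>2)"
proof -
  let ?P = "PiM {..<n} (\<lambda>_. M)"
  let ?X = "\<lambda>j s. indicator C (s j) :: real"
  have ind: "(indicator C :: 'a \<Rightarrow> real) \<in> borel_measurable M"
    using C by (rule borel_measurable_indicator)
  interpret P: product_prob_space "\<lambda>_. M" "{..<n}" by unfold_locales
  have rv: "(\<lambda>s. s j) \<in> measurable ?P M" if "j \<in> {..<n}" for j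
    using that by (rule measurable_component_singleton)
  have "P.indep_vars (\<lambda>_. M) (\<lambda>j s. s j) {..<n}"
  proof (subst P.indep_vars_iff_distr_eq_PiM')
    show "{..<n} \<noteq> {}" using n by auto
    have "distr ?P ?P (\<lambda>s. \<lambda>j\<in>{..<n}. s j) = distr ?P ?P (\<lambda>s. s)"
      by (rule distr_cong) (auto simp: space_PiM PiE_def extensional_restrict)
    also have "\<dots> = ?P" by (rule distr_id)
    also have "\<dots> = PiM {..<n} (\<lambda>j. distr ?P M (\<lambda>s. s j))"
      by (intro PiM_cong refl distr_PiM_component[symmetric]) (auto intro: prob_space_axioms)
    finally show "distr ?P ?P (\<lambda>s. \<lambda>j\<in>{..<n}. s j) = PiM {..<n} (\<lambda>j. distr ?P M (\<lambda>s. s j))" .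
  qed (rule rv)
  then have indep: "P.indep_vars (\<lambda>_. borel) ?X {..<n}"
    by (rule P.indep_vars_compose2) (rule ind)
  let ?Y = "\<lambda>s. indicator C (s 0) :: real"
  have D: "distr ?P borel (?X j) = distr M borel (indicator C)" if "j < n" for j
  proof -
    have "distr ?P borel (?X j) = distr (distr ?P M (\<lambda>s. s j)) borel (indicator C)"
      using distr_distr[OF ind rv[of j]] that by (simp add: comp_def)
    also have "distr ?P M (\<lambda>s. s j) = M"
      using that by (intro distr_PiM_component) (auto intro: prob_space_axioms)
    finally show ?thesis .
  qed
  have rvX: "?X j \<in> borel_measurable ?P" if "j < n" for j
    using measurable_compose[OF rv[of j] ind] that by simp
  have "P.expectation ?Y = integral\<^sup>L (distr ?P M (\<lambda>s. s 0)) (indicator C)"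
    using integral_distr[OF rv[of 0] ind] n by simp
  also have "distr ?P M (\<lambda>s. s 0) = M"
    using n by (intro distr_PiM_component) (auto intro: prob_space_axioms)
  finally have E: "P.expectation ?Y = prob C" using C by simp
  have cnt: "(\<Sum>j<n. ?X j s) = real (card {j. j < n \<and> s j \<in> C})" for s
  proof -
    have "(\<Sum>j<n. ?X j s) = real (card ({..<n} \<inter> {j. s j \<in> C}))"
      by (subst sum_indicator_eq_card[symmetric]) (auto simp: indicator_def intro!: sum.cong)
    also have "{..<n} \<inter> {j. s j \<in> C} = {j. j < n \<and> s j \<in> C}" by auto
    finally show ?thesis .
  qed
  interpret Hoeffding_ineq_iid ?P "{..<n}" ?X ?Y 0 1 "P.expectation ?Y"
  proof unfold_locales
    show "distr ?P borel (?X j) = distr ?P borel ?Y" if "j \<in> {..<n}" for j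
      using D[of j] D[of 0] that n by simp
    show "?Y \<in> borel_measurable ?P" using rvX[OF n] .
  qed (use indep in \<open>auto simp: indicator_def\<close>)
  have ne: "{..<n} \<noteq> {}" using n by blast
  note bound = Hoeffding_ineq_abs_ge'[OF assms(3) zero_less_one ne, unfolded E cnt card_lessThan]
  then show ?thesis by (simp only: diff_zero power_one div_by_1)
qed

section \<open>A single bid distribution\<close>

context
  fixes \<alpha> \<eta> :: real and f :: "real \<Rightarrow> real"
  assumes \<alpha>: "0 < \<alpha>" and f: "bounded_density \<alpha> \<eta> f"
begin

lemma density_measurable: "(\<lambda>x. ennreal (indicator {0..1} x * f x)) \<in> borel_measurable lborel"
proof -
  have [measurable]: "(\<lambda>x. indicator {0..1} x * f x) \<in> borel_measurable borel"
    using f unfolding bounded_density_def set_borel_measurable_def by simp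
  show ?thesis by measurable
qed

lemma sets_bid_law: "sets (bid_law f) = sets borel" "space (bid_law f) = UNIV"
  unfolding bid_law_def by simp_all

lemma prob_space_bid_law: "prob_space (bid_law f)"
proof
  let ?g = "\<lambda>x. indicator {0..1} x * f x"
  have g0: "0 \<le> ?g x" for x
    using f \<alpha> unfolding bounded_density_def by (auto simp: indicator_def intro: order_trans[of 0 \<alpha>])
  have int1: "integral\<^sup>L lborel ?g = 1"
    using f unfolding bounded_density_def set_lebesgue_integral_def by simp
  \<comment> \<open>The Bochner integral of a function that is not integrable is 0 by convention, so
    the value 1 implies integrability.\<close>
  then have int: "integrable lborel ?g" using not_integrable_integral_eq by fastforce
  have "emeasure (bid_law f) (space (bid_law f)) = (\<integral>\<^sup>+x. ennreal (?g x) \<partial>lborel)"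
    unfolding bid_law_def using density_measurable by (simp add: emeasure_density)
  also have "\<dots> = ennreal (integral\<^sup>L lborel ?g)"
    by (rule nn_integral_eq_integral[OF int]) (use g0 in auto)
  finally show "emeasure (bid_law f) (space (bid_law f)) = 1" using int1 by simp
qed

lemma bid_law_unit: "measure (bid_law f) {0..1} = 1"
proof -
  interpret prob_space "bid_law f" by (rule prob_space_bid_law)
  have "emeasure (bid_law f) (- {0..1}) =
      (\<integral>\<^sup>+x. ennreal (indicator {0..1} x * f x) * indicator (- {0..1}) x \<partial>lborel)"
    unfolding bid_law_def using density_measurable by (subst emeasure_density) auto
  also have "\<dots> = (\<integral>\<^sup>+(x::real). 0 \<partial>lborel)"
    by (intro nn_integral_cong) (auto simp: indicator_def)
  finally have "emeasure (bid_law f) (- {0..1}) = 0" by simp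
  then have "measure (bid_law f) (- {0..1}) = 0" by (simp add: measure_def)
  then show ?thesis using prob_compl[of "{0..1}"] by (simp add: sets_bid_law Compl_eq_Diff_UNIV)
qed

lemma bid_law_Ioc:
  assumes "0 \<le> a" "a \<le> b" "b \<le> 1"
  shows "\<alpha> * (b - a) \<le> measure (bid_law f) {a<..b}" "measure (bid_law f) {a<..b} \<le> \<eta> * (b - a)"
proof -
  interpret prob_space "bid_law f" by (rule prob_space_bid_law)
  have f': "\<alpha> \<le> f x" "f x \<le> \<eta>" if "x \<in> {a<..b}" for x
    using f that assms unfolding bounded_density_def by auto
  have \<eta>: "0 \<le> \<eta>" using f \<alpha> unfolding bounded_density_def by force
  have e: "emeasure (bid_law f) {a<..b} = (\<integral>\<^sup>+x. ennreal (indicator {0..1} x * f x) * indicator {a<..b} x \<partial>lborel)"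
    unfolding bid_law_def using density_measurable by (subst emeasure_density) auto
  have "ennreal (\<alpha> * (b - a)) = (\<integral>\<^sup>+x. ennreal \<alpha> * indicator {a<..b} x \<partial>lborel)"
    using assms \<alpha> by (simp add: nn_integral_cmult ennreal_mult'')
  also have "\<dots> \<le> emeasure (bid_law f) {a<..b}"
    unfolding e using f' assms by (intro nn_integral_mono) (auto simp: indicator_def intro!: ennreal_leI)
  finally show "\<alpha> * (b - a) \<le> measure (bid_law f) {a<..b}"
    by (simp add: emeasure_eq_measure)
  have "emeasure (bid_law f) {a<..b} \<le> (\<integral>\<^sup>+x. ennreal \<eta> * indicator {a<..b} x \<partial>lborel)"
    unfolding e using f' assms by (intro nn_integral_mono) (auto simp: indicator_def intro: ennreal_leI)
  also have "\<dots> = ennreal (\<eta> * (b - a))"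
    using assms \<eta> by (simp add: nn_integral_cmult ennreal_mult'')
  finally show "measure (bid_law f) {a<..b} \<le> \<eta> * (b - a)"
    using assms \<eta> by (simp add: emeasure_eq_measure)
qed

lemma cdf_bid_law:
  shows "cdf (bid_law f) 0 = 0" "cdf (bid_law f) 1 = 1"
    "0 \<le> a \<Longrightarrow> a \<le> b \<Longrightarrow> b \<le> 1 \<Longrightarrow> \<alpha> * (b - a) \<le> cdf (bid_law f) b - cdf (bid_law f) a"
    "0 \<le> a \<Longrightarrow> a \<le> b \<Longrightarrow> b \<le> 1 \<Longrightarrow> cdf (bid_law f) b - cdf (bid_law f) a \<le> \<eta> * (b - a)"
    "a \<le> b \<Longrightarrow> cdf (bid_law f) a \<le> cdf (bid_law f) b"
proof -
  interpret prob_space "bid_law f" by (rule prob_space_bid_law)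
  interpret finite_borel_measure "bid_law f" by unfold_locales (simp_all add: sets_bid_law)
  show "cdf (bid_law f) 0 = 0"
  proof -
    have "emeasure (bid_law f) {..0} = (\<integral>\<^sup>+x. ennreal (indicator {0..1} x * f x) * indicator {..0} x \<partial>lborel)"
      unfolding bid_law_def using density_measurable by (subst emeasure_density) auto
    also have "\<dots> = (\<integral>\<^sup>+(x::real). ennreal (f 0) * indicator {0} x \<partial>lborel)"
      by (intro nn_integral_cong) (auto simp: indicator_def)
    also have "\<dots> = 0" by (subst nn_integral_cmult_indicator) auto
    finally show ?thesis by (simp add: cdf_def measure_def)
  qed
  show "cdf (bid_law f) 1 = 1"
  proof -
    have "prob {0..1} \<le> prob {..1}" by (intro finite_measure_mono) (auto simp: sets_bid_law)
    then show ?thesis using bid_law_unit prob_le_1[of "{..1}"] by (simp add: cdf_def)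
  qed
  show "0 \<le> a \<Longrightarrow> a \<le> b \<Longrightarrow> b \<le> 1 \<Longrightarrow> \<alpha> * (b - a) \<le> cdf (bid_law f) b - cdf (bid_law f) a"
    using bid_law_Ioc(1)[of a b] cdf_diff_eq[of a b] by (cases "a = b") auto
  show "0 \<le> a \<Longrightarrow> a \<le> b \<Longrightarrow> b \<le> 1 \<Longrightarrow> cdf (bid_law f) b - cdf (bid_law f) a \<le> \<eta> * (b - a)"
    using bid_law_Ioc(2)[of a b] cdf_diff_eq[of a b] by (cases "a = b") auto
  show "a \<le> b \<Longrightarrow> cdf (bid_law f) a \<le> cdf (bid_law f) b" by (rule cdf_nondecreasing)
qed

lemma bounded_density_constants: "\<alpha> \<le> 1" "1 \<le> \<eta>"
  using cdf_bid_law(3,4)[of 0 1] cdf_bid_law(1,2) by auto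

end

section \<open>Winner, price and the law of one observation\<close>

lemma finite_prod_split_off:
  fixes i k :: nat
  assumes "i \<in> {1..k}"
  shows "(\<Prod>j=1..k. if j = i then a else g j) = a * (\<Prod>j\<in>{1..k} - {i}. (g j :: real))"
proof -
  have "(\<Prod>j\<in>{1..k} - {i}. if j = i then a else g j) = (\<Prod>j\<in>{1..k} - {i}. g j)"
    by (rule prod.cong) auto
  then show ?thesis using assms by (subst prod.remove[of _ i]) auto
qed

lemma winner_props:
  assumes "1 \<le> k"
  shows "winner k X \<in> {1..k}" "X (winner k X) = Max (X ` {1..k})"
proof -
  have "Max (X ` {1..k}) \<in> X ` {1..k}" using assms by (intro Max_in) auto
  then have "\<exists>i. i \<in> {1..k} \<and> X i = Max (X ` {1..k})" by auto
  from LeastI_ex[OF this] show "winner k X \<in> {1..k}" "X (winner k X) = Max (X ` {1..k})"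
    unfolding winner_def by auto
qed

lemma le_winner: "1 \<le> k \<Longrightarrow> j \<in> {1..k} \<Longrightarrow> X j \<le> X (winner k X)"
  using winner_props(2)[of k X] by simp

lemma other_bidders_nonempty: "2 \<le> k \<Longrightarrow> {1..k} - {i} \<noteq> {}" for i k :: nat
  by (rule ccontr) (use card_mono[of "{i}" "{1..k}"] in auto)

lemma price_less_iff:
  fixes i k :: nat
  assumes "2 \<le> k"
  shows "x < Max (X ` ({1..k} - {i})) \<longleftrightarrow> (\<exists>j\<in>{1..k} - {i}. x < X j)"
    "Max (X ` ({1..k} - {i})) \<le> (y :: real) \<longleftrightarrow> (\<forall>j\<in>{1..k} - {i}. X j \<le> y)"
  using other_bidders_nonempty[OF assms, of i] by (auto simp: Max_gr_iff)

text \<open>The event that \<open>i\<close> wins at a price in \<open>(x, y]\<close> is sandwiched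
  between two events that constrain bidder \<open>i\<close> and the other bidders separately: bidder
  \<open>i\<close> above \<open>y\<close>, or only above \<open>x\<close>. This replaces
  conditioning on the price and avoids any discussion of ties; the gap is of second order in the
  cell width.\<close>

lemma second_price_cell:
  assumes k: "2 \<le> k" and i: "i \<in> {1..k}"
  shows "y < X i \<Longrightarrow> (\<forall>j\<in>{1..k} - {i}. X j \<le> y) \<Longrightarrow> (\<exists>j\<in>{1..k} - {i}. x < X j)
      \<Longrightarrow> second_price_obs k X \<in> {x<..y} \<times> {i}"
    and "second_price_obs k X \<in> {x<..y} \<times> {i}
      \<Longrightarrow> x < X i \<and> (\<forall>j\<in>{1..k} - {i}. X j \<le> y) \<and> (\<exists>j\<in>{1..k} - {i}. x < X j)"
proof -
  have k1: "1 \<le> k" using k by simp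
  assume *: "y < X i" "\<forall>j\<in>{1..k} - {i}. X j \<le> y" "\<exists>j\<in>{1..k} - {i}. x < X j"
  have "X i \<le> X (winner k X)" using le_winner k1 i by blast
  then have "winner k X = i" using winner_props(1)[OF k1, of X] * by force
  then show "second_price_obs k X \<in> {x<..y} \<times> {i}"
    using * by (simp add: second_price_obs_def price_less_iff[OF k, unfolded One_nat_def])
next
  have k1: "1 \<le> k" using k by simp
  assume "second_price_obs k X \<in> {x<..y} \<times> {i}"
  then have w: "winner k X = i" and ex: "\<exists>j\<in>{1..k} - {i}. x < X j" and al: "\<forall>j\<in>{1..k} - {i}. X j \<le> y"
    by (auto simp: second_price_obs_def price_less_iff[OF k, unfolded One_nat_def])
  from ex obtain j where "j \<in> {1..k} - {i}" "x < X j" by blast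
  with le_winner[OF k1, of j X] w have "x < X i" by auto
  with ex al show "x < X i \<and> (\<forall>j\<in>{1..k} - {i}. X j \<le> y) \<and> (\<exists>j\<in>{1..k} - {i}. x < X j)" by blast
qed

lemma measurable_second_price_obs:
  fixes k :: nat
  assumes "\<And>i. i \<in> {1..k} \<Longrightarrow> sets (M i) = sets borel"
  shows "second_price_obs k \<in> measurable (PiM {1..k} M) (borel \<Otimes>\<^sub>M count_space UNIV)"
proof -
  have comp: "(\<lambda>X. X i) \<in> borel_measurable (PiM {1..k} M)" if "i \<in> {1..k}" for i
    using measurable_component_singleton[OF that, of M] measurable_cong_sets[OF refl assms[OF that]] by blast
  have mx: "(\<lambda>X. Max (X ` J)) \<in> borel_measurable (PiM {1..k} M)" if "J \<subseteq> {1..k}" for J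
  proof (rule borel_measurable_Max)
    show "finite J" using that by (rule finite_subset) simp
    show "(\<lambda>X. X i) \<in> borel_measurable (PiM {1..k} M)" if "i \<in> J" for i
      using comp that \<open>J \<subseteq> {1..k}\<close> by blast
  qed
  have w: "winner k \<in> measurable (PiM {1..k} M) (count_space UNIV)"
  proof -
    have P: "(\<lambda>X. i \<in> {1..k} \<and> X i = Max (X ` {1..k})) \<in> measurable (PiM {1..k} M) (count_space UNIV)" for i
    proof (cases "i \<in> {1..k}")
      case True
      have "Measurable.pred (PiM {1..k} M) (\<lambda>X. X i = Max (X ` {1..k}))"
        by (rule iffD2[OF pred_def borel_measurable_eq[OF comp[OF True] mx[OF subset_refl]]])
      moreover have "(\<lambda>X. X i = Max (X ` {1..k})) = (\<lambda>X. i \<in> {1..k} \<and> X i = Max (X ` {1..k}))"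
        using True by (intro ext) blast
      ultimately show ?thesis by (rule back_subst[where P = "Measurable.pred (PiM {1..k} M)"])
    next
      case False
      then have eq: "(\<lambda>_. False) = (\<lambda>X. i \<in> {1..k} \<and> X i = Max (X ` {1..k}))" by blast
      have "Measurable.pred (PiM {1..k} M) (\<lambda>_. False)" by (rule measurable_const) simp
      then show ?thesis
        using eq by (rule back_subst[where P = "Measurable.pred (PiM {1..k} M)"])
    qed
    show ?thesis unfolding winner_def[abs_def] by (rule measurable_Least[OF P])
  qed
  have "(\<lambda>X. Max (X ` ({1..k} - {winner k X}))) \<in> borel_measurable (PiM {1..k} M)"
    \<comment> \<open>The set over which the maximum is taken varies with the bids only through the
      winner, which has countably many values.\<close>
    by (rule measurable_compose_countable[OF _ w]) (rule mx, auto)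
  with w show ?thesis unfolding second_price_obs_def[abs_def] by (intro measurable_Pair)
qed

locale second_price =
  fixes k :: nat and \<alpha> \<eta> :: real and f :: "nat \<Rightarrow> real \<Rightarrow> real"
  assumes k: "2 \<le> k" and \<alpha>: "0 < \<alpha>" and f: "\<And>i. i \<in> {1..k} \<Longrightarrow> bounded_density \<alpha> \<eta> (f i)"
begin

abbreviation F :: "nat \<Rightarrow> real \<Rightarrow> real" where "F i \<equiv> cdf (bid_law (f i))"

abbreviation "bids \<equiv> PiM {1..k} (\<lambda>i. bid_law (f i))"

abbreviation "model \<equiv> second_price_model k f"

lemma measure_box:
  assumes A: "\<And>i. i \<in> {1..k} \<Longrightarrow> A i \<in> sets borel"
  shows "measure bids (PiE {1..k} A) = (\<Prod>i=1..k. measure (bid_law (f i)) (A i))"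
    "PiE {1..k} A \<in> sets bids" "prob_space bids"
proof -
  \<comment> \<open>Product probability spaces require a probability measure at every index, while
    \<open>f\<close> is constrained only on \<open>{1..k}\<close>; all other indices receive the law
    of bidder 1.\<close>
  define M where "M = (\<lambda>i. bid_law (f (if i \<in> {1..k} then i else 1)))"
  have M: "prob_space (M i)" "sets (M i) = sets borel" for i
    unfolding M_def using prob_space_bid_law[OF \<alpha> f] sets_bid_law[OF \<alpha> f] k by auto
  have eq: "bids = PiM {1..k} M" by (rule PiM_cong) (auto simp: M_def)
  interpret finite_product_prob_space M "{1..k}"
    by (intro finite_product_prob_space.intro finite_product_sigma_finite.intro product_sigma_finite.intro
       product_prob_space.intro product_prob_space_axioms.intro finite_product_sigma_finite_axioms.intro M
       prob_space_imp_sigma_finite) auto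
  show "prob_space bids" unfolding eq by (rule prob_space_axioms)
  have AM: "A i \<in> sets (M i)" if "i \<in> {1..k}" for i using A[OF that] M(2) by (simp only:)
  have "measure (PiM {1..k} M) (PiE {1..k} A) = (\<Prod>i=1..k. measure (M i) (A i))"
    using AM by (rule prob_times)
  also have "\<dots> = (\<Prod>i=1..k. measure (bid_law (f i)) (A i))"
    by (intro prod.cong refl) (simp add: M_def)
  finally show "measure bids (PiE {1..k} A) = (\<Prod>i=1..k. measure (bid_law (f i)) (A i))"
    unfolding eq .
  show "PiE {1..k} A \<in> sets bids" unfolding eq by (rule sets_PiM_I_finite[OF finite_atLeastAtMost AM])
qed

lemma prob_space_bids: "prob_space bids"
  by (rule measure_box(3)[where A = "\<lambda>_. {}"]) simp

lemma measurable_obs: "second_price_obs k \<in> measurable bids (borel \<Otimes>\<^sub>M count_space UNIV)"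
  by (rule measurable_second_price_obs, rule sets_bid_law(1)[OF \<alpha> f])

lemma prob_space_model: "prob_space model"
  unfolding second_price_model_def
  by (rule prob_space.prob_space_distr[OF prob_space_bids measurable_obs])

lemma sets_model: "sets model = sets (borel \<Otimes>\<^sub>M count_space UNIV)" "space model = UNIV"
  unfolding second_price_model_def by (simp_all add: space_pair_measure)

lemma measure_model:
  assumes "C \<in> sets (borel \<Otimes>\<^sub>M count_space UNIV)"
  shows "measure model C = measure bids (second_price_obs k -` C \<inter> space bids)"
  unfolding second_price_model_def using measurable_obs assms by (rule measure_distr)

lemma cell_in_sets: "{x<..y::real} \<times> {i::nat} \<in> sets (borel \<Otimes>\<^sub>M count_space UNIV)"
  by (intro pair_measureI) auto

lemma space_bids: "space bids = PiE {1..k} (\<lambda>_. UNIV)"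
  unfolding space_PiM using sets_bid_law[OF \<alpha> f] by (auto intro!: PiE_cong)

text \<open>For fixed \<open>a\<close>, the difference of the boxes with \<open>c = y\<close> and
  \<open>c = x\<close> says that bidder \<open>i\<close> is above \<open>a\<close> and the highest
  other bid lies in \<open>(x, y]\<close>.\<close>

definition box :: "nat \<Rightarrow> real \<Rightarrow> real \<Rightarrow> (nat \<Rightarrow> real) set" where
  "box i a c = PiE {1..k} (\<lambda>j. if j = i then {a<..} else {..c})"

lemma measure_box_cell:
  assumes i: "i \<in> {1..k}" and "x \<le> y"
  shows "measure bids (box i a y - box i a x) =
      (1 - F i a) * ((\<Prod>j\<in>{1..k}-{i}. F j y) - (\<Prod>j\<in>{1..k}-{i}. F j x))"
    "box i a y - box i a x \<in> sets bids"
proof -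
  interpret prob_space bids by (rule prob_space_bids)
  interpret Bi: prob_space "bid_law (f i)" using prob_space_bid_law[OF \<alpha> f[OF i]] .
  have Fi: "measure (bid_law (f i)) {a<..} = 1 - F i a"
  proof -
    have "{a<..} = space (bid_law (f i)) - {..a}" using sets_bid_law[OF \<alpha> f[OF i]] by auto
    then show ?thesis using Bi.prob_compl[of "{..a}"] sets_bid_law[OF \<alpha> f[OF i]] by (simp add: cdf_def)
  qed
  have m: "measure bids (box i a c) = (1 - F i a) * (\<Prod>j\<in>{1..k}-{i}. F j c)" for c
  proof -
    have "measure bids (box i a c) = (\<Prod>j=1..k. measure (bid_law (f j)) (if j = i then {a<..} else {..c}))"
      unfolding box_def by (rule measure_box) auto
    also have "\<dots> = (\<Prod>j=1..k. if j = i then 1 - F i a else F j c)"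
      using Fi by (intro prod.cong) (auto simp: cdf_def)
    also have "\<dots> = (1 - F i a) * (\<Prod>j\<in>{1..k}-{i}. F j c)" by (rule finite_prod_split_off[OF i])
    finally show ?thesis .
  qed
  have s: "box i a c \<in> sets bids" for c unfolding box_def by (rule measure_box) auto
  then show "box i a y - box i a x \<in> sets bids" by auto
  have "box i a x \<subseteq> box i a y" unfolding box_def using assms(2) by (intro PiE_mono) auto
  then have "measure bids (box i a y - box i a x) = measure bids (box i a y) - measure bids (box i a x)"
    using s by (intro finite_measure_Diff) auto
  then show "measure bids (box i a y - box i a x) =
      (1 - F i a) * ((\<Prod>j\<in>{1..k}-{i}. F j y) - (\<Prod>j\<in>{1..k}-{i}. F j x))"
    unfolding m by (simp add: right_diff_distrib)
qed

lemma model_cell_bounds: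
  assumes i: "i \<in> {1..k}" and xy: "x \<le> y"
  shows "(1 - F i y) * ((\<Prod>j\<in>{1..k}-{i}. F j y) - (\<Prod>j\<in>{1..k}-{i}. F j x)) \<le> measure model ({x<..y} \<times> {i})"
    "measure model ({x<..y} \<times> {i}) \<le> (1 - F i x) * ((\<Prod>j\<in>{1..k}-{i}. F j y) - (\<Prod>j\<in>{1..k}-{i}. F j x))"
proof -
  interpret prob_space bids by (rule prob_space_bids)
  let ?E = "second_price_obs k -` ({x<..y} \<times> {i}) \<inter> space bids"
  have E: "?E \<in> sets bids" using measurable_obs cell_in_sets by (rule measurable_sets)
  have box_iff: "X \<in> box i a c \<longleftrightarrow> X \<in> space bids \<and> a < X i \<and> (\<forall>j\<in>{1..k} - {i}. X j \<le> c)" for X a c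
  proof -
    have "X \<in> box i a c \<longleftrightarrow> X \<in> extensional {1..k} \<and> (\<forall>j\<in>{1..k}. X j \<in> (if j = i then {a<..} else {..c}))"
      unfolding box_def PiE_iff by blast
    also have "(\<forall>j\<in>{1..k}. X j \<in> (if j = i then {a<..} else {..c})) \<longleftrightarrow>
        a < X i \<and> (\<forall>j\<in>{1..k} - {i}. X j \<le> c)"
      using i by (metis DiffD1 DiffD2 DiffI atMost_iff greaterThan_iff singletonD singletonI)
    finally show ?thesis unfolding space_bids PiE_iff by blast
  qed
  have mem: "X \<in> box i a y - box i a x \<longleftrightarrow>
      X \<in> space bids \<and> a < X i \<and> (\<forall>j\<in>{1..k} - {i}. X j \<le> y) \<and> (\<exists>j\<in>{1..k} - {i}. x < X j)" for X a
    unfolding Diff_iff box_iff not_le[symmetric] by blast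
  have sub1: "box i y y - box i y x \<subseteq> ?E"
  proof
    fix X assume "X \<in> box i y y - box i y x"
    then have "X \<in> space bids" "y < X i" "\<forall>j\<in>{1..k} - {i}. X j \<le> y" "\<exists>j\<in>{1..k} - {i}. x < X j"
      unfolding mem by blast+
    then show "X \<in> ?E" using second_price_cell(1)[OF k i] by blast
  qed
  have sub2: "?E \<subseteq> box i x y - box i x x"
  proof
    fix X assume "X \<in> ?E"
    then have s: "X \<in> space bids" and o: "second_price_obs k X \<in> {x<..y} \<times> {i}"
      by (simp_all only: Int_iff vimage_eq)
    show "X \<in> box i x y - box i x x"
      unfolding mem by (rule conjI[OF s second_price_cell(2)[OF k i o]])
  qed
  have "measure bids (box i y y - box i y x) \<le> measure bids ?E"
    using sub1 E by (rule finite_measure_mono)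
  then show "(1 - F i y) * ((\<Prod>j\<in>{1..k}-{i}. F j y) - (\<Prod>j\<in>{1..k}-{i}. F j x)) \<le> measure model ({x<..y} \<times> {i})"
    unfolding measure_model[OF cell_in_sets] measure_box_cell(1)[OF i xy] .
  have "measure bids ?E \<le> measure bids (box i x y - box i x x)"
    using sub2 measure_box_cell(2)[OF i xy] by (rule finite_measure_mono)
  then show "measure model ({x<..y} \<times> {i}) \<le> (1 - F i x) * ((\<Prod>j\<in>{1..k}-{i}. F j y) - (\<Prod>j\<in>{1..k}-{i}. F j x))"
    unfolding measure_model[OF cell_in_sets] measure_box_cell(1)[OF i xy] .
qed

lemma range_in_sets: "{0..1::real} \<times> {1..k} \<in> sets (borel \<Otimes>\<^sub>M count_space UNIV)"
  by (intro pair_measureI) auto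

lemma model_range: "measure model ({0..1} \<times> {1..k}) = 1"
proof -
  interpret prob_space bids by (rule prob_space_bids)
  let ?E = "second_price_obs k -` ({0..1} \<times> {1..k}) \<inter> space bids"
  have E: "?E \<in> sets bids" using measurable_obs range_in_sets by (rule measurable_sets)
  have "measure bids (PiE {1..k} (\<lambda>_. {0..1})) = (\<Prod>i=1..k. measure (bid_law (f i)) {0..1})"
    by (rule measure_box) auto
  also have "\<dots> = 1" using bid_law_unit[OF \<alpha> f] by (intro prod.neutral) auto
  finally have 1: "measure bids (PiE {1..k} (\<lambda>_. {0..1})) = 1" .
  have "PiE {1..k} (\<lambda>_. {0..1}) \<subseteq> ?E"
  proof
    fix X :: "nat \<Rightarrow> real" assume X: "X \<in> PiE {1..k} (\<lambda>_. {0..1})"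
    have "Max (X ` ({1..k} - {winner k X})) \<in> X ` ({1..k} - {winner k X})"
      using other_bidders_nonempty[OF k] by (intro Max_in) auto
    then have "Max (X ` ({1..k} - {winner k X})) \<in> {0..1}" using X by (auto simp: PiE_iff)
    moreover have "winner k X \<in> {1..k}" using k by (intro winner_props(1)) simp
    ultimately have "second_price_obs k X \<in> {0..1} \<times> {1..k}"
      unfolding second_price_obs_def by (rule SigmaI)
    moreover have "X \<in> space bids" unfolding space_bids using X by (simp add: PiE_iff)
    ultimately show "X \<in> ?E" by blast
  qed
  then have "1 \<le> measure bids ?E" using finite_measure_mono[OF _ E] 1 by metis
  then show ?thesis unfolding measure_model[OF range_in_sets] using prob_le_1[of ?E] by linarith
qed

end

context second_price
begin

section \<open>Samples and empirical cell frequencies\<close>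

abbreviation "iid n \<equiv> iid_observations n k f"

definition cell :: "nat \<Rightarrow> nat \<Rightarrow> nat \<Rightarrow> (real \<times> nat) set" where
  "cell N i t = {real t / real N<..(real t + 1) / real N} \<times> {i}"

lemma cell_count_eq: "cell_count N n s i t = card {j. j < n \<and> s j \<in> cell N i t}"
  unfolding cell_count_def cell_def by (rule arg_cong[where f = card]) (auto simp: mem_Times_iff)

lemma cell_sets: "cell N i t \<in> sets model"
  unfolding cell_def sets_model by (rule cell_in_sets)

lemma finite_product_iid: "finite_product_prob_space (\<lambda>_. model) {..<n::nat}"
  by (intro finite_product_prob_space.intro finite_product_sigma_finite.intro product_sigma_finite.intro
     product_prob_space.intro product_prob_space_axioms.intro finite_product_sigma_finite_axioms.intro
     prob_space_imp_sigma_finite prob_space_model) auto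

lemma prob_space_iid: "prob_space (iid n)"
  unfolding iid_observations_def using finite_product_iid finite_product_prob_space.axioms(2)
  by (metis prob_space_PiM prob_space_model)

lemma sample_seqs_sets: "sample_seqs n k \<in> sets (iid n)"
  unfolding sample_seqs_def iid_observations_def
  by (rule sets_PiM_I_finite) (simp_all only: finite_lessThan sets_model range_in_sets)

lemma measure_sample_seqs: "measure (iid n) (sample_seqs n k) = 1"
proof -
  interpret finite_product_prob_space "\<lambda>_. model" "{..<n}" by (rule finite_product_iid)
  have "measure (PiM {..<n} (\<lambda>_. model)) (PiE {..<n} (\<lambda>_. {0..1} \<times> {1..k})) =
      (\<Prod>j<n. measure model ({0..1} \<times> {1..k}))"
    by (rule prob_times) (simp only: sets_model range_in_sets)
  then show ?thesis unfolding sample_seqs_def iid_observations_def by (simp only: model_range prod.neutral_const)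
qed

lemma count_measurable: "(\<lambda>s. real (cell_count N n s i t)) \<in> borel_measurable (iid n)"
proof -
  have eq: "real (cell_count N n s i t) = (\<Sum>j<n. indicator (cell N i t) (s j))" for s
  proof -
    have "(\<Sum>j<n. indicator (cell N i t) (s j) :: real) = real (card ({..<n} \<inter> {j. s j \<in> cell N i t}))"
      by (subst sum_indicator_eq_card[symmetric]) (auto simp: indicator_def intro!: sum.cong)
    also have "{..<n} \<inter> {j. s j \<in> cell N i t} = {j. j < n \<and> s j \<in> cell N i t}" by auto
    finally show ?thesis unfolding cell_count_eq by simp
  qed
  have "(\<lambda>s. indicator (cell N i t) (s j) :: real) \<in> borel_measurable (iid n)" if "j \<in> {..<n}" for j
    unfolding iid_observations_def
    by (rule measurable_compose[OF measurable_component_singleton[OF that] borel_measurable_indicator[OF cell_sets]])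
  then show ?thesis unfolding eq by (rule borel_measurable_sum)
qed

definition count_table :: "nat \<Rightarrow> nat \<Rightarrow> (nat \<Rightarrow> real \<times> nat) \<Rightarrow> nat \<Rightarrow> nat \<Rightarrow> nat" where
  "count_table N n s i t = (if i \<in> {1..k} \<and> t < N then cell_count N n s i t else 0)"

text \<open>The learner sees the sample only through the finitely many possible count tables, so no
  measurability of the learner itself has to be established.\<close>

lemma count_table_sets: "{s \<in> sample_seqs n k. Q (count_table N n s)} \<in> sets (iid n)"
proof -
  define V where "V = (\<lambda>w i t. if i \<in> {1..k} \<and> t < N then w (i, t) else 0) `
      (PiE ({1..k} \<times> {..<N}) (\<lambda>_. {..n}))"
  have finV: "finite V" unfolding V_def by (intro finite_imageI finite_PiE) auto
  have inV: "count_table N n s \<in> V" for s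
  proof -
    let ?w = "\<lambda>(i, t)\<in>{1..k} \<times> {..<N}. cell_count N n s i t"
    have "cell_count N n s i t \<le> n" for i t
    proof -
      have "cell_count N n s i t \<le> card {..<n}" unfolding cell_count_def by (intro card_mono) auto
      then show ?thesis by simp
    qed
    then have "?w \<in> PiE ({1..k} \<times> {..<N}) (\<lambda>_. {..n})" by auto
    moreover have "count_table N n s = (\<lambda>i t. if i \<in> {1..k} \<and> t < N then ?w (i, t) else 0)"
      by (intro ext) (simp add: count_table_def)
    ultimately show ?thesis unfolding V_def by blast
  qed
  let ?S = "\<lambda>v. sample_seqs n k \<inter> {s \<in> space (iid n). \<forall>i\<in>{1..k}. \<forall>t\<in>{..<N}. real (cell_count N n s i t) = real (v i t)}"
  have S: "?S v \<in> sets (iid n)" for v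
  proof (intro sets.Int sample_seqs_sets sets.sets_Collect_finite_All)
    fix i t
    show "{s \<in> space (iid n). real (cell_count N n s i t) = real (v i t)} \<in> sets (iid n)"
      by (rule borel_measurable_eq[OF count_measurable borel_measurable_const])
  qed auto
  have "{s \<in> sample_seqs n k. Q (count_table N n s)} = (\<Union>v\<in>{v \<in> V. Q v}. ?S v)"
  proof (intro set_eqI iffI)
    fix s assume s: "s \<in> {s \<in> sample_seqs n k. Q (count_table N n s)}"
    then have "s \<in> ?S (count_table N n s)"
      using sets.sets_into_space[OF sample_seqs_sets[of n]] by (auto simp: count_table_def)
    then show "s \<in> (\<Union>v\<in>{v \<in> V. Q v}. ?S v)" using s inV by blast
  next
    fix s assume "s \<in> (\<Union>v\<in>{v \<in> V. Q v}. ?S v)"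
    then obtain v where v: "v \<in> V" "Q v" "s \<in> sample_seqs n k"
      "\<forall>i\<in>{1..k}. \<forall>t\<in>{..<N}. cell_count N n s i t = v i t" by auto
    have "v i t = 0" if "\<not> (i \<in> {1..k} \<and> t < N)" for i t
      using v(1) that unfolding V_def by auto
    then have "count_table N n s = v"
      using v(4) by (intro ext) (auto simp: count_table_def)
    then show "s \<in> {s \<in> sample_seqs n k. Q (count_table N n s)}" using v by blast
  qed
  also have "\<dots> \<in> sets (iid n)" using finV S by (intro sets.finite_UN) auto
  finally show ?thesis .
qed

definition accurate :: "nat \<Rightarrow> nat \<Rightarrow> (nat \<Rightarrow> nat \<Rightarrow> nat) \<Rightarrow> bool" where
  "accurate N n v \<longleftrightarrow> (\<forall>i\<in>{1..k}. \<forall>t<N. \<bar>real (v i t) / real n - measure model (cell N i t)\<bar> \<le> 1 / real N ^ 3)"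

text \<open>A union bound over the \<open>k * N\<close> cells. Passing from the whole space to
  \<open>sample_seqs\<close> costs nothing, as that set has full measure.\<close>

lemma concentration:
  assumes n: "0 < n"
  shows "1 - 2 * real (k * N) * exp (- 2 * real n * (1 / real N ^ 3)\<^sup>2)
    \<le> measure (iid n) {s \<in> sample_seqs n k. accurate N n (count_table N n s)}"
proof -
  interpret P: prob_space "iid n" by (rule prob_space_iid)
  let ?I = "{1..k} \<times> {..<N}"
  let ?e = "exp (- 2 * real n * (1 / real N ^ 3)\<^sup>2)"
  define bad where "bad = (\<lambda>(i, t). {s \<in> space (iid n).
     1 / real N ^ 3 \<le> \<bar>real (cell_count N n s i t) / n - measure model (cell N i t)\<bar>})"
  have bad_sets: "bad x \<in> sets (iid n)" for x
    unfolding bad_def split_beta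
    by (intro borel_measurable_le borel_measurable_const borel_measurable_abs borel_measurable_diff
      borel_measurable_divide count_measurable)
  have bad: "measure (iid n) (bad x) \<le> 2 * ?e" for x
    using prob_space.Hoeffding_frequency[OF prob_space_model cell_sets n, of "1 / real N ^ 3" N "fst x" "snd x"]
    unfolding bad_def cell_count_eq iid_observations_def split_beta by simp
  have "measure (iid n) (\<Union>x\<in>?I. bad x) \<le> (\<Sum>x\<in>?I. measure (iid n) (bad x))"
    by (intro P.finite_measure_subadditive_finite) (auto simp: bad_sets)
  also have "\<dots> \<le> (\<Sum>x\<in>?I. 2 * ?e)" by (intro sum_mono bad)
  also have "\<dots> = 2 * real (k * N) * ?e" by (simp add: card_cartesian_product)
  finally have U: "measure (iid n) (\<Union>x\<in>?I. bad x) \<le> 2 * real (k * N) * ?e" .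
  let ?E = "{s \<in> sample_seqs n k. accurate N n (count_table N n s)}"
  have E: "?E \<in> sets (iid n)" by (rule count_table_sets)
  have "sample_seqs n k \<subseteq> ?E \<union> (\<Union>x\<in>?I. bad x)"
  proof
    fix s assume s: "s \<in> sample_seqs n k"
    show "s \<in> ?E \<union> (\<Union>x\<in>?I. bad x)"
    proof (cases "accurate N n (count_table N n s)")
      case True
      then show ?thesis using s by blast
    next
      case False
      then obtain i t where it: "i \<in> {1..k}" "t < N"
        "\<not> \<bar>real (count_table N n s i t) / real n - measure model (cell N i t)\<bar> \<le> 1 / real N ^ 3"
        unfolding accurate_def by blast
      then have "s \<in> bad (i, t)"
        using s sets.sets_into_space[OF sample_seqs_sets[of n]] by (auto simp: bad_def count_table_def)
      then show ?thesis using it by blast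
    qed
  qed
  then have "measure (iid n) (sample_seqs n k) \<le> measure (iid n) (?E \<union> (\<Union>x\<in>?I. bad x))"
    using E bad_sets by (intro P.finite_measure_mono) auto
  also have "\<dots> \<le> measure (iid n) ?E + measure (iid n) (\<Union>x\<in>?I. bad x)"
    using E bad_sets by (intro measure_Un_le) auto
  finally show ?thesis using U unfolding measure_sample_seqs by linarith
qed

end

section \<open>The learner\<close>

context second_price
begin

lemma grid_error:
  assumes k: "2 \<le> k" and N: "1 \<le> N" and x0: "0 < x0" "x0 \<le> 1" "real k \<le> real N * x0"
    and acc: "accurate N n v"
  shows "auction_grid k N \<alpha> \<eta> x0 (\<lambda>i t. F i (real t / real N)) (\<lambda>i t. measure model (cell N i t))
     (\<lambda>i t. real (v i t) / real n)"
proof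
  have one: "1 \<in> {1..k}" using k by simp
  note const = bounded_density_constants[OF \<alpha> f[OF one]]
  have Np: "0 < real N" using N by simp
  have div: "real (Suc t) / real N = (real t + 1) / real N" "real t / real N \<le> (real t + 1) / real N"
    "0 \<le> real t / real N" for t
    by (simp_all add: add.commute divide_right_mono)
  have le1: "(real t + 1) / real N \<le> 1" if "t < N" for t using that by simp
  have diff: "(real t + 1) / real N - real t / real N = 1 / real N" for t by (simp add: add_divide_distrib)
  show "\<alpha> \<le> 1" "\<alpha> \<le> \<eta>" using const by auto
  show "F i (real 0 / real N) = 0" if "i \<in> {1..k}" for i using cdf_bid_law(1)[OF \<alpha> f[OF that]] by simp
  show "F i (real N / real N) = 1" if "i \<in> {1..k}" for i using cdf_bid_law(2)[OF \<alpha> f[OF that]] Np by simp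
  show "\<alpha> / real N \<le> F i (real (Suc t) / real N) - F i (real t / real N)" if "i \<in> {1..k}" "t < N" for i t
    using cdf_bid_law(3)[OF \<alpha> f[OF that(1)] div(3) div(2) le1[OF that(2)]] unfolding div(1) diff by simp
  show "F i (real (Suc t) / real N) - F i (real t / real N) \<le> \<eta> / real N" if "i \<in> {1..k}" "t < N" for i t
    using cdf_bid_law(4)[OF \<alpha> f[OF that(1)] div(3) div(2) le1[OF that(2)]] unfolding div(1) diff by simp
  show "(1 - F i (real (Suc t) / real N)) * ((\<Prod>j\<in>{1..k} - {i}. F j (real (Suc t) / real N))
       - (\<Prod>j\<in>{1..k} - {i}. F j (real t / real N))) \<le> measure model (cell N i t)"
    if "i \<in> {1..k}" "t < N" for i t
    unfolding div(1) cell_def by (rule model_cell_bounds(1)[OF that(1) div(2)])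
  show "measure model (cell N i t) \<le> (1 - F i (real t / real N)) * ((\<Prod>j\<in>{1..k} - {i}. F j (real (Suc t) / real N))
       - (\<Prod>j\<in>{1..k} - {i}. F j (real t / real N)))"
    if "i \<in> {1..k}" "t < N" for i t
    unfolding div(1) cell_def by (rule model_cell_bounds(2)[OF that(1) div(2)])
  show "\<bar>real (v i t) / real n - measure model (cell N i t)\<bar> \<le> 1 / real N ^ 3" if "i \<in> {1..k}" "t < N" for i t
    using acc that unfolding accurate_def by blast
qed (use \<alpha> k N x0 in auto)

text \<open>Half of \<open>\<epsilon>\<close> is spent on the error at the left end of the cell,
  half on the growth of \<open>F i\<close> inside it, at most \<open>\<eta> / N\<close>. At 1 both
  functions equal 1.\<close>

lemma step_fun_error:
  assumes i: "i \<in> {1..k}" and N: "1 \<le> N" and g: "g 0 = 0"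
    and err: "\<And>l. l < N \<Longrightarrow> \<bar>g (Suc l) - F i (real l / real N)\<bar> \<le> \<epsilon> / 2" and "\<eta> / N \<le> \<epsilon> / 2"
  shows "(SUP x\<in>{0..1}. \<bar>step_fun N g x - F i x\<bar>) \<le> \<epsilon>"
proof (rule cSUP_least)
  note cdf = cdf_bid_law[OF \<alpha> f[OF i]]
  have "0 \<le> \<epsilon> / 2" using order_trans[OF abs_ge_zero err[of 0]] N by simp
  then have \<epsilon>: "0 \<le> \<epsilon>" by simp
  fix x :: real assume x: "x \<in> {0..1}"
  show "\<bar>step_fun N g x - F i x\<bar> \<le> \<epsilon>"
  proof (cases "x = 1")
    case True
    then show ?thesis using step_fun_ge_1[of x g N] g cdf(2) \<epsilon> by simp
  next
    case False
    with x have x': "0 \<le> x" "x < 1" by auto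
    have N0: "0 < N" using N by simp
    define l where "l = nat \<lfloor>real N * x\<rfloor>"
    note st = step_fun_inside[of x N g, OF x' N0 g, folded l_def]
    have "F i (real l / real N) \<le> F i x" using cdf(5) st(2) by blast
    moreover have "F i x - F i (real l / real N) \<le> \<eta> * (x - real l / real N)"
      using cdf(4)[of "real l / real N" x] st(2) x' by simp
    moreover have "\<eta> * (x - real l / real N) \<le> \<eta> * (1 / N)"
      using st(3) bounded_density_constants(2)[OF \<alpha> f[OF i]]
      by (intro mult_left_mono) (auto simp: add_divide_distrib)
    moreover have "\<eta> * (1 / N) = \<eta> / N" by simp
    ultimately show ?thesis using err[OF st(1)] assms(5) unfolding st(4) by linarith
  qed
qed simp

end

section \<open>Running time, sample size and conclusion\<close>

lemma mono_est_props:
  "mono_est x0 N k q t i \<le> mono_est x0 N k q (Suc t) i" "mono_est x0 N k q t i \<le> 1"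
proof -
  show "mono_est x0 N k q t i \<le> mono_est x0 N k q (Suc t) i" by simp
  show "mono_est x0 N k q t i \<le> 1" by (induction t) auto
qed

text \<open>This is \<open>learner_time\<close> with \<open>N\<close> and \<open>k\<close> both
  replaced by \<open>n\<close>.\<close>

definition time_poly :: "nat poly" where
  "time_poly = [:28, 27, 30, 7:]"

lemma learner_time_le:
  assumes "N \<le> n" "k \<le> n"
  shows "learner_time n k N \<le> poly time_poly n" "N + 1 \<le> poly time_poly n"
proof -
  have "learner_time n k N \<le> 28 + 7 * n + 3 * n + 3 * n + n * (14 + 3 * n + n * (9 + 3 * n) + n * (18 + 4 * n))"
    unfolding learner_time_def using assms by (intro add_mono mult_mono order_refl) auto
  also have "\<dots> = poly time_poly n" unfolding time_poly_def by (simp add: algebra_simps)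
  finally show "learner_time n k N \<le> poly time_poly n" .
  show "N + 1 \<le> poly time_poly n"
  proof -
    have "poly time_poly n = 28 + 27 * n + (30 * n * n + 7 * n * n * n)"
      unfolding time_poly_def by (simp add: algebra_simps)
    then show ?thesis using assms by linarith
  qed
qed

text \<open>The exponent 10 splits as 6 + 2 + 2: precision \<open>1 / N ^ 3\<close> enters squared
  and gives \<open>N ^ 6\<close>; the number of cells, controlled through the crude
  \<open>ln z \<le> z\<close>, gives \<open>Y\<^sup>2\<close>; another \<open>Y\<^sup>2\<close>
  absorbs the numerical factor.\<close>

lemma exp_tail_bound:
  fixes Y M \<rho> :: real and N n k :: nat
  assumes Y: "256 \<le> Y" "Y \<le> N" "N \<le> 2 * Y" "k \<le> Y" and n: "Y ^ 10 * M \<le> n" and k: "1 \<le> k"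
    and M: "1 \<le> M" "ln (1 / \<rho>) \<le> M" and \<rho>: "0 < \<rho>"
  shows "2 * real (k * N) * exp (- 2 * real n * (1 / real N ^ 3)\<^sup>2) \<le> \<rho>"
proof -
  have Yp: "0 < Y" using Y by simp
  have Np: "0 < real N" using Y by linarith
  have "real N ^ 6 \<le> (2 * Y) ^ 6" using Y by (intro power_mono) auto
  then have N6: "real N ^ 6 \<le> 64 * Y ^ 6" by (simp add: power_mult_distrib)
  have "5 * Y\<^sup>2 * M * real N ^ 6 \<le> 5 * Y\<^sup>2 * M * (64 * Y ^ 6)"
    using N6 M by (intro mult_left_mono) auto
  also have "\<dots> = 320 * (Y ^ 8 * M)" by (simp add: power_add[symmetric] mult.commute mult.left_commute)
  also have "\<dots> \<le> (2 * Y\<^sup>2) * (Y ^ 8 * M)"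
  proof (rule mult_right_mono)
    have "256 * 256 \<le> Y * Y" using Y by (intro mult_mono) auto
    then show "320 \<le> 2 * Y\<^sup>2" by (simp add: power2_eq_square)
  qed (use M in auto)
  also have "\<dots> = 2 * (Y ^ 10 * M)" by (simp flip: power_add)
  also have "\<dots> \<le> 2 * real n" using n by simp
  finally have big: "5 * Y\<^sup>2 * M \<le> 2 * real n / real N ^ 6" using Np by (simp add: pos_le_divide_eq)
  have kN: "2 * real (k * N) \<le> 4 * Y\<^sup>2"
  proof -
    have "real k * real N \<le> Y * (2 * Y)" using Y by (intro mult_mono) auto
    then show ?thesis by (simp add: power2_eq_square mult_ac)
  qed
  have "0 < k * N" using k Np by simp
  then have kNp: "0 < 2 * real (k * N)" by (simp only: of_nat_0_less_iff zero_less_mult_iff) simp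
  have Y2: "0 \<le> Y\<^sup>2" by simp
  have "ln (2 * real (k * N)) \<le> 2 * real (k * N)" using ln_less_self[OF kNp] by simp
  then have "ln (2 * real (k * N)) + ln (1 / \<rho>) \<le> 4 * Y\<^sup>2 * 1 + 1 * M" using kN M by linarith
  also have "\<dots> \<le> 4 * Y\<^sup>2 * M + Y\<^sup>2 * M"
  proof (intro add_mono mult_left_mono mult_right_mono)
    have "1 * 1 \<le> Y * Y" using Y by (intro mult_mono) auto
    then show "1 \<le> Y\<^sup>2" by (simp add: power2_eq_square)
  qed (use M in auto)
  also have "\<dots> \<le> 2 * real n / real N ^ 6"
  proof -
    have "4 * Y\<^sup>2 * M + Y\<^sup>2 * M = 5 * Y\<^sup>2 * M" by simp
    then show ?thesis using big by (simp only:)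
  qed
  finally have "ln (2 * real (k * N)) + ln (1 / \<rho>) \<le> 2 * real n / real N ^ 6" .
  then have "ln (2 * real (k * N)) - 2 * real n / real N ^ 6 \<le> ln \<rho>" using \<rho> by (simp add: ln_div)
  then have "exp (ln (2 * real (k * N)) - 2 * real n / real N ^ 6) \<le> exp (ln \<rho>)" by (simp only: exp_le_cancel_iff)
  moreover have "exp (ln (2 * real (k * N)) - 2 * real n / real N ^ 6)
      = 2 * real (k * N) * exp (- 2 * real n * (1 / real N ^ 3)\<^sup>2)"
  proof -
    have "(1 / real N ^ 3)\<^sup>2 = 1 / real N ^ 6" by (simp add: power_divide flip: power_mult)
    then have "- 2 * real n * (1 / real N ^ 3)\<^sup>2 = - (2 * real n / real N ^ 6)" by simp
    then show ?thesis using kNp by (simp only: exp_diff exp_ln exp_minus divide_inverse)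
  qed
  ultimately show ?thesis using \<rho> by simp
qed

lemma grid_size_bounds:
  assumes "0 < \<epsilon>" "\<epsilon> < 1"
  shows "(1 / \<epsilon>) ^ (c * k) \<le> grid_size c k \<epsilon>" "grid_size c k \<epsilon> \<le> 2 * (1 / \<epsilon>) ^ (c * k)"
proof -
  have eq: "(1 / \<epsilon> ^ c) ^ k = (1 / \<epsilon>) ^ (c * k)" by (simp add: power_mult power_one_over)
  have 1: "1 \<le> (1 / \<epsilon>) ^ (c * k)" using assms by (intro one_le_power) simp
  show "(1 / \<epsilon>) ^ (c * k) \<le> grid_size c k \<epsilon>" "grid_size c k \<epsilon> \<le> 2 * (1 / \<epsilon>) ^ (c * k)"
    unfolding grid_size_def eq using 1 by linarith+
qed

text \<open>Although \<open>N\<close> is exponential in \<open>k\<close>, the sample size exceeds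
  it: \<open>n\<close> is at least \<open>Y ^ 10\<close> and \<open>N \<le> 2 * Y\<close>. This
  makes the running time and the table polynomial in \<open>n\<close>.\<close>

lemma learner_correct:
  fixes \<alpha> \<eta> C K \<epsilon> \<rho> :: real and c1 c2 k n :: nat and f :: "nat \<Rightarrow> real \<Rightarrow> real"
  defines "C \<equiv> 8 * \<eta>\<^sup>2 / \<alpha>\<^sup>2"
  assumes \<alpha>: "0 < \<alpha>"
    and K: "256 \<le> K" "1 / \<alpha> \<le> K" "256 * \<eta> / \<alpha> \<le> K" "2 powr C \<le> K" "4 * (8 * \<eta>) powr C \<le> K"
      "(6 + 2 * \<eta>) * 8 * \<eta>\<^sup>2 / \<alpha>\<^sup>2 \<le> K"
    and c1: "4 \<le> c1" "C + 4 \<le> c1 * (\<alpha> / \<eta>) / 2" and c2: "2 * c1 + C + 7 \<le> c2"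
    and k: "2 \<le> k" and f: "\<And>i. i \<in> {1..k} \<Longrightarrow> bounded_density \<alpha> \<eta> (f i)"
    and \<epsilon>: "0 < \<epsilon>" "\<epsilon> < 1" "K ^ k \<le> 1 / \<epsilon>" and \<rho>: "0 < \<rho>" "\<rho> < 1"
    and n: "((1 / \<epsilon>) ^ (c2 * k)) ^ 10 * max 1 (ln (1 / \<rho>)) \<le> n"
  defines "out \<equiv> \<lambda>s. result (learner c1 c2) (learner_input n k \<epsilon> \<rho> s)"
  shows "halts_within (learner c1 c2) (learner_input n k \<epsilon> \<rho> s) (poly time_poly n)"
    "table_size (out s) \<le> poly time_poly n"
    "i \<in> {1..k} \<Longrightarrow> is_cdf (table_fun (out s) i)"
    "1 - \<rho> \<le> measure (iid_observations n k f) {s \<in> sample_seqs n k.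
        \<forall>i\<in>{1..k}. (SUP x\<in>{0..1}. \<bar>table_fun (out s) i x - cdf (bid_law (f i)) x\<bar>) \<le> \<epsilon>}"
proof -
  interpret sp: second_price k \<alpha> \<eta> f by unfold_locales (use k \<alpha> f in auto)
  have "1 \<in> {1..k}" using k by simp
  note const = bounded_density_constants[OF \<alpha> f[OF this]]
  define y where "y = 1 / \<epsilon>"
  define Y where "Y = y ^ (c2 * k)"
  define N where "N = grid_size c2 k \<epsilon>"
  define x0 where "x0 = \<epsilon> ^ c1"
  have Ky: "K \<le> y" using \<epsilon>(3) self_le_power[of K k] K k unfolding y_def by linarith
  have y: "256 \<le> y" using Ky K by simp
  have C0: "0 \<le> C" unfolding C_def by simp
  have ky: "real k \<le> y"
  proof -
    have "real k \<le> 2 ^ k" using of_nat_less_two_power[of k, where ?'a = real] by linarith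
    also have "\<dots> \<le> K ^ k" using K by (intro power_mono) auto
    finally show ?thesis using \<epsilon>(3) unfolding y_def by linarith
  qed
  have c2c1: "c1 + 1 \<le> c2" using c2 C0 by linarith
  have c2k: "c1 + 1 \<le> c2 * k" using c2c1 k by (metis le_trans mult.right_neutral mult_le_mono2 one_le_numeral)
  have yY: "y ^ (c1 + 1) \<le> Y" unfolding Y_def using y c2k by (intro power_increasing) auto
  have "y ^ 1 \<le> y ^ (c1 + 1)" using y by (intro power_increasing) auto
  then have Y: "y \<le> Y" using yY by simp
  have NY: "Y \<le> N" "N \<le> 2 * Y"
    using grid_size_bounds[OF \<epsilon>(1,2), of c2 k] unfolding N_def Y_def y_def by auto
  have N1: "1 \<le> N" using NY(1) Y y by linarith
  have nY: "Y ^ 10 * max 1 (ln (1 / \<rho>)) \<le> n" using n unfolding Y_def y_def .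
  have n2Y: "2 * Y \<le> n"
  proof -
    have "2 * Y \<le> Y * Y" using Y y by (intro mult_right_mono) auto
    also have "\<dots> \<le> Y ^ 10 * 1"
      using Y y power_increasing[of 2 10 Y] by (simp add: power2_eq_square)
    also have "\<dots> \<le> Y ^ 10 * max 1 (ln (1 / \<rho>))" using Y y by (intro mult_left_mono) auto
    finally show ?thesis using nY by linarith
  qed
  have Nn: "N \<le> n" using n2Y NY by linarith
  have kn: "k \<le> n" using ky Y y n2Y by linarith
  have n0: "0 < n" using kn k by linarith
  have x0: "0 < x0" "x0 \<le> 1" "real k \<le> real N * x0"
  proof -
    show "0 < x0" "x0 \<le> 1" unfolding x0_def using \<epsilon> by (auto intro: power_le_one)
    have "x0 * y ^ c1 = 1" unfolding x0_def y_def using \<epsilon> by (simp flip: power_mult_distrib)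
    then have "y = y ^ (c1 + 1) * x0" by (simp add: mult.commute)
    also have "\<dots> \<le> N * x0" using yY NY \<open>0 < x0\<close> by (intro mult_right_mono) auto
    finally show "real k \<le> real N * x0" using ky by linarith
  qed
  have x0y: "x0 = 1 / y ^ c1" unfolding x0_def y_def by (simp add: power_one_over)
  define g where "g = (\<lambda>(v :: nat \<Rightarrow> nat \<Rightarrow> nat) i t. mono_est x0 N k (\<lambda>i t. real (v i t) / real n) t i)"
  have wp: "wp (learner c1 c2) (learner_time n k N)
    (\<lambda>s'. table_size s' = N + 1 \<and>
       (\<forall>i\<in>{1..k}. table_fun s' i = step_fun N (g (sp.count_table N n s) i)))
    (learner_input n k \<epsilon> \<rho> s)" for s
    unfolding g_def x0_def
    by (rule learner_wp[OF N_def]) (simp add: sp.count_table_def)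
  note res = wp_result[OF wp]
  have tab: "table_size (out s) = N + 1" "\<And>i. i \<in> {1..k} \<Longrightarrow> table_fun (out s) i = step_fun N (g (sp.count_table N n s) i)" for s
    unfolding out_def using res(2)[of s] by blast+
  show "halts_within (learner c1 c2) (learner_input n k \<epsilon> \<rho> s) (poly time_poly n)"
    using res(1) learner_time_le(1)[OF Nn kn] unfolding halts_within_def by (meson le_trans)
  show "table_size (out s) \<le> poly time_poly n" unfolding tab(1) by (rule learner_time_le(2)[OF Nn kn])
  show "is_cdf (table_fun (out s) i)" if "i \<in> {1..k}"
    unfolding tab(2)[OF that] g_def by (rule is_cdf_step_fun) (simp_all only: mono_est.simps(1) mono_est_props)
  let ?Q = "\<lambda>v. \<forall>i\<in>{1..k}. (SUP x\<in>{0..1}. \<bar>step_fun N (g v i) x - cdf (bid_law (f i)) x\<bar>) \<le> \<epsilon>"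
  have good: "?Q v" if acc: "sp.accurate N n v" for v
  proof
    fix i assume i: "i \<in> {1..k}"
    interpret auction_grid k N \<alpha> \<eta> x0 "\<lambda>i t. cdf (bid_law (f i)) (real t / real N)"
      "\<lambda>i t. measure (second_price_model k f) (sp.cell N i t)" "\<lambda>i t. real (v i t) / real n"
      by (rule sp.grid_error[OF k N1 x0 acc])
    have K2: "2 \<le> K" using K by simp
    note est = estimate_error[OF const(2) \<epsilon>(3)[folded y_def] x0y NY(1)[unfolded Y_def]
      K2 K(2-6)[unfolded C_def] c1(1) c1(2)[unfolded C_def] c2[unfolded C_def] i]
    have \<epsilon>y: "1 / (2 * y) = \<epsilon> / 2" unfolding y_def by simp
    show "(SUP x\<in>{0..1}. \<bar>step_fun N (g v i) x - cdf (bid_law (f i)) x\<bar>) \<le> \<epsilon>"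
    proof (rule sp.step_fun_error[OF i N1])
      show "g v i 0 = 0" unfolding g_def by simp
      show "\<bar>g v i (Suc l) - cdf (bid_law (f i)) (real l / real N)\<bar> \<le> \<epsilon> / 2" if "l < N" for l
        using est(1)[OF that] unfolding \<epsilon>y g_def .
      show "\<eta> / real N \<le> \<epsilon> / 2" using est(2)[of 0] N1 unfolding \<epsilon>y by simp
    qed
  qed
  have "1 - \<rho> \<le> 1 - 2 * real (k * N) * exp (- 2 * real n * (1 / real N ^ 3)\<^sup>2)"
    using exp_tail_bound[OF _ NY _ nY _ _ _ \<rho>(1), of k] y Y ky k by simp
  also have "\<dots> \<le> measure (iid_observations n k f) {s \<in> sample_seqs n k. sp.accurate N n (sp.count_table N n s)}"
    by (rule sp.concentration[OF n0])
  also have "\<dots> \<le> measure (iid_observations n k f) {s \<in> sample_seqs n k. ?Q (sp.count_table N n s)}"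
  proof -
    interpret prob_space "iid_observations n k f" by (rule sp.prob_space_iid)
    show ?thesis
      by (rule finite_measure_mono[OF _ sp.count_table_sets]) (use good in blast)
  qed
  also have "{s \<in> sample_seqs n k. ?Q (sp.count_table N n s)} = {s \<in> sample_seqs n k.
        \<forall>i\<in>{1..k}. (SUP x\<in>{0..1}. \<bar>table_fun (out s) i x - cdf (bid_law (f i)) x\<bar>) \<le> \<epsilon>}"
    using tab(2) by (intro Collect_cong conj_cong ball_cong refl) (simp only:)
  finally show "1 - \<rho> \<le> measure (iid_observations n k f) {s \<in> sample_seqs n k.
        \<forall>i\<in>{1..k}. (SUP x\<in>{0..1}. \<bar>table_fun (out s) i x - cdf (bid_law (f i)) x\<bar>) \<le> \<epsilon>}" .
qed

text \<open>The choice \<open>C1 = ln K\<close> turns the bound on \<open>\<epsilon>\<close> into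
  \<open>K ^ k \<le> 1 / \<epsilon>\<close>; \<open>C2 = 10 * c2\<close> combines the exponent of
  the mesh with that of \<open>exp_tail_bound\<close>. The maximum with 1 keeps \<open>n\<close>
  above the grid size even when \<open>\<rho>\<close> is close to 1. The program depends on
  \<open>\<alpha>\<close> and \<open>\<eta>\<close> through the constants \<open>c1\<close> and
  \<open>c2\<close> in its text.\<close>

theorem theorem3p3:
  fixes \<alpha> \<eta> :: real
  assumes "\<alpha> > 0" and "\<eta> > 0"
  shows "\<exists>C1 C2 :: real. C1 > 0 \<and> C2 > 0 \<and>
    (\<exists>(A :: prog) (p :: nat poly).
      \<forall>(k :: nat) (f :: nat \<Rightarrow> real \<Rightarrow> real) (\<epsilon> :: real) (\<rho> :: real) (n :: nat).
        k \<ge> 2 \<longrightarrow>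
        (\<forall>i\<in>{1..k}. bounded_density \<alpha> \<eta> (f i)) \<longrightarrow>
        0 < \<epsilon> \<longrightarrow> \<epsilon> < 1 \<longrightarrow>
        0 < \<rho> \<longrightarrow> \<rho> < 1 \<longrightarrow>
        \<epsilon> \<le> exp (- C1 * real k) \<longrightarrow>
        real n \<ge> (1 / \<epsilon>) powr (C2 * real k) * max 1 (ln (1 / \<rho>)) \<longrightarrow>
        (let F = (\<lambda>i. cdf (bid_law (f i)));
             out = (\<lambda>s. result A (learner_input n k \<epsilon> \<rho> s));
             F_hat = (\<lambda>s. table_fun (out s))
         in
          (\<forall>s\<in>sample_seqs n k.
             halts_within A (learner_input n k \<epsilon> \<rho> s) (poly p n) \<and>
             table_size (out s) \<le> poly p n \<and>
             (\<forall>i\<in>{1..k}. is_cdf (F_hat s i))) \<and>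
          measure (iid_observations n k f)
            {s \<in> sample_seqs n k.
               \<forall>i\<in>{1..k}. (SUP x\<in>{0..1}. \<bar>F_hat s i x - F i x\<bar>) \<le> \<epsilon>} \<ge> 1 - \<rho>))"
proof -
  define C where "C = 8 * \<eta>\<^sup>2 / \<alpha>\<^sup>2"
  define c1 where "c1 = nat \<lceil>2 * (C + 4) * (\<eta> / \<alpha>)\<rceil> + 4"
  define c2 where "c2 = nat \<lceil>2 * c1 + C + 7\<rceil>"
  define K where "K = Max {256, 1 / \<alpha>, 256 * \<eta> / \<alpha>, 2 powr C, 4 * (8 * \<eta>) powr C,
     (6 + 2 * \<eta>) * 8 * \<eta>\<^sup>2 / \<alpha>\<^sup>2}"
  have K: "256 \<le> K" "1 / \<alpha> \<le> K" "256 * \<eta> / \<alpha> \<le> K" "2 powr C \<le> K" "4 * (8 * \<eta>) powr C \<le> K"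
      "(6 + 2 * \<eta>) * 8 * \<eta>\<^sup>2 / \<alpha>\<^sup>2 \<le> K"
    unfolding K_def by (rule Max_ge; simp)+
  have C0: "0 \<le> C" unfolding C_def by simp
  have c1: "4 \<le> c1" "C + 4 \<le> c1 * (\<alpha> / \<eta>) / 2"
  proof -
    have "2 * (C + 4) * (\<eta> / \<alpha>) \<le> c1" unfolding c1_def by linarith
    then have "2 * (C + 4) * (\<eta> / \<alpha>) * (\<alpha> / \<eta>) \<le> c1 * (\<alpha> / \<eta>)" using assms by (intro mult_right_mono) auto
    also have "2 * (C + 4) * (\<eta> / \<alpha>) * (\<alpha> / \<eta>) = (C + 4) * 2" using assms by simp
    finally show "C + 4 \<le> c1 * (\<alpha> / \<eta>) / 2"
      by (rule iffD2[OF pos_le_divide_eq[OF zero_less_numeral]])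
  qed (simp add: c1_def)
  have c2: "2 * c1 + C + 7 \<le> c2" unfolding c2_def by linarith
  have c2p: "0 < c2" using c2 C0 by linarith
  note correct = learner_correct[OF assms(1) K[unfolded C_def] c1(1) c1(2)[unfolded C_def] c2[unfolded C_def]]
  show ?thesis
  proof (rule exI[of _ "ln K"], rule exI[of _ "10 * real c2"],
      intro conjI exI[of _ "learner c1 c2"] exI[of _ time_poly] allI impI)
    show "0 < ln K" "0 < 10 * real c2" using K c2p by auto
    fix k f \<epsilon> \<rho> n
    assume k: "2 \<le> k" and f: "\<forall>i\<in>{1..k}. bounded_density \<alpha> \<eta> (f i)"
      and \<epsilon>: "0 < \<epsilon>" "\<epsilon> < (1::real)" and \<rho>: "0 < \<rho>" "\<rho> < (1::real)"
      and \<epsilon>K: "\<epsilon> \<le> exp (- ln K * real k)"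
      and n: "(1 / \<epsilon>) powr (10 * real c2 * real k) * max 1 (ln (1 / \<rho>)) \<le> real n"
    have "exp (- ln K * real k) = 1 / K ^ k"
    proof -
      have "exp (- ln K * real k) = inverse (exp (real k * ln K))" by (simp add: exp_minus mult.commute)
      also have "exp (real k * ln K) = K ^ k" using K(1) by (simp add: exp_of_nat_mult)
      finally show ?thesis by (simp add: inverse_eq_divide)
    qed
    with \<epsilon>K have "\<epsilon> \<le> 1 / K ^ k" by simp
    moreover have "0 < K ^ k" using K(1) by simp
    ultimately have \<epsilon>3: "K ^ k \<le> 1 / \<epsilon>" using \<epsilon> by (simp add: field_simps)
    have "(1 / \<epsilon>) powr (10 * real c2 * real k) = ((1 / \<epsilon>) ^ (c2 * k)) ^ 10"
    proof -
      have "10 * real c2 * real k = real (c2 * k * 10)" by simp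
      then have "(1 / \<epsilon>) powr (10 * real c2 * real k) = (1 / \<epsilon>) ^ (c2 * k * 10)"
        using \<epsilon> by (simp only: powr_realpow zero_less_divide_1_iff)
      then show ?thesis by (simp only: power_mult)
    qed
    with n have n': "((1 / \<epsilon>) ^ (c2 * k)) ^ 10 * max 1 (ln (1 / \<rho>)) \<le> real n" by simp
    have f': "bounded_density \<alpha> \<eta> (f i)" if "i \<in> {1..k}" for i using f that by blast
    note final = correct[where f = f, OF k f' \<epsilon> \<epsilon>3 \<rho> n']
    show "let F = (\<lambda>i. cdf (bid_law (f i)));
             out = (\<lambda>s. result (learner c1 c2) (learner_input n k \<epsilon> \<rho> s));
             F_hat = (\<lambda>s. table_fun (out s))
         in
          (\<forall>s\<in>sample_seqs n k.
             halts_within (learner c1 c2) (learner_input n k \<epsilon> \<rho> s) (poly time_poly n) \<and>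
             table_size (out s) \<le> poly time_poly n \<and>
             (\<forall>i\<in>{1..k}. is_cdf (F_hat s i))) \<and>
          measure (iid_observations n k f)
            {s \<in> sample_seqs n k.
               \<forall>i\<in>{1..k}. (SUP x\<in>{0..1}. \<bar>F_hat s i x - F i x\<bar>) \<le> \<epsilon>} \<ge> 1 - \<rho>"
      unfolding Let_def using final by blast
  qed
qed

end
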